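(* Let $\{A_j\}_{j=0,1,2}$ be D-minimal or V-minimal cones in $\mathbb{R}^2$ with vertices at the origin, each $A_j$ being nonempty. Then each $A_j$ is formed of precisely one connected component, and the angle condition $$\frac{\sin\gamma_{01}}{\sigma_{01}}=\frac{\sin\gamma_{02}}{\sigma_{02}}=\frac{\sin\gamma_{12}}{\sigma_{12}}$$ is satisfied, where $\gamma_{12}$ is the angle at the origin measured within $A_0$, $\gamma_{02}$ the angle measured within $A_1$, and $\gamma_{01}$ the angle measured within $A_2$.
   Context: Constants: $\sigma_{01},\sigma_{02},\sigma_{12}$ are surface tensions, $\alpha_0=\frac12(\sigma_{01}+\sigma_{02}-\sigma_{12})$, $\alpha_1=\frac12(\sigma_{01}+\sigma_{12}-\sigma_{02})$, $\alpha_2=\frac12(\sigma_{02}+\sigma_{12}-\sigma_{01})$, and $\alpha_j>0$ for all $j$ (strict triangle inequality). A triple of open sets $\{A_j\}$ in $\mathbb{R}^2$ is permissible if the $A_j$ are disjoint sets of locally finite perimeter and the union of their closures is $\mathbb{R}^2$. Sets of finite perimeter are considered up to Lebesgue null sets, normalized so that the topological boundary of $A_j$ is the support of $D\chi_{A_j}$. $\mathcal{F}_S(\{A_j\},\Omega')=\sum_{j=0}^2\alpha_j\int_{\Omega'}|D\chi_{A_j}|$. A permissible triple $\{A_j\}$ is D-minimal in $\mathbb{R}^2$ if for every bounded open $U\subset\mathbb{R}^2$ and every permissible $\{\tilde A_j\}$ with $\mathrm{spt}(\chi_{A_j}-\chi_{\tilde A_j})\subset U$ for all $j$, $\mathcal{F}_S(\{A_j\},U)\le\mathcal{F}_S(\{\tilde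 A_j\},U)$. It is V-minimal if this holds for all such $\{\tilde A_j\}$ satisfying in addition $|\tilde A_j\cap U|=|A_j\cap U|$, $j=0,1,2$. A cone with vertex at the origin is a set invariant under $x\mapsto tx$ for all $t>0$. *)

theory Defs
  imports "HOL-Analysis.Analysis"
begin

definition spt :: "('a::topological_space \<Rightarrow> 'b::zero) \<Rightarrow> 'a set" where
  "spt f = closure {x. f x \<noteq> 0}"

definition divergence :: "('a::euclidean_space \<Rightarrow> 'a) \<Rightarrow> 'a \<Rightarrow> real" where
  "divergence \<phi> x = (\<Sum>b\<in>Basis. frechet_derivative \<phi> (at x) b \<bullet> b)"

(* Compactly supported C^1 vector fields on the open set Omega, extended by zero, of norm at most 1.
   In finite dimension, continuity of all directional derivatives is continuity of the derivative. *)
definition test_fields :: "'a::euclidean_space set \<Rightarrow> ('a \<Rightarrow> 'a) set" where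
  "test_fields \<Omega> = {\<phi>.
     (\<forall>x. \<phi> differentiable (at x)) \<and>
     (\<forall>v. continuous_on UNIV (\<lambda>x. frechet_derivative \<phi> (at x) v)) \<and>
     compact (spt \<phi>) \<and> spt \<phi> \<subseteq> \<Omega> \<and> (\<forall>x. norm (\<phi> x) \<le> 1)}"

(* The total variation of the distributional gradient of the characteristic function of E
   on the open set Omega. *)
definition perimeter :: "'a::euclidean_space set \<Rightarrow> 'a set \<Rightarrow> ereal" where
  "perimeter E \<Omega> = (SUP \<phi>\<in>test_fields \<Omega>. ereal (LINT x:E|lebesgue. divergence \<phi> x))"

definition locally_finite_perimeter :: "'a::euclidean_space set \<Rightarrow> bool" where
  "locally_finite_perimeter E \<longleftrightarrow>
     E \<in> sets lebesgue \<and> (\<forall>U. open U \<and> bounded U \<longrightarrow> perimeter E U < \<infinity>)"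

(* Support of the measure given by the gradient of the characteristic function of E. *)
definition perimeter_support :: "'a::euclidean_space set \<Rightarrow> 'a set" where
  "perimeter_support E = {x. \<forall>U. open U \<and> x \<in> U \<longrightarrow> 0 < perimeter E U}"

(* Triples are functions on nat, of which only the values at 0, 1, 2 matter.
   The frontier condition selects the normalized representative modulo null sets. *)
definition permissible :: "(nat \<Rightarrow> (real^2) set) \<Rightarrow> bool" where
  "permissible A \<longleftrightarrow>
     (\<forall>j\<le>2. open (A j) \<and> locally_finite_perimeter (A j) \<and> frontier (A j) = perimeter_support (A j)) \<and>
     disjoint_family_on A {..2} \<and>
     (\<Union>j\<le>2. closure (A j)) = UNIV"

definition tension_coeff :: "real \<Rightarrow> real \<Rightarrow> real \<Rightarrow> nat \<Rightarrow> real" where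
  "tension_coeff \<sigma>01 \<sigma>02 \<sigma>12 j =
     (if j = 0 then (\<sigma>01 + \<sigma>02 - \<sigma>12) / 2
      else if j = 1 then (\<sigma>01 + \<sigma>12 - \<sigma>02) / 2
      else (\<sigma>02 + \<sigma>12 - \<sigma>01) / 2)"

definition surface_energy :: "(nat \<Rightarrow> real) \<Rightarrow> (nat \<Rightarrow> (real^2) set) \<Rightarrow> (real^2) set \<Rightarrow> ereal" where
  "surface_energy \<alpha> A \<Omega> = (\<Sum>j\<le>2. ereal (\<alpha> j) * perimeter (A j) \<Omega>)"

(* For normalized open sets, the closure of the pointwise difference set agrees with the
   support of the difference as a class modulo null sets. *)
definition competitor :: "(nat \<Rightarrow> (real^2) set) \<Rightarrow> (real^2) set \<Rightarrow> (nat \<Rightarrow> (real^2) set) \<Rightarrow> bool" where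
  "competitor A U B \<longleftrightarrow> permissible B \<and>
     (\<forall>j\<le>2. spt (\<lambda>x. indicat_real (A j) x - indicat_real (B j) x) \<subseteq> U)"

definition D_minimal :: "(nat \<Rightarrow> real) \<Rightarrow> (nat \<Rightarrow> (real^2) set) \<Rightarrow> bool" where
  "D_minimal \<alpha> A \<longleftrightarrow> permissible A \<and>
     (\<forall>U B. open U \<and> bounded U \<and> competitor A U B \<longrightarrow>
        surface_energy \<alpha> A U \<le> surface_energy \<alpha> B U)"

definition V_minimal :: "(nat \<Rightarrow> real) \<Rightarrow> (nat \<Rightarrow> (real^2) set) \<Rightarrow> bool" where
  "V_minimal \<alpha> A \<longleftrightarrow> permissible A \<and>
     (\<forall>U B. open U \<and> bounded U \<and> competitor A U B \<and>
        (\<forall>j\<le>2. measure lebesgue (B j \<inter> U) = measure lebesgue (A j \<inter> U)) \<longrightarrow>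
        surface_energy \<alpha> A U \<le> surface_energy \<alpha> B U)"

(* Unlike the library's cone, the vertex need not belong to the set. *)
definition cone_at_origin :: "'a::real_vector set \<Rightarrow> bool" where
  "cone_at_origin C \<longleftrightarrow> (\<forall>t>0. (\<lambda>x. t *\<^sub>R x) ` C = C)"

definition sector :: "real \<Rightarrow> real \<Rightarrow> (real^2) set" where
  "sector \<theta> \<gamma> = {vector [r * cos t, r * sin t] | r t. 0 < r \<and> \<theta> < t \<and> t < \<theta> + \<gamma>}"

(* The angle at the origin measured within C is gamma; it may exceed pi. The bound 2 * pi makes
   gamma unique. *)
definition angle_within :: "(real^2) set \<Rightarrow> real \<Rightarrow> bool" where
  "angle_within C \<gamma> \<longleftrightarrow> 0 < \<gamma> \<and> \<gamma> \<le> 2 * pi \<and> (\<exists>\<theta>. C = sector \<theta> \<gamma>)"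

end

theory Submission
  imports Defs
begin

text \<open>
  A D-minimal triple is V-minimal. Finite perimeter forces the cones to have finitely many boundary
  rays, because every boundary ray carries a fixed amount of perimeter in the unit ball; hence the
  three cones consist of finitely many sectors, adjacent ones with different labels.

  Consider a sector of label \<open>j\<close> and opening \<open>\<gamma> < \<pi>\<close>, bounded by the unit directions \<open>u\<^sub>1\<close>, \<open>u\<^sub>2\<close> and with
  neighbours of labels \<open>i\<close> and \<open>k\<close>. Pushing its tip from \<open>0\<close> to \<open>p = t w\<close>, where
  \<open>w = \<sigma>\<^sub>i\<^sub>j u\<^sub>1 + \<sigma>\<^sub>j\<^sub>k u\<^sub>2\<close>, replaces the two rays near \<open>0\<close> by a triple junction at \<open>p\<close> and an interface
  \<open>[0, p]\<close> between \<open>i\<close> and \<open>k\<close>. The areas can be restored at cost \<open>O(t\<^sup>2)\<close>, and the energy changes by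
  \<open>t (\<sigma>\<^sub>i\<^sub>k |w| - |w|\<^sup>2) + O(t\<^sup>2)\<close> with \<open>\<sigma>\<^sub>i\<^sub>i = 0\<close>. Minimality therefore gives \<open>|w| \<le> \<sigma>\<^sub>i\<^sub>k\<close>, so \<open>i \<noteq> k\<close> and
  \<open>\<gamma> \<ge> \<gamma>\<^sub>j\<close>, where \<open>\<pi> - \<gamma>\<^sub>j\<close> is the angle opposite to \<open>\<sigma>\<^sub>i\<^sub>k\<close> in the triangle with sides \<open>\<sigma>\<^sub>0\<^sub>1\<close>,
  \<open>\<sigma>\<^sub>0\<^sub>2\<close>, \<open>\<sigma>\<^sub>1\<^sub>2\<close>. As \<open>\<gamma>\<^sub>0 + \<gamma>\<^sub>1 + \<gamma>\<^sub>2 = 2 \<pi>\<close> and all three labels occur, there is exactly one sector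
  for each label and its opening is \<open>\<gamma>\<^sub>j\<close>; the angle condition is the law of sines.
\<close>

section \<open>Integration in affine coordinates\<close>

text \<open>The perimeter is a supremum over test fields, so upper and lower bounds are obtained
  differently. Upper bounds concern the competitors: it suffices to estimate each single field, and
  the divergence theorem on triangles and sectors turns its integral into fluxes through edges, each
  at most the length of the edge. Lower bounds concern the cones: explicit fields in disjoint narrow
  wedges, one wedge per boundary ray, recover the length of every ray in the limit. Rays that a
  competitor leaves alone then cancel in the comparison.

  The vector \<open>w\<close> is the direction of steepest descent, namely minus the gradient at
  \<open>p = 0\<close> of \<open>\<sigma>\<^sub>i\<^sub>j |p - u\<^sub>1| + \<sigma>\<^sub>j\<^sub>k
  |p - u\<^sub>2|\<close>. Restoring the areas is cheap because a triangle of height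
  \<open>h\<close> over a unit segment replaces the length 1 by
  \<open>2 sqrt (1/4 + h^2) = 1 + O(h^2)\<close>.

  Competitors have to be normalized open sets again. Taking the interior of the closure achieves
  this, since a regular open set has positive perimeter near each of its frontier points.\<close>

definition cross2 :: "real^2 \<Rightarrow> real^2 \<Rightarrow> real" where
  "cross2 u v = u$1 * v$2 - u$2 * v$1"

lemma Basis_vec2: "(Basis :: (real^2) set) = {axis 1 1, axis 2 1}"
  by (auto simp: Basis_vec_def UNIV_2)

lemma axis_12_neq: "(axis 1 1 :: real^2) \<noteq> axis 2 1"
  by (simp add: axis_eq_axis)

text \<open>Boxes determine \<open>lborel\<close>, and a box in \<open>real^2\<close> pulls back to
  a box in the product. The identification gives access to Fubini's theorem in the plane.\<close>

lemma lborel_pair_axis: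
  "lborel = distr (lborel \<Otimes>\<^sub>M lborel) borel (\<lambda>(s::real, t::real). s *\<^sub>R axis 1 1 + t *\<^sub>R axis 2 1 :: real^2)"
  (is "_ = distr _ _ ?J")
proof (rule lborel_eqI)
  fix l u :: "real^2"
  have m: "?J \<in> borel_measurable borel"
    by (intro borel_measurable_continuous_onI) (auto simp: split_beta intro!: continuous_intros)
  assume le: "\<And>b. b \<in> Basis \<Longrightarrow> l \<bullet> b \<le> u \<bullet> b"
  then have le': "l$1 \<le> u$1" "l$2 \<le> u$2"
    using le[of "axis 1 1"] le[of "axis 2 1"] by (auto simp: Basis_vec2 inner_axis)
  have pre: "?J -` box l u = box (l$1, l$2) (u$1, u$2)"
    by (auto simp: mem_box_cart forall_2 axis_def) (auto simp: mem_box Basis_prod_def)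
  have "emeasure (distr (lborel \<Otimes>\<^sub>M lborel) borel ?J) (box l u) = emeasure lborel (?J -` box l u)"
    using m by (simp add: lborel_prod emeasure_distr)
  also have "\<dots> = ennreal ((u$1 - l$1) * (u$2 - l$2))"
    unfolding pre using le' by (subst emeasure_lborel_box) (auto simp: Basis_prod_def)
  also have "(u$1 - l$1) * (u$2 - l$2) = (\<Prod>b\<in>Basis. (u - l) \<bullet> b)"
    using axis_12_neq by (simp add: Basis_vec2 inner_axis)
  finally show "emeasure (distr (lborel \<Otimes>\<^sub>M lborel) borel ?J) (box l u) = ennreal (\<Prod>b\<in>Basis. (u - l) \<bullet> b)" .
qed simp

text \<open>Change of variables with Jacobian \<open>cross2 u v\<close>. The coordinate map is
  \<open>G\<close> after the map of \<open>lborel_pair_axis\<close>, so only the measure of the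
  preimage of a box under \<open>G\<close> has to be found, and that is a linear image of a
  box.\<close>

lemma lborel_affine_plane:
  assumes c: "cross2 u v \<noteq> 0"
  shows "lborel = density (distr (lborel \<Otimes>\<^sub>M lborel) borel
    (\<lambda>(s::real, t::real). a + s *\<^sub>R u + t *\<^sub>R v)) (\<lambda>_. ennreal \<bar>cross2 u v\<bar>)"
proof (rule lborel_eqI)
  let ?J = "\<lambda>(s::real, t::real). s *\<^sub>R axis 1 1 + t *\<^sub>R axis 2 1 :: real^2"
  let ?L = "\<lambda>(s::real, t::real). a + s *\<^sub>R u + t *\<^sub>R v"
  define G where "G = (\<lambda>x::real^2. a + (x$1) *\<^sub>R u + (x$2) *\<^sub>R v)"
  \<comment> \<open>The inverse of the linear part of \<open>G\<close>, by Cramer's rule.\<close>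
  define g' where "g' = (\<lambda>y::real^2. (cross2 y v / cross2 u v) *\<^sub>R axis 1 1 + (cross2 u y / cross2 u v) *\<^sub>R axis 2 1 :: real^2)"
  fix l w :: "real^2"
  assume le: "\<And>b. b \<in> Basis \<Longrightarrow> l \<bullet> b \<le> w \<bullet> b"
  have mJ: "?J \<in> borel_measurable borel" and mL: "?L \<in> borel_measurable borel" and mG: "G \<in> borel_measurable borel"
    unfolding G_def
    by (intro borel_measurable_continuous_onI; auto simp: split_beta intro!: continuous_intros)+
  have GJ: "G (?J p) = ?L p" for p
    by (auto simp: G_def split_beta axis_def)
  have lin: "linear g'"
    unfolding g'_def cross2_def
    by (rule linearI) (auto simp: vec_eq_iff forall_2 axis_def field_simps add_divide_distrib diff_divide_distrib)
  have det: "det (matrix g') = 1 / cross2 u v"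
  proof -
    have ax: "cross2 (axis 1 1) v = v$2" "cross2 (axis 2 1) v = - v$1"
       "cross2 u (axis 1 1) = - u$2" "cross2 u (axis 2 1) = u$1"
      by (simp_all add: cross2_def axis_def)
    have "det (matrix g') = (u$1 * v$2 - u$2 * v$1) / (cross2 u v * cross2 u v)"
      unfolding g'_def matrix_def det_2 by (simp add: ax) (simp add: axis_def diff_divide_distrib mult.commute)
    also have "u$1 * v$2 - u$2 * v$1 = cross2 u v" by (simp add: cross2_def)
    finally show ?thesis using c by simp
  qed
  have inv1: "g' (G x - a) = x" for x
  proof -
    have "cross2 (G x - a) v = x$1 * cross2 u v" "cross2 u (G x - a) = x$2 * cross2 u v"
      by (simp_all add: G_def cross2_def algebra_simps)
    then show ?thesis
      using c by (simp add: g'_def vec_eq_iff forall_2 axis_def)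
  qed
  have cr: "(u$1 * v$2 - u$2 * v$1) * z = cross2 u v * z" for z by (simp add: cross2_def)
  have inv2: "G (g' y) = y + a" for y
  proof -
    have "u$i * (cross2 y v / cross2 u v) + v$i * (cross2 u y / cross2 u v) = y$i" if "i = 1 \<or> i = 2" for i :: 2
      using c that by (auto simp: field_simps) (auto simp: cross2_def algebra_simps)
    from this[of 1] this[of 2] show ?thesis
      by (simp add: g'_def G_def vec_eq_iff forall_2 axis_def mult.commute)
  qed
  have pre: "G -` box l w = g' ` box (l - a) (w - a)"
  proof (intro set_eqI iffI)
    fix x assume "x \<in> G -` box l w"
    then have "G x - a \<in> box (l - a) (w - a)" by (auto simp: mem_box inner_diff_left)
    then show "x \<in> g' ` box (l - a) (w - a)" using inv1 by (metis imageI)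
  next
    fix x assume "x \<in> g' ` box (l - a) (w - a)"
    then show "x \<in> G -` box l w" by (auto simp: inv2 mem_box inner_diff_left algebra_simps)
  qed
  have meas: "g' ` box (l - a) (w - a) \<in> lmeasurable" 
    and mm: "measure lebesgue (g' ` box (l - a) (w - a)) = \<bar>1 / cross2 u v\<bar> * measure lebesgue (box (l - a) (w - a))"
    using measurable_linear_image[OF lin lmeasurable_box] measure_linear_image[OF lin lmeasurable_box] det by auto
  have borelG: "G -` box l w \<in> sets borel"
    using mG by (metis borel_open open_box measurable_sets_borel)
  have "emeasure lborel (G -` box l w) = emeasure lebesgue (G -` box l w)"
    using borelG by simp
  also have "\<dots> = ennreal (\<bar>1 / cross2 u v\<bar> * measure lebesgue (box (l - a) (w - a)))"
    using emeasure_eq_measure2[OF meas] mm pre by simp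
  also have "measure lebesgue (box (l - a) (w - a)) = (\<Prod>b\<in>Basis. (w - l) \<bullet> b)"
    using le by (simp add: measure_lborel_box_eq inner_diff_left)
  finally have e: "emeasure lborel (G -` box l w) = ennreal (\<bar>1 / cross2 u v\<bar> * (\<Prod>b\<in>Basis. (w - l) \<bullet> b))" .
  have "emeasure (density (distr (lborel \<Otimes>\<^sub>M lborel) borel ?L) (\<lambda>_. ennreal \<bar>cross2 u v\<bar>)) (box l w)
     = ennreal \<bar>cross2 u v\<bar> * emeasure (distr (lborel \<Otimes>\<^sub>M lborel) borel ?L) (box l w)"
    by (subst emeasure_density) (auto simp: nn_integral_cmult_indicator)
  also have "emeasure (distr (lborel \<Otimes>\<^sub>M lborel) borel ?L) (box l w) = emeasure lborel (?J -` (G -` box l w))"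
    using mL by (simp add: lborel_prod emeasure_distr vimage_def GJ)
  also have "\<dots> = emeasure (distr (lborel \<Otimes>\<^sub>M lborel) borel ?J) (G -` box l w)"
    using mJ borelG by (simp add: lborel_prod emeasure_distr)
  also have "\<dots> = emeasure lborel (G -` box l w)"
    by (simp flip: lborel_pair_axis)
  finally show "emeasure (density (distr (lborel \<Otimes>\<^sub>M lborel) borel ?L) (\<lambda>_. ennreal \<bar>cross2 u v\<bar>)) (box l w)
     = (\<Prod>b\<in>Basis. (w - l) \<bullet> b)"
    using c by (simp add: e prod_nonneg le flip: ennreal_mult')
qed simp

lemma
  fixes f :: "real^2 \<Rightarrow> real"
  assumes c: "cross2 u v \<noteq> 0" and f: "integrable lborel f"
  shows integrable_affine_plane: "integrable (lborel \<Otimes>\<^sub>M lborel) (\<lambda>(s, t). f (a + s *\<^sub>R u + t *\<^sub>R v))"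
    and integral_affine_plane:
      "integral\<^sup>L lborel f = \<bar>cross2 u v\<bar> * integral\<^sup>L (lborel \<Otimes>\<^sub>M lborel) (\<lambda>(s, t). f (a + s *\<^sub>R u + t *\<^sub>R v))"
proof -
  let ?L = "\<lambda>(s::real, t::real). a + s *\<^sub>R u + t *\<^sub>R v"
  let ?D = "distr (lborel \<Otimes>\<^sub>M lborel) borel ?L"
  have mL: "?L \<in> borel_measurable (lborel \<Otimes>\<^sub>M lborel)"
  proof -
    have "?L \<in> borel_measurable borel"
      by (intro borel_measurable_continuous_onI) (auto simp: split_beta intro!: continuous_intros)
    then show ?thesis by (simp add: lborel_prod)
  qed
  have mf: "f \<in> borel_measurable borel" using f by auto
  have L: "lborel = density ?D (\<lambda>_. ennreal \<bar>cross2 u v\<bar>)" by (rule lborel_affine_plane[OF c])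
  have "integrable (density ?D (\<lambda>_. ennreal \<bar>cross2 u v\<bar>)) f" using f L by simp
  then have "integrable ?D (\<lambda>x. \<bar>cross2 u v\<bar> *\<^sub>R f x)"
    using mf by (subst (asm) integrable_density) auto
  then have "integrable ?D f" using c by simp
  then show "integrable (lborel \<Otimes>\<^sub>M lborel) (\<lambda>(s, t). f (a + s *\<^sub>R u + t *\<^sub>R v))"
    using mL mf by (subst (asm) integrable_distr_eq) (auto simp: case_prod_unfold)
  have "integral\<^sup>L lborel f = integral\<^sup>L (density ?D (\<lambda>_. ennreal \<bar>cross2 u v\<bar>)) f" using L by simp
  also have "\<dots> = integral\<^sup>L ?D (\<lambda>x. \<bar>cross2 u v\<bar> *\<^sub>R f x)"
    using mf by (subst integral_density) auto
  also have "\<dots> = \<bar>cross2 u v\<bar> * integral\<^sup>L ?D f" by simp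
  also have "integral\<^sup>L ?D f = integral\<^sup>L (lborel \<Otimes>\<^sub>M lborel) (\<lambda>(s, t). f (a + s *\<^sub>R u + t *\<^sub>R v))"
    using mL mf by (subst integral_distr) (auto simp: case_prod_unfold)
  finally show "integral\<^sup>L lborel f = \<bar>cross2 u v\<bar> * integral\<^sup>L (lborel \<Otimes>\<^sub>M lborel) (\<lambda>(s, t). f (a + s *\<^sub>R u + t *\<^sub>R v))" .
qed

text \<open>Both orders of integration are kept: in the divergence theorem the derivative along
  \<open>u\<close> is integrated first in \<open>s\<close>, the derivative along \<open>v\<close>
  first in \<open>t\<close>.\<close>

lemma
  fixes f :: "real^2 \<Rightarrow> real"
  assumes c: "cross2 u v \<noteq> 0" and f: "integrable lborel f"
  shows integral_affine_plane_fst: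
      "integral\<^sup>L lborel f = \<bar>cross2 u v\<bar> * (LINT s|lborel. LINT t|lborel. f (a + s *\<^sub>R u + t *\<^sub>R v))"
    and integral_affine_plane_snd:
      "integral\<^sup>L lborel f = \<bar>cross2 u v\<bar> * (LINT t|lborel. LINT s|lborel. f (a + s *\<^sub>R u + t *\<^sub>R v))"
  using integral_affine_plane[OF c f, of a] lborel_pair.integral_fst[OF integrable_affine_plane[OF c f, of a]]
    lborel_pair.integral_snd[OF integrable_affine_plane[OF c f, of a]] by auto

section \<open>Test fields and flux\<close>

lemma divergence_vec2:
  fixes \<phi> :: "real^2 \<Rightarrow> real^2"
  shows "divergence \<phi> x = frechet_derivative \<phi> (at x) (axis 1 1) $ 1 + frechet_derivative \<phi> (at x) (axis 2 1) $ 2"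
  using axis_12_neq by (simp add: divergence_def Basis_vec2 inner_axis)

lemma not_in_spt: "x \<notin> spt \<phi> \<Longrightarrow> \<phi> x = 0"
  using closure_subset[of "{x. \<phi> x \<noteq> 0}"] by (auto simp: spt_def)

lemma test_fieldsD:
  assumes "\<phi> \<in> test_fields \<Omega>"
  shows "\<And>x. (\<phi> has_derivative frechet_derivative \<phi> (at x)) (at x)"
    and "\<And>v. continuous_on UNIV (\<lambda>x. frechet_derivative \<phi> (at x) v)"
    and "compact (spt \<phi>)" "spt \<phi> \<subseteq> \<Omega>" "\<And>x. norm (\<phi> x) \<le> 1" "\<And>x. x \<notin> \<Omega> \<Longrightarrow> \<phi> x = 0"
    and "continuous_on UNIV \<phi>"
proof -
  have d: "\<phi> differentiable (at x)" for x
    using assms by (auto simp: test_fields_def)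
  then show "\<And>x. (\<phi> has_derivative frechet_derivative \<phi> (at x)) (at x)"
    by (simp flip: frechet_derivative_works)
  show "continuous_on UNIV \<phi>"
    using d by (auto simp: continuous_on_eq_continuous_at intro!: differentiable_imp_continuous_within)
  show "\<And>x. x \<notin> \<Omega> \<Longrightarrow> \<phi> x = 0"
    using assms not_in_spt[of _ \<phi>] by (auto simp: test_fields_def)
qed (use assms in \<open>auto simp: test_fields_def\<close>)

lemma derivative_outside_spt:
  assumes "\<phi> \<in> test_fields \<Omega>" "x \<notin> spt \<phi>"
  shows "frechet_derivative \<phi> (at x) = (\<lambda>_. 0)"
proof -
  have "open (- spt \<phi>)" by (auto simp: spt_def)
  have "((\<lambda>_. 0) has_derivative (\<lambda>_. 0)) (at x)" by simp
  then have "(\<phi> has_derivative (\<lambda>_. 0)) (at x)"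
    by (rule has_derivative_transform_within_open[OF _ \<open>open (- spt \<phi>)\<close>]) (use assms not_in_spt[of _ \<phi>] in auto)
  then show ?thesis by (simp add: frechet_derivative_at[symmetric])
qed

lemma continuous_divergence:
  fixes \<phi> :: "real^2 \<Rightarrow> real^2"
  assumes "\<phi> \<in> test_fields \<Omega>"
  shows "continuous_on UNIV (divergence \<phi>)"
  unfolding divergence_vec2[abs_def]
  by (intro continuous_intros test_fieldsD[OF assms])

lemma divergence_outside_spt:
  assumes "\<phi> \<in> test_fields \<Omega>" "x \<notin> spt \<phi>"
  shows "divergence \<phi> x = 0"
  using derivative_outside_spt[OF assms] by (simp add: divergence_def)

lemma integrable_continuous_compact_support:
  fixes f :: "'a::euclidean_space \<Rightarrow> real"
  assumes "continuous_on UNIV f" "compact K" "\<And>x. x \<notin> K \<Longrightarrow> f x = 0"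
  shows "integrable lborel f"
proof -
  have "integrable lborel (\<lambda>x. indicat_real K x *\<^sub>R f x)"
    using assms by (intro borel_integrable_compact) (auto intro: continuous_on_subset)
  moreover have "(\<lambda>x. indicat_real K x *\<^sub>R f x) = f"
  proof
    fix x show "indicat_real K x *\<^sub>R f x = f x" using assms(3)[of x] by (cases "x \<in> K") auto
  qed
  ultimately show ?thesis by simp
qed

lemma integrable_divergence:
  fixes \<phi> :: "real^2 \<Rightarrow> real^2"
  assumes "\<phi> \<in> test_fields \<Omega>"
  shows "integrable lborel (divergence \<phi>)"
  using continuous_divergence[OF assms] test_fieldsD(3)[OF assms] divergence_outside_spt[OF assms]
  by (rule integrable_continuous_compact_support)

lemma integrable_indicator_divergence:
  fixes \<phi> :: "real^2 \<Rightarrow> real^2"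
  assumes "\<phi> \<in> test_fields \<Omega>" "E \<in> sets borel"
  shows "integrable lborel (\<lambda>x. indicat_real E x * divergence \<phi> x)"
  using integrable_mult_indicator[OF _ integrable_divergence[OF assms(1)], of E] assms(2) by simp

text \<open>\<open>perimeter\<close> integrates against \<open>lebesgue\<close>, whereas Fubini's
  theorem is applied to \<open>lborel\<close>; this is the passage between the two.\<close>

lemma set_integral_lebesgue_lborel:
  fixes f :: "'a::euclidean_space \<Rightarrow> real"
  assumes "E \<in> sets borel" "f \<in> borel_measurable borel"
  shows "(LINT x:E|lebesgue. f x) = (LINT x|lborel. indicat_real E x * f x)"
  unfolding set_lebesgue_integral_def using assms by (subst integral_completion) auto

lemma set_integral_lebesgue_divergence:
  fixes \<phi> :: "real^2 \<Rightarrow> real^2"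
  assumes "\<phi> \<in> test_fields \<Omega>" "E \<in> sets borel"
  shows "(LINT x:E|lebesgue. divergence \<phi> x) = (LINT x|lborel. indicat_real E x * divergence \<phi> x)"
  using assms continuous_divergence[OF assms(1)] 
  by (intro set_integral_lebesgue_lborel) (auto intro: borel_measurable_continuous_onI)

text \<open>Since \<open>cross2 y (b - a)\<close> is the inner product of \<open>y\<close> with
  \<open>b - a\<close> turned clockwise by a right angle, this is the flux through the segment
  towards the right of the direction of travel: outward for a polygon run through counterclockwise.
  The length of the segment is built into \<open>b - a\<close>.\<close>

definition flux :: "(real^2 \<Rightarrow> real^2) \<Rightarrow> real^2 \<Rightarrow> real^2 \<Rightarrow> real" where
  "flux \<phi> a b = integral {0..1} (\<lambda>r. cross2 (\<phi> (a + r *\<^sub>R (b - a))) (b - a))"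

lemma cross2_bound: "\<bar>cross2 x y\<bar> \<le> norm x * norm y"
proof -
  have "(cross2 x y)\<^sup>2 \<le> (norm x * norm y)\<^sup>2"
  proof -
    have "(norm x * norm y)\<^sup>2 = ((x$1)\<^sup>2 + (x$2)\<^sup>2) * ((y$1)\<^sup>2 + (y$2)\<^sup>2)"
      unfolding power_mult_distrib power2_norm_eq_inner by (simp add: inner_vec_def sum_2 power2_eq_square)
    also have "\<dots> = (cross2 x y)\<^sup>2 + (x$1 * y$1 + x$2 * y$2)\<^sup>2"
      by (simp add: cross2_def power2_eq_square algebra_simps)
    finally show ?thesis by simp
  qed
  then show ?thesis
    using abs_le_square_iff[of "cross2 x y" "norm x * norm y"] by (simp add: abs_mult)
qed

lemma continuous_on_cross2 [continuous_intros]: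
  "continuous_on S f \<Longrightarrow> continuous_on S g \<Longrightarrow> continuous_on S (\<lambda>x. cross2 (f x) (g x))"
  unfolding cross2_def by (intro continuous_intros)

text \<open>Here the bound 1 on test fields becomes a length; the upper estimate for the perimeter
  of a competitor is a sum of such terms.\<close>

lemma flux_bound:
  assumes "continuous_on UNIV \<phi>" "\<And>x. norm (\<phi> x) \<le> 1"
  shows "\<bar>flux \<phi> a b\<bar> \<le> norm (b - a)"
proof -
  have "norm (flux \<phi> a b) \<le> norm (b - a) * (1 - 0)"
    unfolding flux_def
  proof (rule integral_bound)
    show "continuous_on {0..1} (\<lambda>r. cross2 (\<phi> (a + r *\<^sub>R (b - a))) (b - a))"
      by (intro continuous_intros continuous_on_compose2[OF assms(1)]) auto
    fix t
    have "norm (\<phi> (a + t *\<^sub>R (b - a))) * norm (b - a) \<le> 1 * norm (b - a)"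
      by (intro mult_right_mono assms) auto
    then show "norm (cross2 (\<phi> (a + t *\<^sub>R (b - a))) (b - a)) \<le> norm (b - a)"
      using cross2_bound[of "\<phi> (a + t *\<^sub>R (b - a))" "b - a"] by simp
  qed auto
  then show ?thesis by simp
qed

lemma flux_scale:
  assumes "0 < c"
  shows "integral {0..c} (\<lambda>s. cross2 (\<phi> (a + s *\<^sub>R w)) w) = flux \<phi> a (a + c *\<^sub>R w)"
proof -
  have "flux \<phi> a (a + c *\<^sub>R w) = integral {0..1} (\<lambda>r. c *\<^sub>R cross2 (\<phi> (a + (c * r) *\<^sub>R w)) w)"
  proof -
    have "a + r *\<^sub>R (a + c *\<^sub>R w - a) = a + (c * r) *\<^sub>R w" for r
      by (simp add: mult.commute)
    moreover have "cross2 y (a + c *\<^sub>R w - a) = c *\<^sub>R cross2 y w" for y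
      by (simp add: cross2_def algebra_simps)
    ultimately show ?thesis by (simp only: flux_def)
  qed
  also have "\<dots> = c * integral {0..1} (\<lambda>r. cross2 (\<phi> (a + (c * r) *\<^sub>R w)) w)"
    by simp
  also have "integral {0..1} (\<lambda>r. cross2 (\<phi> (a + (c * r) *\<^sub>R w)) w) = (1 / c) * integral {0..c} (\<lambda>s. cross2 (\<phi> (a + s *\<^sub>R w)) w)"
    using integral_stretch_real[of c 0 c "\<lambda>s. cross2 (\<phi> (a + s *\<^sub>R w)) w"] assms 
    by (simp add: image_divide_atLeastAtMost)
  finally show ?thesis using assms by simp
qed

lemma flux_reverse: "flux \<phi> b a = - flux \<phi> a b"
proof -
  let ?g = "\<lambda>r. cross2 (\<phi> (b + r *\<^sub>R (a - b))) (a - b)"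
  have "flux \<phi> b a = integral {-1..0} (\<lambda>r. ?g (- r))"
    unfolding flux_def using Henstock_Kurzweil_Integration.integral_reflect_real[of 1 0 ?g] by simp
  also have "\<dots> = integral {0..1} ((\<lambda>r. ?g (- r)) \<circ> (+) (-1))"
    using integral_shift_Icc_real[of 0 1 "\<lambda>r. ?g (- r)" "-1"] by simp
  also have "\<dots> = integral {0..1} (\<lambda>r. - cross2 (\<phi> (a + r *\<^sub>R (b - a))) (b - a))"
  proof (rule integral_cong)
    fix r :: real
    have "b + (- (- 1 + r)) *\<^sub>R (a - b) = a + r *\<^sub>R (b - a)"
      by (simp add: scaleR_diff_right scaleR_diff_left scaleR_left_distrib)
    moreover have "cross2 y (a - b) = - cross2 y (b - a)" for y
      by (simp add: cross2_def algebra_simps)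
    ultimately show "((\<lambda>r. ?g (- r)) \<circ> (+) (-1)) r = - cross2 (\<phi> (a + r *\<^sub>R (b - a))) (b - a)"
      by (simp only: o_def)
  qed
  finally show ?thesis by (simp add: flux_def)
qed

lemma flux_split:
  assumes "continuous_on UNIV \<phi>" "0 < c" "c < d"
  shows "flux \<phi> a (a + d *\<^sub>R w) = flux \<phi> a (a + c *\<^sub>R w) + flux \<phi> (a + c *\<^sub>R w) (a + d *\<^sub>R w)"
proof -
  let ?f = "\<lambda>s. cross2 (\<phi> (a + s *\<^sub>R w)) w"
  have "?f integrable_on {0..d}"
    by (intro integrable_continuous_interval continuous_intros continuous_on_compose2[OF assms(1)]) auto
  then have "integral {0..d} ?f = integral {0..c} ?f + integral {c..d} ?f"
    using assms by (simp add: Henstock_Kurzweil_Integration.integral_combine)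
  moreover have "integral {c..d} ?f = integral {0..d - c} (\<lambda>s. cross2 (\<phi> ((a + c *\<^sub>R w) + s *\<^sub>R w)) w)"
  proof -
    have "?f \<circ> (+) c = (\<lambda>s. cross2 (\<phi> ((a + c *\<^sub>R w) + s *\<^sub>R w)) w)"
      by (simp add: o_def scaleR_left_distrib add.assoc)
    then show ?thesis using integral_shift_Icc_real[of 0 "d - c" ?f c] by simp
  qed
  moreover have "integral {0..d - c} (\<lambda>s. cross2 (\<phi> ((a + c *\<^sub>R w) + s *\<^sub>R w)) w) = flux \<phi> (a + c *\<^sub>R w) (a + d *\<^sub>R w)"
  proof -
    have "a + c *\<^sub>R w + (d - c) *\<^sub>R w = a + d *\<^sub>R w" by (simp add: scaleR_left_diff_distrib)
    then show ?thesis using flux_scale[of "d - c" \<phi> "a + c *\<^sub>R w" w] assms by (simp only: diff_gt_0_iff_gt)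
  qed
  ultimately show ?thesis
    using flux_scale[of d \<phi> a w, symmetric] flux_scale[of c \<phi> a w, symmetric] assms by linarith
qed

section \<open>The divergence theorem on triangles\<close>

lemma cross2_simps:
  "cross2 (x + y) z = cross2 x z + cross2 y z" "cross2 z (x + y) = cross2 z x + cross2 z y"
  "cross2 (x - y) z = cross2 x z - cross2 y z" "cross2 z (x - y) = cross2 z x - cross2 z y"
  "cross2 (c *\<^sub>R x) z = c * cross2 x z" "cross2 z (c *\<^sub>R x) = c * cross2 z x"
  "cross2 (- x) z = - cross2 x z" "cross2 z (- x) = - cross2 z x"
  "cross2 x x = 0" "cross2 0 z = 0" "cross2 z 0 = 0"
  by (simp_all add: cross2_def algebra_simps)

lemma cross2_commute: "cross2 x y = - cross2 y x"
  by (simp add: cross2_def)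

lemma bounded_linear_cross2_left: "bounded_linear (\<lambda>x. cross2 x v)"
  by (rule bounded_linear_intro[where K="norm v"]) (auto simp: cross2_simps cross2_bound)

lemma bounded_linear_cross2_right: "bounded_linear (cross2 v)"
proof (rule bounded_linear_intro[where K="norm v"])
  show "norm (cross2 v x) \<le> norm x * norm v" for x
    using cross2_bound[of v x] by (simp add: mult.commute)
qed (simp_all add: cross2_simps)

lemma cross2_coordinates:
  assumes "cross2 u v \<noteq> 0"
  shows "a + s *\<^sub>R u + t *\<^sub>R v = a + s' *\<^sub>R u + t' *\<^sub>R v \<longleftrightarrow> s = s' \<and> t = t'"
proof
  assume e: "a + s *\<^sub>R u + t *\<^sub>R v = a + s' *\<^sub>R u + t' *\<^sub>R v"
  have "cross2 (s *\<^sub>R u + t *\<^sub>R v) v = cross2 (s' *\<^sub>R u + t' *\<^sub>R v) v"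
    "cross2 u (s *\<^sub>R u + t *\<^sub>R v) = cross2 u (s' *\<^sub>R u + t' *\<^sub>R v)"
    using e by (simp_all add: add.assoc)
  then show "s = s' \<and> t = t'" using assms by (simp add: cross2_simps)
qed auto

text \<open>The derivative of the determinant: a linear map \<open>L\<close> changes the area form
  infinitesimally by its trace.\<close>

lemma cross2_trace:
  assumes "linear L"
  shows "cross2 (L u) v + cross2 u (L v) = cross2 u v * (L (axis 1 1) $ 1 + L (axis 2 1) $ 2)"
proof -
  have e: "L x = x$1 *\<^sub>R L (axis 1 1) + x$2 *\<^sub>R L (axis 2 1)" for x
  proof -
    have "x = x$1 *\<^sub>R axis 1 1 + x$2 *\<^sub>R axis 2 1"
      by (simp add: vec_eq_iff forall_2 axis_def)
    from arg_cong[OF this, of L] show ?thesis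
      by (simp add: linear_add[OF assms] linear_scale[OF assms])
  qed
  show ?thesis
    unfolding e[of u] e[of v] by (simp add: cross2_def algebra_simps)
qed

text \<open>The divergence splits into one directional derivative along \<open>u\<close> and one
  along \<open>v\<close>, for an arbitrary basis. A triangle can thus be treated in the coordinates
  of its own edges.\<close>

lemma divergence_cross2:
  assumes "\<phi> \<in> test_fields \<Omega>"
  shows "cross2 u v * divergence \<phi> x =
    cross2 (frechet_derivative \<phi> (at x) u) v + cross2 u (frechet_derivative \<phi> (at x) v)"
  using cross2_trace[of "frechet_derivative \<phi> (at x)" u v] test_fieldsD(1)[OF assms, of x]
  by (simp add: divergence_vec2 has_derivative_linear)

lemma has_field_derivative_along:
  assumes "\<phi> \<in> test_fields \<Omega>" "bounded_linear L"
  shows "((\<lambda>s. L (\<phi> (p + s *\<^sub>R u)) :: real) has_field_derivative L (frechet_derivative \<phi> (at (p + s *\<^sub>R u)) u)) (at s)"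
proof -
  have "((\<lambda>s. p + s *\<^sub>R u) has_derivative (\<lambda>h. h *\<^sub>R u)) (at s)"
    by (auto intro!: derivative_eq_intros)
  from has_derivative_compose[OF this test_fieldsD(1)[OF assms(1)]]
  have "((\<lambda>s. \<phi> (p + s *\<^sub>R u)) has_derivative (\<lambda>h. frechet_derivative \<phi> (at (p + s *\<^sub>R u)) (h *\<^sub>R u))) (at s)" .
  from bounded_linear.has_derivative[OF assms(2) this]
  have "((\<lambda>s. L (\<phi> (p + s *\<^sub>R u))) has_derivative (\<lambda>h. L (frechet_derivative \<phi> (at (p + s *\<^sub>R u)) (h *\<^sub>R u)))) (at s)" .
  moreover have "L (frechet_derivative \<phi> (at (p + s *\<^sub>R u)) (h *\<^sub>R u)) = L (frechet_derivative \<phi> (at (p + s *\<^sub>R u)) u) * h" for h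
    using test_fieldsD(1)[OF assms(1), of "p + s *\<^sub>R u"] assms(2)
    by (simp add: linear_scale has_derivative_linear bounded_linear.linear)
  ultimately show ?thesis by (simp add: has_field_derivative_def)
qed

lemma LINT_open_interval_eq:
  fixes g :: "real \<Rightarrow> real"
  assumes "continuous_on UNIV g"
  shows "(LINT t|lborel. indicat_real {a<..<b} t * g t) = integral {a..b} g"
proof -
  have g[measurable]: "g \<in> borel_measurable borel" using assms by (rule borel_measurable_continuous_onI)
  have "(LINT t|lborel. indicat_real {a<..<b} t * g t) = (LINT t|lborel. indicat_real {a..b} t * g t)"
  proof (rule integral_cong_AE)
    show "AE t in lborel. indicat_real {a<..<b} t * g t = indicat_real {a..b} t * g t"
      using AE_lborel_singleton[of a] AE_lborel_singleton[of b]
      by eventually_elim (auto simp: indicator_def)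
  qed (use g in measurable)
  also have "\<dots> = (LINT t:{a..b}|lborel. g t)" by (simp add: set_lebesgue_integral_def)
  also have "\<dots> = integral {a..b} g"
    using borel_integrable_atLeastAtMost'[of a b g] assms
    by (intro set_borel_integral_eq_integral) (auto intro: continuous_on_subset)
  finally show ?thesis .
qed

lemma LINT_open_interval_FTC:
  fixes F f :: "real \<Rightarrow> real"
  assumes "continuous_on UNIV f" "\<And>x. (F has_field_derivative f x) (at x)" "a \<le> b"
  shows "(LINT t|lborel. indicat_real {a<..<b} t * f t) = F b - F a"
proof -
  have "(f has_integral (F b - F a)) {a..b}"
    using assms by (intro fundamental_theorem_of_calculus)
      (auto simp: has_real_derivative_iff_has_vector_derivative intro: has_vector_derivative_at_within)
  then show ?thesis using LINT_open_interval_eq[OF assms(1)] by (simp add: integral_unique)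
qed

lemma integral_reflect_01:
  fixes f :: "real \<Rightarrow> real"
  shows "integral {0..1} (\<lambda>x. f (1 - x)) = integral {0..1} f"
proof -
  have "integral {0..1} f = integral {-1..0} (\<lambda>r. f (- r))"
    using Henstock_Kurzweil_Integration.integral_reflect_real[of 1 0 f] by simp
  also have "\<dots> = integral {0..1} ((\<lambda>r. f (- r)) \<circ> (+) (-1))"
    using integral_shift_Icc_real[of 0 1 "\<lambda>r. f (- r)" "-1"] by simp
  also have "(\<lambda>r. f (- r)) \<circ> (+) (-1) = (\<lambda>x. f (1 - x))" by auto
  finally show ?thesis by simp
qed

definition triangle :: "real^2 \<Rightarrow> real^2 \<Rightarrow> real^2 \<Rightarrow> (real^2) set" where
  "triangle a b c = {a + s *\<^sub>R (b - a) + t *\<^sub>R (c - a) | s t. 0 < s \<and> 0 < t \<and> s + t < 1}"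

lemma mem_triangle_iff:
  assumes "cross2 (b - a) (c - a) \<noteq> 0"
  shows "a + s *\<^sub>R (b - a) + t *\<^sub>R (c - a) \<in> triangle a b c \<longleftrightarrow> 0 < s \<and> 0 < t \<and> s + t < 1"
  unfolding triangle_def using cross2_coordinates[OF assms] by auto

text \<open>By Cramer's rule the cross products are barycentric coordinates multiplied by
  \<open>cross2 (b - a) (c - a)\<close>, which is positive for a counterclockwise triangle.\<close>

lemma mem_triangle_cross2:
  assumes c: "cross2 (b - a) (c - a) > 0"
  shows "x \<in> triangle a b c \<longleftrightarrow>
    0 < cross2 (x - a) (c - a) \<and> 0 < cross2 (b - a) (x - a) \<and>
    cross2 (x - a) (c - a) + cross2 (b - a) (x - a) < cross2 (b - a) (c - a)"
proof -
  let ?k = "cross2 (b - a) (c - a)"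
  have x: "x = a + (cross2 (x - a) (c - a) / ?k) *\<^sub>R (b - a) + (cross2 (b - a) (x - a) / ?k) *\<^sub>R (c - a)"
  proof -
    have "?k * (x - a)$i = cross2 (x - a) (c - a) * (b - a)$i + cross2 (b - a) (x - a) * (c - a)$i"
      if "i = 1 \<or> i = 2" for i :: 2
      using that by (auto simp: cross2_def algebra_simps)
    then have "(x - a)$i = (cross2 (x - a) (c - a) * (b - a)$i + cross2 (b - a) (x - a) * (c - a)$i) / ?k"
      if "i = 1 \<or> i = 2" for i :: 2
      using that c by (simp add: eq_divide_eq mult.commute)
    from this[of 1] this[of 2] show ?thesis
      by (simp add: vec_eq_iff forall_2 add_divide_distrib)
  qed
  show ?thesis
    by (subst x, subst mem_triangle_iff) (use c in \<open>auto simp: field_simps\<close>)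
qed

lemma open_triangle:
  assumes c: "cross2 (b - a) (c - a) > 0"
  shows "open (triangle a b c)"
proof -
  have "triangle a b c = {x. 0 < cross2 (x - a) (c - a) \<and> 0 < cross2 (b - a) (x - a) \<and>
    cross2 (x - a) (c - a) + cross2 (b - a) (x - a) < cross2 (b - a) (c - a)}"
    using mem_triangle_cross2[OF c] by auto
  also have "open \<dots>"
    by (intro open_Collect_conj open_Collect_less continuous_intros)
  finally show ?thesis .
qed

text \<open>In edge coordinates the triangle is \<open>0 < s\<close>, \<open>0 < t\<close>,
  \<open>s + t < 1\<close>. The fundamental theorem of calculus on the slices gives boundary terms
  on two edges for each of \<open>P\<close> and \<open>Q\<close>. The edge from \<open>b\<close> to
  \<open>c\<close> occurs in both, once paired with \<open>v\<close> and once with \<open>u\<close>,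
  and \<open>v - u = c - b\<close> combines the two into one flux.\<close>

theorem triangle_divergence:
  assumes \<phi>: "\<phi> \<in> test_fields \<Omega>" and c: "cross2 (b - a) (c - a) > 0"
  shows "(LINT x|lborel. indicat_real (triangle a b c) x * divergence \<phi> x) =
    flux \<phi> a b + flux \<phi> b c + flux \<phi> c a"
proof -
  define u v where "u = b - a" and "v = c - a"
  have k: "cross2 u v > 0" "cross2 u v \<noteq> 0" using c by (auto simp: u_def v_def)
  let ?T = "triangle a b c" and ?D = "\<lambda>x. frechet_derivative \<phi> (at x)"
  define P where "P = (\<lambda>x. cross2 (?D x u) v)"
  define Q where "Q = (\<lambda>x. cross2 u (?D x v))"
  have T: "?T \<in> sets borel" using open_triangle[OF c] by auto
  note cD = test_fieldsD(2)[OF \<phi>] and c\<phi> = test_fieldsD(7)[OF \<phi>]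
  have cP: "continuous_on UNIV P" and cQ: "continuous_on UNIV Q"
    unfolding P_def Q_def by (intro continuous_intros cD)+
  have "integrable lborel P" "integrable lborel Q"
    by (rule integrable_continuous_compact_support[OF _ test_fieldsD(3)[OF \<phi>]];
      use cP cQ derivative_outside_spt[OF \<phi>] in \<open>simp add: P_def Q_def cross2_simps\<close>)+
  then have iP: "integrable lborel (\<lambda>x. indicat_real ?T x * P x)" and iQ: "integrable lborel (\<lambda>x. indicat_real ?T x * Q x)"
    using integrable_mult_indicator[of ?T lborel] T by force+
  have inT: "a + s *\<^sub>R u + t *\<^sub>R v \<in> ?T \<longleftrightarrow> 0 < s \<and> 0 < t \<and> s + t < 1" for s t
    using mem_triangle_iff[of b a c s t] k by (simp add: u_def v_def)
  have "cross2 u v * (LINT x|lborel. indicat_real ?T x * divergence \<phi> x)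
    = (LINT x|lborel. indicat_real ?T x * P x + indicat_real ?T x * Q x)"
    by (subst integral_mult_right_zero[symmetric], rule Bochner_Integration.integral_cong)
      (auto simp: P_def Q_def divergence_cross2[OF \<phi>, of u v] indicator_def)
  also have "\<dots> = (LINT x|lborel. indicat_real ?T x * P x) + (LINT x|lborel. indicat_real ?T x * Q x)"
    by (rule Bochner_Integration.integral_add[OF iP iQ])
  also have "(LINT x|lborel. indicat_real ?T x * P x) = cross2 u v *
     (LINT t|lborel. LINT s|lborel. indicat_real ?T (a + s *\<^sub>R u + t *\<^sub>R v) * P (a + s *\<^sub>R u + t *\<^sub>R v))"
    using integral_affine_plane_snd[OF k(2) iP, of a] k by simp
  also have "(LINT t|lborel. LINT s|lborel. indicat_real ?T (a + s *\<^sub>R u + t *\<^sub>R v) * P (a + s *\<^sub>R u + t *\<^sub>R v))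
     = (LINT t|lborel. indicat_real {0<..<1} t * (cross2 (\<phi> (b + t *\<^sub>R (c - b))) v - cross2 (\<phi> (a + t *\<^sub>R v)) v))"
  proof (rule Bochner_Integration.integral_cong[OF refl])
    fix t :: real
    show "(LINT s|lborel. indicat_real ?T (a + s *\<^sub>R u + t *\<^sub>R v) * P (a + s *\<^sub>R u + t *\<^sub>R v))
      = indicat_real {0<..<1} t * (cross2 (\<phi> (b + t *\<^sub>R (c - b))) v - cross2 (\<phi> (a + t *\<^sub>R v)) v)"
    proof (cases "0 < t \<and> t < 1")
      case True
      have "(LINT s|lborel. indicat_real ?T (a + s *\<^sub>R u + t *\<^sub>R v) * P (a + s *\<^sub>R u + t *\<^sub>R v))
        = (LINT s|lborel. indicat_real {0<..<1-t} s * P ((a + t *\<^sub>R v) + s *\<^sub>R u))"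
        proof (rule Bochner_Integration.integral_cong[OF refl])
        fix s
        have "a + s *\<^sub>R u + t *\<^sub>R v = (a + t *\<^sub>R v) + s *\<^sub>R u" by simp
        moreover have "indicat_real ?T (a + s *\<^sub>R u + t *\<^sub>R v) = indicat_real {0<..<1-t} s"
          using True by (auto simp: inT indicator_def)
        ultimately show "indicat_real ?T (a + s *\<^sub>R u + t *\<^sub>R v) * P (a + s *\<^sub>R u + t *\<^sub>R v) = indicat_real {0<..<1-t} s * P ((a + t *\<^sub>R v) + s *\<^sub>R u)"
          by (simp only:)
      qed
      also have "\<dots> = cross2 (\<phi> ((a + t *\<^sub>R v) + (1 - t) *\<^sub>R u)) v - cross2 (\<phi> ((a + t *\<^sub>R v) + 0 *\<^sub>R u)) v"
      proof (rule LINT_open_interval_FTC[where F = "\<lambda>s. cross2 (\<phi> ((a + t *\<^sub>R v) + s *\<^sub>R u)) v"])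
        show "continuous_on UNIV (\<lambda>s. P ((a + t *\<^sub>R v) + s *\<^sub>R u))"
          by (intro continuous_on_compose2[OF cP] continuous_intros) auto
        show "((\<lambda>s. cross2 (\<phi> ((a + t *\<^sub>R v) + s *\<^sub>R u)) v) has_field_derivative P ((a + t *\<^sub>R v) + x *\<^sub>R u)) (at x)" for x
          unfolding P_def by (rule has_field_derivative_along[OF \<phi> bounded_linear_cross2_left])
      qed (use True in simp)
      also have "(a + t *\<^sub>R v) + (1 - t) *\<^sub>R u = b + t *\<^sub>R (c - b)"
        by (simp add: u_def v_def algebra_simps)
      finally show ?thesis using True by simp
    next
      case False
      then have "a + s *\<^sub>R u + t *\<^sub>R v \<notin> ?T" for s using inT by auto
      then show ?thesis using False by auto
    qed
  qed
  also have "\<dots> = integral {0..1} (\<lambda>t. cross2 (\<phi> (b + t *\<^sub>R (c - b))) v - cross2 (\<phi> (a + t *\<^sub>R v)) v)"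
    by (intro LINT_open_interval_eq continuous_intros continuous_on_compose2[OF c\<phi>]) auto
  also have "\<dots> = integral {0..1} (\<lambda>t. cross2 (\<phi> (b + t *\<^sub>R (c - b))) v) - integral {0..1} (\<lambda>t. cross2 (\<phi> (a + t *\<^sub>R v)) v)"
    by (intro Henstock_Kurzweil_Integration.integral_diff integrable_continuous_interval continuous_intros continuous_on_compose2[OF c\<phi>]) auto
  also have "integral {0..1} (\<lambda>t. cross2 (\<phi> (a + t *\<^sub>R v)) v) = flux \<phi> a c"
    by (simp add: flux_def v_def)
  also have "(LINT x|lborel. indicat_real ?T x * Q x) = cross2 u v *
     (LINT s|lborel. LINT t|lborel. indicat_real ?T (a + s *\<^sub>R u + t *\<^sub>R v) * Q (a + s *\<^sub>R u + t *\<^sub>R v))"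
    using integral_affine_plane_fst[OF k(2) iQ, of a] k by simp
  also have "(LINT s|lborel. LINT t|lborel. indicat_real ?T (a + s *\<^sub>R u + t *\<^sub>R v) * Q (a + s *\<^sub>R u + t *\<^sub>R v))
     = (LINT s|lborel. indicat_real {0<..<1} s * (cross2 u (\<phi> (c + s *\<^sub>R (b - c))) - cross2 u (\<phi> (a + s *\<^sub>R u))))"
  proof (rule Bochner_Integration.integral_cong[OF refl])
    fix s :: real
    show "(LINT t|lborel. indicat_real ?T (a + s *\<^sub>R u + t *\<^sub>R v) * Q (a + s *\<^sub>R u + t *\<^sub>R v))
      = indicat_real {0<..<1} s * (cross2 u (\<phi> (c + s *\<^sub>R (b - c))) - cross2 u (\<phi> (a + s *\<^sub>R u)))"
    proof (cases "0 < s \<and> s < 1")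
      case True
      have "(LINT t|lborel. indicat_real ?T (a + s *\<^sub>R u + t *\<^sub>R v) * Q (a + s *\<^sub>R u + t *\<^sub>R v))
        = (LINT t|lborel. indicat_real {0<..<1-s} t * Q ((a + s *\<^sub>R u) + t *\<^sub>R v))"
        proof (rule Bochner_Integration.integral_cong[OF refl])
        fix t
        have "a + s *\<^sub>R u + t *\<^sub>R v = (a + s *\<^sub>R u) + t *\<^sub>R v" by simp
        moreover have "indicat_real ?T (a + s *\<^sub>R u + t *\<^sub>R v) = indicat_real {0<..<1-s} t"
          using True by (auto simp: inT indicator_def)
        ultimately show "indicat_real ?T (a + s *\<^sub>R u + t *\<^sub>R v) * Q (a + s *\<^sub>R u + t *\<^sub>R v) = indicat_real {0<..<1-s} t * Q ((a + s *\<^sub>R u) + t *\<^sub>R v)"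
          by (simp only:)
      qed
      also have "\<dots> = cross2 u (\<phi> ((a + s *\<^sub>R u) + (1 - s) *\<^sub>R v)) - cross2 u (\<phi> ((a + s *\<^sub>R u) + 0 *\<^sub>R v))"
      proof (rule LINT_open_interval_FTC[where F = "\<lambda>t. cross2 u (\<phi> ((a + s *\<^sub>R u) + t *\<^sub>R v))"])
        show "continuous_on UNIV (\<lambda>t. Q ((a + s *\<^sub>R u) + t *\<^sub>R v))"
          by (intro continuous_on_compose2[OF cQ] continuous_intros) auto
        show "((\<lambda>t. cross2 u (\<phi> ((a + s *\<^sub>R u) + t *\<^sub>R v))) has_field_derivative Q ((a + s *\<^sub>R u) + x *\<^sub>R v)) (at x)" for x
          unfolding Q_def by (rule has_field_derivative_along[OF \<phi> bounded_linear_cross2_right])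
      qed (use True in simp)
      also have "(a + s *\<^sub>R u) + (1 - s) *\<^sub>R v = c + s *\<^sub>R (b - c)"
        by (simp add: u_def v_def algebra_simps)
      finally show ?thesis using True by simp
    next
      case False
      then have "a + s *\<^sub>R u + t *\<^sub>R v \<notin> ?T" for t using inT by auto
      then show ?thesis using False by auto
    qed
  qed
  also have "\<dots> = integral {0..1} (\<lambda>s. cross2 u (\<phi> (c + s *\<^sub>R (b - c))) - cross2 u (\<phi> (a + s *\<^sub>R u)))"
    by (intro LINT_open_interval_eq continuous_intros continuous_on_compose2[OF c\<phi>]) auto
  also have "\<dots> = integral {0..1} (\<lambda>s. cross2 u (\<phi> (c + s *\<^sub>R (b - c)))) - integral {0..1} (\<lambda>s. cross2 u (\<phi> (a + s *\<^sub>R u)))"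
    by (intro Henstock_Kurzweil_Integration.integral_diff integrable_continuous_interval continuous_intros continuous_on_compose2[OF c\<phi>]) auto
  also have "integral {0..1} (\<lambda>s. cross2 u (\<phi> (a + s *\<^sub>R u))) = - flux \<phi> a b"
    using cross2_commute[of u] by (simp add: flux_def u_def)
  \<comment> \<open>The two slicings traverse the edge between \<open>b\<close> and \<open>c\<close>
    in opposite directions, so one of them is reflected.\<close>
  also have "integral {0..1} (\<lambda>s. cross2 u (\<phi> (c + s *\<^sub>R (b - c)))) = integral {0..1} (\<lambda>s. - cross2 (\<phi> (b + s *\<^sub>R (c - b))) u)"
  proof -
    have "c + (1 - x) *\<^sub>R (b - c) = b + x *\<^sub>R (c - b)" for x by (simp add: algebra_simps)
    then show ?thesis
      using integral_reflect_01[of "\<lambda>s. cross2 u (\<phi> (c + s *\<^sub>R (b - c)))"] cross2_commute[of u] by simp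
  qed
  also have "\<dots> = - integral {0..1} (\<lambda>s. cross2 (\<phi> (b + s *\<^sub>R (c - b))) u)" by simp
  finally have "(LINT x|lborel. indicat_real ?T x * divergence \<phi> x) =
     (integral {0..1} (\<lambda>t. cross2 (\<phi> (b + t *\<^sub>R (c - b))) v) - flux \<phi> a c) +
     (- integral {0..1} (\<lambda>s. cross2 (\<phi> (b + s *\<^sub>R (c - b))) u) + flux \<phi> a b)"
    using k(2) by (simp flip: distrib_left)
  moreover have "integral {0..1} (\<lambda>t. cross2 (\<phi> (b + t *\<^sub>R (c - b))) v) - integral {0..1} (\<lambda>s. cross2 (\<phi> (b + s *\<^sub>R (c - b))) u)
     = flux \<phi> b c"
  proof -
    have "flux \<phi> b c = integral {0..1} (\<lambda>t. cross2 (\<phi> (b + t *\<^sub>R (c - b))) v - cross2 (\<phi> (b + t *\<^sub>R (c - b))) u)"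
      by (simp add: flux_def u_def v_def cross2_simps)
    also have "\<dots> = integral {0..1} (\<lambda>t. cross2 (\<phi> (b + t *\<^sub>R (c - b))) v) - integral {0..1} (\<lambda>s. cross2 (\<phi> (b + s *\<^sub>R (c - b))) u)"
      by (intro Henstock_Kurzweil_Integration.integral_diff integrable_continuous_interval continuous_intros continuous_on_compose2[OF c\<phi>]) auto
    finally show ?thesis by simp
  qed
  moreover have "flux \<phi> c a = - flux \<phi> a c" by (rule flux_reverse)
  ultimately show ?thesis by linarith
qed

section \<open>Sectors\<close>

definition dir :: "real \<Rightarrow> real^2" where
  "dir t = vector [cos t, sin t]"

lemma dir_nth [simp]: "dir t $ 1 = cos t" "dir t $ 2 = sin t"
  by (simp_all add: dir_def)

lemma norm_dir [simp]: "norm (dir t) = 1"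
  by (simp add: norm_vec_def L2_set_def sum_2)

lemma dir_nonzero [simp]: "dir t \<noteq> 0"
  using norm_dir[of t] by (metis norm_zero zero_neq_one)

lemma cross2_dir: "cross2 (dir s) (dir t) = sin (t - s)"
  by (simp add: cross2_def sin_diff mult.commute)

lemma inner_dir: "dir s \<bullet> dir t = cos (t - s)"
  by (simp add: inner_vec_def sum_2 cos_diff mult.commute)

lemma dir_periodic: "dir (t + 2 * pi) = dir t" "dir (t - 2 * pi) = dir t"
  using sin_periodic[of "t - 2 * pi"] cos_periodic[of "t - 2 * pi"]
  by (simp_all add: vec_eq_iff forall_2)

lemma dir_eq_iff: "dir s = dir t \<longleftrightarrow> (\<exists>k::int. s = t + 2 * pi * k)"
  using sin_cos_eq_iff[of s t] by (auto simp: vec_eq_iff forall_2)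

lemma polar_unique:
  assumes "r *\<^sub>R dir s = r' *\<^sub>R dir t" "0 < r" "0 < r'" "\<bar>s - t\<bar> < 2 * pi"
  shows "r = r' \<and> s = t"
proof -
  have "norm (r *\<^sub>R dir s) = norm (r' *\<^sub>R dir t)" using assms(1) by simp
  then have r: "r = r'" using assms(2,3) by simp
  then have "dir s = dir t" using assms by simp
  then obtain k :: int where k: "s = t + 2 * pi * k" using dir_eq_iff by auto
  then have "2 * pi * \<bar>real_of_int k\<bar> < 2 * pi * 1" using assms(4) by (simp add: abs_mult)
  then have "\<bar>real_of_int k\<bar> < 1" by (subst (asm) mult_less_cancel_left_pos) auto
  then have "k = 0" by linarith
  then show ?thesis using r k by simp
qed

lemma polar_exists:
  fixes x :: "real^2"
  assumes "x \<noteq> 0"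
  obtains r t where "0 < r" "a < t" "t \<le> a + 2 * pi" "x = r *\<^sub>R dir t"
proof -
  define r where "r = norm x"
  have r: "0 < r" using assms by (simp add: r_def)
  have "(x$1)\<^sup>2 + (x$2)\<^sup>2 = r\<^sup>2"
    by (simp add: r_def norm_vec_def L2_set_def sum_2)
  then have "(x$1 / r)\<^sup>2 + (x$2 / r)\<^sup>2 = 1"
    using r by (simp add: power_divide flip: add_divide_distrib)
  then obtain t where t: "x$1 / r = cos t" "x$2 / r = sin t"
    using sincos_total_2pi_le by metis
  \<comment> \<open>This integer moves the angle into the window from \<open>a\<close> to
    \<open>a + 2 * pi\<close> that is closed on the left. The lemma wants it closed on the right,
    hence the separate treatment of \<open>?t = a\<close>.\<close>
  define k where "k = \<lceil>(a - t) / (2 * pi) + 1\<rceil> - 1"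
  let ?t = "t + 2 * pi * real_of_int k"
  have "\<lceil>(a - t) / (2 * pi) + 1\<rceil> - 1 < (a - t) / (2 * pi) + 1" "(a - t) / (2 * pi) + 1 \<le> \<lceil>(a - t) / (2 * pi) + 1\<rceil>"
    by linarith+
  then have "real_of_int k < (a - t) / (2 * pi) + 1" "(a - t) / (2 * pi) \<le> k"
    unfolding k_def by linarith+
  then have k: "2 * pi * real_of_int k < a - t + 2 * pi" "a - t \<le> 2 * pi * real_of_int k"
    by (simp_all add: field_simps)
  have d: "dir (t + 2 * pi * real_of_int m) = dir t" for m
    using dir_eq_iff by blast
  have x: "x = r *\<^sub>R dir t"
    using t r by (simp add: vec_eq_iff forall_2 field_simps)
  show thesis
  proof (cases "?t = a")
    case True
    then show thesis using that[of r "a + 2 * pi"] r x d[of k] dir_periodic(1)[of a] by simp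
  next
    case False
    then show thesis using that[of r ?t] r x d[of k] k by auto
  qed
qed

lemma mem_sector: "x \<in> sector \<theta> \<gamma> \<longleftrightarrow> (\<exists>r t. 0 < r \<and> \<theta> < t \<and> t < \<theta> + \<gamma> \<and> x = r *\<^sub>R dir t)"
proof -
  have "vector [r * cos t, r * sin t] = r *\<^sub>R dir t" for r t
    by (simp add: vec_eq_iff forall_2)
  then show ?thesis by (auto simp: sector_def)
qed

lemma dir_mem_sector: "\<theta> < t \<Longrightarrow> t < \<theta> + \<gamma> \<Longrightarrow> 0 < r \<Longrightarrow> r *\<^sub>R dir t \<in> sector \<theta> \<gamma>"
  by (auto simp: mem_sector)

lemma sector_shift: "sector (\<theta> + 2 * pi) \<gamma> = sector \<theta> \<gamma>"
proof (intro set_eqI iffI)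
  fix x assume "x \<in> sector (\<theta> + 2 * pi) \<gamma>"
  then obtain r t where "0 < r" "\<theta> + 2 * pi < t" "t < \<theta> + 2 * pi + \<gamma>" "x = r *\<^sub>R dir t" by (auto simp: mem_sector)
  then show "x \<in> sector \<theta> \<gamma>" using dir_mem_sector[of \<theta> "t - 2 * pi" \<gamma> r] dir_periodic(2)[of t] by simp
next
  fix x assume "x \<in> sector \<theta> \<gamma>"
  then obtain r t where "0 < r" "\<theta> < t" "t < \<theta> + \<gamma>" "x = r *\<^sub>R dir t" by (auto simp: mem_sector)
  then show "x \<in> sector (\<theta> + 2 * pi) \<gamma>" using dir_mem_sector[of "\<theta> + 2 * pi" "t + 2 * pi" \<gamma> r] dir_periodic(1)[of t] by simp
qed

text \<open>Below a half turn a sector is the intersection of two half planes. For the backward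
  direction the angle is taken within \<open>pi\<close> of \<open>\<theta>\<close>, where the signs
  of the two sines decide the two inequalities.\<close>

lemma sector_cross2:
  assumes "0 < \<gamma>" "\<gamma> < pi"
  shows "x \<in> sector \<theta> \<gamma> \<longleftrightarrow> 0 < cross2 (dir \<theta>) x \<and> 0 < cross2 x (dir (\<theta> + \<gamma>))"
proof
  assume "x \<in> sector \<theta> \<gamma>"
  then obtain r t where "0 < r" "\<theta> < t" "t < \<theta> + \<gamma>" and x: "x = r *\<^sub>R dir t" by (auto simp: mem_sector)
  then show "0 < cross2 (dir \<theta>) x \<and> 0 < cross2 x (dir (\<theta> + \<gamma>))"
    using assms by (auto simp: x cross2_simps cross2_dir intro!: mult_pos_pos sin_gt_zero)
next
  assume a: "0 < cross2 (dir \<theta>) x \<and> 0 < cross2 x (dir (\<theta> + \<gamma>))"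
  then have "x \<noteq> 0" by (auto simp: cross2_simps)
  then obtain r t where r: "0 < r" and t: "\<theta> - pi < t" "t \<le> \<theta> - pi + 2 * pi" and x: "x = r *\<^sub>R dir t"
    by (rule polar_exists[of x "\<theta> - pi"])
  have s1: "0 < sin (t - \<theta>)" and s2: "0 < sin (\<theta> + \<gamma> - t)"
    using a r by (auto simp: x cross2_simps cross2_dir zero_less_mult_iff)
  have "\<theta> < t"
  proof (rule ccontr)
    assume "\<not> \<theta> < t"
    then have "0 \<le> sin (\<theta> - t)" using t by (intro sin_ge_zero) auto
    moreover have "sin (\<theta> - t) = - sin (t - \<theta>)" by (metis minus_diff_eq sin_minus)
    ultimately show False using s1 by linarith
  qed
  moreover have "t < \<theta> + \<gamma>"
  proof (rule ccontr)
    assume "\<not> t < \<theta> + \<gamma>"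
    then have "0 \<le> sin (t - (\<theta> + \<gamma>))" using t assms by (intro sin_ge_zero) auto
    moreover have "sin (t - (\<theta> + \<gamma>)) = - sin (\<theta> + \<gamma> - t)" by (metis minus_diff_eq sin_minus)
    ultimately show False using s2 by linarith
  qed
  ultimately show "x \<in> sector \<theta> \<gamma>" using r x by (auto simp: mem_sector)
qed

lemma sector_mono:
  assumes "\<theta>' \<le> \<theta>" "\<theta> + \<gamma> \<le> \<theta>' + \<gamma>'"
  shows "sector \<theta> \<gamma> \<subseteq> sector \<theta>' \<gamma>'"
proof
  fix x assume "x \<in> sector \<theta> \<gamma>"
  then obtain r t where "0 < r" "\<theta> < t" "t < \<theta> + \<gamma>" "x = r *\<^sub>R dir t" by (auto simp: mem_sector)
  then show "x \<in> sector \<theta>' \<gamma>'" using assms dir_mem_sector[of \<theta>' t \<gamma>' r] by simp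
qed

lemma open_sector: "open (sector \<theta> \<gamma>)"
proof (subst open_subopen, intro ballI)
  fix x assume "x \<in> sector \<theta> \<gamma>"
  then obtain r t where r: "0 < r" and t: "\<theta> < t" "t < \<theta> + \<gamma>" and x: "x = r *\<^sub>R dir t" by (auto simp: mem_sector)
  \<comment> \<open>Wide sectors are not intersections of half planes. A narrow sector around the
    point, of opening \<open>2 * d < pi\<close>, is one and lies inside.\<close>
  define d where "d = min (pi/4) (min (t - \<theta>) (\<theta> + \<gamma> - t))"
  have d: "0 < d" "d \<le> pi / 4" "d \<le> t - \<theta>" "d \<le> \<theta> + \<gamma> - t"
    using t unfolding d_def by (auto simp del: divide_le_eq_numeral1 le_divide_eq_numeral1 simp: min.coboundedI1 min.coboundedI2)
  have d2: "0 < 2 * d" "2 * d < pi" using d pi_gt_zero by linarith+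
  have "sector (t - d) (2 * d) = {x. 0 < cross2 (dir (t - d)) x \<and> 0 < cross2 x (dir (t - d + 2 * d))}"
    using sector_cross2[OF d2, of _ "t - d"] by auto
  also have "open \<dots>" by (intro open_Collect_conj open_Collect_less continuous_intros)
  finally have "open (sector (t - d) (2 * d))" .
  moreover have "x \<in> sector (t - d) (2 * d)" using r x d by (auto intro: dir_mem_sector)
  moreover have "sector (t - d) (2 * d) \<subseteq> sector \<theta> \<gamma>" using d by (intro sector_mono) auto
  ultimately show "\<exists>T. open T \<and> x \<in> T \<and> T \<subseteq> sector \<theta> \<gamma>" by blast
qed

lemma sector_disjoint:
  assumes "\<theta> + \<gamma> \<le> \<theta>'" "\<theta>' + \<gamma>' \<le> \<theta> + 2 * pi"
  shows "sector \<theta> \<gamma> \<inter> sector \<theta>' \<gamma>' = {}"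
proof (rule ccontr)
  assume "sector \<theta> \<gamma> \<inter> sector \<theta>' \<gamma>' \<noteq> {}"
  then obtain r s r' t where "0 < r" "\<theta> < s" "s < \<theta> + \<gamma>" "0 < r'" "\<theta>' < t" "t < \<theta>' + \<gamma>'" "r *\<^sub>R dir s = r' *\<^sub>R dir t"
    by (auto simp: mem_sector)
  then show False using polar_unique[of r s r' t] assms by auto
qed

section \<open>Null lines and the divergence theorem on sectors\<close>

definition line :: "real^2 \<Rightarrow> (real^2) set" where
  "line u = {x. cross2 u x = 0}"

lemma closed_line: "closed (line u)"
  unfolding line_def by (intro closed_Collect_eq continuous_intros)

lemma AE_not_line:
  assumes "u \<noteq> 0"
  shows "AE x in lborel. x \<notin> line u"
proof -
  let ?n = "vector [- (u$2), u$1] :: real^2"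
  have "?n \<noteq> 0" using assms by (auto simp: vec_eq_iff forall_2)
  then have "negligible {x. ?n \<bullet> x = 0}" by (intro negligible_hyperplane) auto
  also have "{x. ?n \<bullet> x = 0} = line u"
    by (auto simp: line_def cross2_def inner_vec_def sum_2)
  finally have "emeasure lebesgue (line u) = 0"
    by (simp add: negligible_iff_null_sets null_sets_def)
  then have "line u \<in> null_sets lborel"
    using closed_line[of u] by (auto simp: null_sets_def)
  then show ?thesis by (rule AE_not_in)
qed

lemma dir_in_line: "r *\<^sub>R dir t \<in> line (dir t)"
  by (simp add: line_def cross2_simps)

lemma flux_beyond:
  assumes \<phi>: "\<phi> \<in> test_fields (ball 0 \<rho>)" and u: "norm u = 1" and R: "0 < \<rho>" "\<rho> < R"
  shows "flux \<phi> 0 (R *\<^sub>R u) = flux \<phi> 0 (\<rho> *\<^sub>R u)"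
proof -
  have "flux \<phi> (\<rho> *\<^sub>R u) (R *\<^sub>R u) = integral {0..1} (\<lambda>r::real. 0)"
    unfolding flux_def
  proof (rule integral_cong)
    fix r :: real assume r: "r \<in> {0..1}"
    have "\<rho> *\<^sub>R u + r *\<^sub>R (R *\<^sub>R u - \<rho> *\<^sub>R u) = (\<rho> + r * (R - \<rho>)) *\<^sub>R u"
      by (simp add: algebra_simps)
    moreover have "norm ((\<rho> + r * (R - \<rho>)) *\<^sub>R u) \<ge> \<rho>" using u r R by (simp add: mult_nonneg_nonneg)
    ultimately have "\<rho> *\<^sub>R u + r *\<^sub>R (R *\<^sub>R u - \<rho> *\<^sub>R u) \<notin> ball 0 \<rho>" by simp
    then show "cross2 (\<phi> (\<rho> *\<^sub>R u + r *\<^sub>R (R *\<^sub>R u - \<rho> *\<^sub>R u))) (R *\<^sub>R u - \<rho> *\<^sub>R u) = 0"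
      using test_fieldsD(6)[OF \<phi>] by (simp add: cross2_simps)
  qed
  then show ?thesis
    using flux_split[OF test_fieldsD(7)[OF \<phi>] R, of 0 u] by simp
qed

text \<open>On the ball that carries the field, the sector coincides with a triangle having a vertex
  at the origin and its opposite edge outside the ball. That edge has no flux, and the two others
  may be cut off at radius \<open>\<rho>\<close>.\<close>

lemma small_sector_divergence:
  assumes \<phi>: "\<phi> \<in> test_fields (ball 0 \<rho>)" and \<rho>: "0 < \<rho>" and \<gamma>: "0 < \<gamma>" "\<gamma> < pi"
  shows "(LINT x|lborel. indicat_real (sector \<theta> \<gamma>) x * divergence \<phi> x) =
    flux \<phi> 0 (\<rho> *\<^sub>R dir \<theta>) - flux \<phi> 0 (\<rho> *\<^sub>R dir (\<theta> + \<gamma>))"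
proof -
  define u v where "u = dir \<theta>" and "v = dir (\<theta> + \<gamma>)"
  define k where "k = cross2 u v"
  have k: "0 < k" "k \<le> 1"
    using sin_gt_zero[OF \<gamma>] by (simp_all add: k_def u_def v_def cross2_dir)
  have nu: "norm u = 1" "norm v = 1" by (simp_all add: u_def v_def)
  \<comment> \<open>On the far edge \<open>cross2 x v + cross2 u x = R * k\<close>, while this sum
    is below \<open>2 * \<rho>\<close> in the ball.\<close>
  define R where "R = 2 * \<rho> / k"
  have "2 * \<rho> \<le> R" using k \<rho> by (simp add: R_def field_simps)
  then have R: "\<rho> < R" "0 < R" using \<rho> by linarith+
  have kR: "cross2 (R *\<^sub>R u - 0) (R *\<^sub>R v - 0) = R * R * k" by (simp add: cross2_simps k_def)
  then have kR0: "0 < cross2 (R *\<^sub>R u - 0) (R *\<^sub>R v - 0)" using R k by simp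
  have small: "cross2 x v + cross2 u x < R * k" if "norm x < \<rho>" for x
  proof -
    have "cross2 x v + cross2 u x \<le> norm x + norm x"
      using cross2_bound[of x v] cross2_bound[of u x] nu by auto
    also have "\<dots> < R * k" using that k by (simp add: R_def)
    finally show ?thesis .
  qed
  have tri: "x \<in> triangle 0 (R *\<^sub>R u) (R *\<^sub>R v) \<longleftrightarrow> 0 < cross2 x v \<and> 0 < cross2 u x \<and> cross2 x v + cross2 u x < R * k" for x
  proof -
    have "x \<in> triangle 0 (R *\<^sub>R u) (R *\<^sub>R v) \<longleftrightarrow> 0 < R * cross2 x v \<and> 0 < R * cross2 u x \<and> R * (cross2 x v + cross2 u x) < R * (R * k)"
      unfolding mem_triangle_cross2[OF kR0] by (simp add: cross2_simps k_def algebra_simps)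
    then show ?thesis using R by (simp add: zero_less_mult_iff)
  qed
  have "(LINT x|lborel. indicat_real (sector \<theta> \<gamma>) x * divergence \<phi> x)
    = (LINT x|lborel. indicat_real (triangle 0 (R *\<^sub>R u) (R *\<^sub>R v)) x * divergence \<phi> x)"
  proof (rule Bochner_Integration.integral_cong[OF refl])
    fix x
    show "indicat_real (sector \<theta> \<gamma>) x * divergence \<phi> x = indicat_real (triangle 0 (R *\<^sub>R u) (R *\<^sub>R v)) x * divergence \<phi> x"
    proof (cases "norm x < \<rho>")
      case True
      then have "x \<in> sector \<theta> \<gamma> \<longleftrightarrow> x \<in> triangle 0 (R *\<^sub>R u) (R *\<^sub>R v)"
      proof -
        have "x \<in> sector \<theta> \<gamma> \<longleftrightarrow> 0 < cross2 u x \<and> 0 < cross2 x v"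
          by (simp add: sector_cross2[OF \<gamma>] u_def v_def)
        then show ?thesis using small[OF True] tri[of x] by blast
      qed
      then show ?thesis by (simp add: indicator_def)
    next
      case False
      then have "x \<notin> spt \<phi>" using test_fieldsD(4)[OF \<phi>] by auto
      then show ?thesis by (simp add: divergence_outside_spt[OF \<phi>])
    qed
  qed
  also have "\<dots> = flux \<phi> 0 (R *\<^sub>R u) + flux \<phi> (R *\<^sub>R u) (R *\<^sub>R v) + flux \<phi> (R *\<^sub>R v) 0"
    by (rule triangle_divergence[OF \<phi> kR0])
  also have "flux \<phi> (R *\<^sub>R u) (R *\<^sub>R v) = integral {0..1} (\<lambda>r::real. 0)"
    unfolding flux_def
  proof (rule integral_cong)
    fix r :: real assume r: "r \<in> {0..1}"
    let ?x = "R *\<^sub>R u + r *\<^sub>R (R *\<^sub>R v - R *\<^sub>R u)"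
    have "cross2 ?x v + cross2 u ?x = R * k"
      by (simp add: cross2_simps k_def algebra_simps)
    then have "?x \<notin> ball 0 \<rho>" using small[of ?x] by auto
    then show "cross2 (\<phi> ?x) (R *\<^sub>R v - R *\<^sub>R u) = 0"
      using test_fieldsD(6)[OF \<phi>] by (simp add: cross2_simps)
  qed
  finally show ?thesis
    using flux_beyond[OF \<phi> nu(1) \<rho> R(1)] flux_beyond[OF \<phi> nu(2) \<rho> R(1)] flux_reverse[of \<phi> "R *\<^sub>R v" 0]
    by (simp add: u_def v_def)
qed

lemma indicator_sector_split:
  assumes "0 < \<gamma>" "0 < \<gamma>'" "\<gamma> + \<gamma>' \<le> 2 * pi" "x \<notin> line (dir (\<theta> + \<gamma>))"
  shows "indicat_real (sector \<theta> (\<gamma> + \<gamma>')) x = indicat_real (sector \<theta> \<gamma>) x + indicat_real (sector (\<theta> + \<gamma>) \<gamma>') x"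
proof -
  have "sector \<theta> \<gamma> \<inter> sector (\<theta> + \<gamma>) \<gamma>' = {}"
    using assms by (intro sector_disjoint) auto
  moreover have "x \<in> sector \<theta> (\<gamma> + \<gamma>') \<longleftrightarrow> x \<in> sector \<theta> \<gamma> \<or> x \<in> sector (\<theta> + \<gamma>) \<gamma>'"
  proof
    assume "x \<in> sector \<theta> (\<gamma> + \<gamma>')"
    then obtain r t where rt: "0 < r" "\<theta> < t" "t < \<theta> + (\<gamma> + \<gamma>')" and x: "x = r *\<^sub>R dir t" by (auto simp: mem_sector)
    have "t \<noteq> \<theta> + \<gamma>" using assms(4) dir_in_line[of r] x by auto
    then consider "t < \<theta> + \<gamma>" | "\<theta> + \<gamma> < t" by linarith
    then show "x \<in> sector \<theta> \<gamma> \<or> x \<in> sector (\<theta> + \<gamma>) \<gamma>'"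
      by cases (use rt x in \<open>auto intro!: dir_mem_sector\<close>)
  next
    assume "x \<in> sector \<theta> \<gamma> \<or> x \<in> sector (\<theta> + \<gamma>) \<gamma>'"
    then show "x \<in> sector \<theta> (\<gamma> + \<gamma>')"
      using sector_mono[of \<theta> \<theta> \<gamma> "\<gamma> + \<gamma>'"] sector_mono[of \<theta> "\<theta> + \<gamma>" \<gamma>' "\<gamma> + \<gamma>'"] assms by auto
  qed
  ultimately show ?thesis by (auto simp: indicator_def)
qed

lemma LINT_sector_split:
  assumes \<phi>: "\<phi> \<in> test_fields \<Omega>" and "0 < \<gamma>" "0 < \<gamma>'" "\<gamma> + \<gamma>' \<le> 2 * pi"
  shows "(LINT x|lborel. indicat_real (sector \<theta> (\<gamma> + \<gamma>')) x * divergence \<phi> x) =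
    (LINT x|lborel. indicat_real (sector \<theta> \<gamma>) x * divergence \<phi> x) +
    (LINT x|lborel. indicat_real (sector (\<theta> + \<gamma>) \<gamma>') x * divergence \<phi> x)"
proof -
  have i: "integrable lborel (\<lambda>x. indicat_real (sector a b) x * divergence \<phi> x)" for a b
    using open_sector by (intro integrable_indicator_divergence[OF \<phi>]) auto
  have "(LINT x|lborel. indicat_real (sector \<theta> (\<gamma> + \<gamma>')) x * divergence \<phi> x) =
    (LINT x|lborel. indicat_real (sector \<theta> \<gamma>) x * divergence \<phi> x + indicat_real (sector (\<theta> + \<gamma>) \<gamma>') x * divergence \<phi> x)"
  proof (rule integral_cong_AE)
    show "AE x in lborel. indicat_real (sector \<theta> (\<gamma> + \<gamma>')) x * divergence \<phi> x =
      indicat_real (sector \<theta> \<gamma>) x * divergence \<phi> x + indicat_real (sector (\<theta> + \<gamma>) \<gamma>') x * divergence \<phi> x"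
      using AE_not_line[OF dir_nonzero, of "\<theta> + \<gamma>"]
      by eventually_elim (simp add: indicator_sector_split[OF assms(2-4)] distrib_right)
  qed (use i in \<open>auto intro!: borel_measurable_add borel_measurable_integrable\<close>)
  also have "\<dots> = (LINT x|lborel. indicat_real (sector \<theta> \<gamma>) x * divergence \<phi> x) +
    (LINT x|lborel. indicat_real (sector (\<theta> + \<gamma>) \<gamma>') x * divergence \<phi> x)"
    by (rule Bochner_Integration.integral_add[OF i i])
  finally show ?thesis .
qed

theorem sector_divergence:
  assumes \<phi>: "\<phi> \<in> test_fields (ball 0 \<rho>)" and \<rho>: "0 < \<rho>" and \<gamma>: "0 < \<gamma>" "\<gamma> \<le> 2 * pi"
  shows "(LINT x|lborel. indicat_real (sector \<theta> \<gamma>) x * divergence \<phi> x) =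
    flux \<phi> 0 (\<rho> *\<^sub>R dir \<theta>) - flux \<phi> 0 (\<rho> *\<^sub>R dir (\<theta> + \<gamma>))"
proof -
  \<comment> \<open>Thirds and not halves: half of a full turn would be \<open>pi\<close>, where the
    triangle of the previous lemma degenerates.\<close>
  have g: "0 < \<gamma> / 3" "\<gamma> / 3 < pi" using \<gamma> pi_gt_zero by linarith+
  note s = small_sector_divergence[OF \<phi> \<rho> g]
  have "(LINT x|lborel. indicat_real (sector \<theta> (\<gamma>/3 + (\<gamma>/3 + \<gamma>/3))) x * divergence \<phi> x) =
    flux \<phi> 0 (\<rho> *\<^sub>R dir \<theta>) - flux \<phi> 0 (\<rho> *\<^sub>R dir (\<theta> + \<gamma>/3 + \<gamma>/3 + \<gamma>/3))"
    using g \<gamma> by (subst LINT_sector_split[OF \<phi>], (auto)[3], subst LINT_sector_split[OF \<phi>], (auto)[3]) (simp add: s)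
  then show ?thesis by (simp add: add.assoc)
qed

lemma test_fields_ball:
  fixes \<phi> :: "real^2 \<Rightarrow> real^2"
  assumes "\<phi> \<in> test_fields \<Omega>"
  obtains \<rho> where "0 < \<rho>" "\<phi> \<in> test_fields (ball 0 \<rho>)"
proof -
  have "bounded (spt \<phi>)" using test_fieldsD(3)[OF assms] by (rule compact_imp_bounded)
  then obtain \<rho> where "0 < \<rho>" "spt \<phi> \<subseteq> ball 0 \<rho>" using bounded_subset_ballD by blast
  then show thesis using assms that by (auto simp: test_fields_def)
qed

text \<open>A sector of opening \<open>2 * pi\<close> misses only a ray, and its two boundary fluxes
  run along that same ray and cancel.\<close>

lemma LINT_divergence_zero:
  fixes \<phi> :: "real^2 \<Rightarrow> real^2"
  assumes \<phi>: "\<phi> \<in> test_fields \<Omega>"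
  shows "(LINT x|lborel. divergence \<phi> x) = 0"
proof -
  obtain \<rho> where \<rho>: "0 < \<rho>" "\<phi> \<in> test_fields (ball 0 \<rho>)" using test_fields_ball[OF \<phi>] .
  have "(LINT x|lborel. divergence \<phi> x) = (LINT x|lborel. indicat_real (sector 0 (2 * pi)) x * divergence \<phi> x)"
  proof (rule integral_cong_AE)
    show "AE x in lborel. divergence \<phi> x = indicat_real (sector 0 (2 * pi)) x * divergence \<phi> x"
      using AE_not_line[OF dir_nonzero, of 0]
    proof eventually_elim
      case (elim x)
      then have "x \<noteq> 0" by (auto simp: line_def cross2_simps)
      then obtain r t where "0 < r" "0 < t" "t \<le> 0 + 2 * pi" "x = r *\<^sub>R dir t"
        by (rule polar_exists)
      moreover have "t \<noteq> 2 * pi"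
        using elim calculation dir_in_line[of r 0] dir_periodic(1)[of 0] by force
      ultimately have "x \<in> sector 0 (2 * pi)" using dir_mem_sector[of 0 t "2 * pi" r] by simp
      then show ?case by simp
    qed
  qed (use integrable_divergence[OF \<phi>] integrable_indicator_divergence[OF \<phi>, of "sector 0 (2 * pi)"] open_sector in auto)
  also have "\<dots> = 0"
    using sector_divergence[OF \<rho>(2) \<rho>(1), of "2 * pi" 0] dir_periodic(1)[of 0] by simp
  finally show ?thesis .
qed

section \<open>The perimeter functional\<close>

lemma zero_test_field: "(\<lambda>_. 0) \<in> test_fields \<Omega>"
  by (simp add: test_fields_def spt_def)

lemma perimeter_upper:
  "\<phi> \<in> test_fields U \<Longrightarrow> ereal (LINT x:E|lebesgue. divergence \<phi> x) \<le> perimeter E U"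
  unfolding perimeter_def by (rule SUP_upper)

lemma perimeter_least:
  assumes "\<And>\<phi>. \<phi> \<in> test_fields U \<Longrightarrow> (LINT x:E|lebesgue. divergence \<phi> x) \<le> c"
  shows "perimeter E U \<le> ereal c"
  unfolding perimeter_def using assms by (intro SUP_least) auto

lemma perimeter_nonneg: "0 \<le> perimeter E U"
proof -
  have "divergence (\<lambda>_. 0 :: 'a) = (\<lambda>_. 0)" by (auto simp: divergence_def)
  then show ?thesis
    using perimeter_upper[OF zero_test_field, of E U] by (simp add: zero_ereal_def set_lebesgue_integral_def)
qed

lemma test_fields_mono: "\<phi> \<in> test_fields U \<Longrightarrow> U \<subseteq> V \<Longrightarrow> \<phi> \<in> test_fields V"
  by (auto simp: test_fields_def)

lemma perimeter_mono: "U \<subseteq> V \<Longrightarrow> perimeter E U \<le> perimeter E V"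
  unfolding perimeter_def by (intro SUP_subset_mono) (auto intro: test_fields_mono)

text \<open>If \<open>E\<close> fills \<open>U\<close> up to a null set, the integral is that of the
  whole divergence and vanishes. The form up to null sets lets \<open>U\<close> contain a ray
  between two sectors of one label.\<close>

lemma perimeter_null:
  fixes E :: "(real^2) set"
  assumes "E \<in> sets borel" "(AE x in lborel. x \<in> U \<longrightarrow> x \<notin> E) \<or> (AE x in lborel. x \<in> U \<longrightarrow> x \<in> E)"
  shows "perimeter E U = 0"
proof -
  have "(LINT x:E|lebesgue. divergence \<phi> x) \<le> 0" if \<phi>: "\<phi> \<in> test_fields U" for \<phi> :: "real^2 \<Rightarrow> real^2"
  proof -
    have d: "divergence \<phi> x = 0" if "x \<notin> U" for x
      using that divergence_outside_spt[OF \<phi>] test_fieldsD(4)[OF \<phi>] by auto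
    have m: "(\<lambda>x. indicat_real E x * divergence \<phi> x) \<in> borel_measurable lborel" "divergence \<phi> \<in> borel_measurable lborel"
      using integrable_indicator_divergence[OF \<phi> assms(1)] integrable_divergence[OF \<phi>] by auto
    from assms(2) have "(LINT x|lborel. indicat_real E x * divergence \<phi> x) = 0"
    proof
      assume "AE x in lborel. x \<in> U \<longrightarrow> x \<notin> E"
      then have "AE x in lborel. indicat_real E x * divergence \<phi> x = 0"
      proof eventually_elim
        case (elim x) then show ?case using d[of x] by (cases "x \<in> U") simp_all
      qed
      then show ?thesis by (rule integral_eq_zero_AE)
    next
      assume "AE x in lborel. x \<in> U \<longrightarrow> x \<in> E"
      then have "AE x in lborel. indicat_real E x * divergence \<phi> x = divergence \<phi> x"
      proof eventually_elim
        case (elim x) then show ?case using d[of x] by (cases "x \<in> U") simp_all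
      qed
      then have "(LINT x|lborel. indicat_real E x * divergence \<phi> x) = (LINT x|lborel. divergence \<phi> x)"
        by (rule integral_cong_AE[OF m])
      then show ?thesis by (simp add: LINT_divergence_zero[OF \<phi>])
    qed
    then show ?thesis by (simp add: set_integral_lebesgue_divergence[OF \<phi> assms(1)])
  qed
  then have "perimeter E U \<le> ereal 0" by (rule perimeter_least)
  then show ?thesis using perimeter_nonneg[of E U] by (simp add: zero_ereal_def)
qed

lemma spt_add: "spt (\<lambda>x. f x + g x :: 'b::monoid_add) \<subseteq> spt f \<union> spt g"
  unfolding spt_def closure_Un[symmetric] by (rule closure_mono) auto

lemma test_fields_add_disjoint:
  fixes \<phi> \<psi> :: "real^2 \<Rightarrow> real^2"
  assumes \<phi>: "\<phi> \<in> test_fields U" and \<psi>: "\<psi> \<in> test_fields V" and "U \<inter> V = {}"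
  shows "(\<lambda>x. \<phi> x + \<psi> x) \<in> test_fields (U \<union> V)"
    and "divergence (\<lambda>x. \<phi> x + \<psi> x) x = divergence \<phi> x + divergence \<psi> x"
proof -
  note D = test_fieldsD[OF \<phi>] and D' = test_fieldsD[OF \<psi>]
  have h: "((\<lambda>x. \<phi> x + \<psi> x) has_derivative (\<lambda>h. frechet_derivative \<phi> (at x) h + frechet_derivative \<psi> (at x) h)) (at x)" for x
    by (intro has_derivative_add D(1) D'(1))
  then have f: "frechet_derivative (\<lambda>x. \<phi> x + \<psi> x) (at x) = (\<lambda>h. frechet_derivative \<phi> (at x) h + frechet_derivative \<psi> (at x) h)" for x
    by (simp add: frechet_derivative_at[symmetric])
  then show "divergence (\<lambda>x. \<phi> x + \<psi> x) x = divergence \<phi> x + divergence \<psi> x"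
    by (simp add: divergence_vec2)
  have s: "spt (\<lambda>x. \<phi> x + \<psi> x) \<subseteq> spt \<phi> \<union> spt \<psi>" by (rule spt_add)
  have "compact ((spt \<phi> \<union> spt \<psi>) \<inter> spt (\<lambda>x. \<phi> x + \<psi> x))"
    using D(3) D'(3) by (intro compact_Int_closed compact_Un) (auto simp: spt_def)
  then have "compact (spt (\<lambda>x. \<phi> x + \<psi> x))" using s by (simp add: Int_absorb1)
  moreover have "norm (\<phi> x + \<psi> x) \<le> 1" for x
  proof -
    have "x \<notin> U \<or> x \<notin> V" using assms(3) by auto
    then show ?thesis using D(5,6)[of x] D'(5,6)[of x] by auto
  qed
  moreover have "(\<lambda>x. \<phi> x + \<psi> x) differentiable at x" for x
    using h by (auto simp: differentiable_def)
  ultimately show "(\<lambda>x. \<phi> x + \<psi> x) \<in> test_fields (U \<union> V)"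
    using s D(4) D'(4) by (auto simp: test_fields_def f intro!: continuous_intros D(2) D'(2))
qed

text \<open>Fields supported in disjoint sets can be added without violating the bound 1 on the
  norm. In this way lower bounds at single rays add up.\<close>

lemma perimeter_superadditive:
  fixes E :: "(real^2) set"
  assumes E: "E \<in> sets borel" and "U \<inter> V = {}"
  shows "perimeter E U + perimeter E V \<le> perimeter E (U \<union> V)"
proof -
  have "ereal (LINT x:E|lebesgue. divergence \<phi> x) + ereal (LINT x:E|lebesgue. divergence \<psi> x) \<le> perimeter E (U \<union> V)"
    if \<phi>: "\<phi> \<in> test_fields U" and \<psi>: "\<psi> \<in> test_fields V" for \<phi> \<psi> :: "real^2 \<Rightarrow> real^2"
  proof -
    note a = test_fields_add_disjoint[OF \<phi> \<psi> assms(2)]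
    have "(LINT x:E|lebesgue. divergence (\<lambda>x. \<phi> x + \<psi> x) x)
       = (LINT x|lborel. indicat_real E x * divergence \<phi> x + indicat_real E x * divergence \<psi> x)"
      unfolding set_integral_lebesgue_divergence[OF a(1) E] by (simp add: a(2) distrib_left)
    also have "\<dots> = (LINT x|lborel. indicat_real E x * divergence \<phi> x) + (LINT x|lborel. indicat_real E x * divergence \<psi> x)"
      by (intro Bochner_Integration.integral_add integrable_indicator_divergence[OF \<phi> E] integrable_indicator_divergence[OF \<psi> E])
    finally show ?thesis
      using perimeter_upper[OF a(1), of E]
      by (simp add: set_integral_lebesgue_divergence[OF \<phi> E] set_integral_lebesgue_divergence[OF \<psi> E])
  qed
  then have "ereal (LINT x:E|lebesgue. divergence \<phi> x) + perimeter E V \<le> perimeter E (U \<union> V)"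
    if \<phi>: "\<phi> \<in> test_fields U" for \<phi> :: "real^2 \<Rightarrow> real^2"
    using that unfolding perimeter_def[of E V]
    by (subst SUP_ereal_add_right[symmetric]) (use zero_test_field in \<open>auto intro!: SUP_least\<close>)
  then show ?thesis
    unfolding perimeter_def[of E U]
    by (subst SUP_ereal_add_left[symmetric]) (use zero_test_field perimeter_nonneg[of E V] in \<open>auto intro!: SUP_least\<close>)
qed

lemma perimeter_superadditive_sum:
  fixes E :: "(real^2) set"
  assumes E: "E \<in> sets borel" and I: "finite I" and d: "disjoint_family_on U I"
  shows "(\<Sum>i\<in>I. perimeter E (U i)) \<le> perimeter E (\<Union>i\<in>I. U i)"
  using I d
proof (induction I rule: finite_induct)
  case empty
  then show ?case by (simp add: perimeter_nonneg)
next
  case (insert i I)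
  have "U i \<inter> (\<Union>i\<in>I. U i) = {}" using insert by (auto simp: disjoint_family_on_def)
  from perimeter_superadditive[OF E this]
  have "perimeter E (U i) + perimeter E (\<Union>i\<in>I. U i) \<le> perimeter E (\<Union>i\<in>insert i I. U i)" by simp
  moreover have "(\<Sum>i\<in>I. perimeter E (U i)) \<le> perimeter E (\<Union>i\<in>I. U i)"
    using insert by (auto simp: disjoint_family_on_def)
  ultimately show ?case using insert(1,2) by (simp add: add_left_mono order_trans[rotated])
qed

section \<open>Cut-off functions of class C^1 built from truncated squares\<close>

definition sqplus :: "real \<Rightarrow> real" where "sqplus x = x * max 0 x"

lemma sqplus_deriv: "(sqplus has_field_derivative 2 * max 0 x) (at x)"
proof (cases "x = 0")
  case True
  have "\<exists>g. (\<forall>z. sqplus z - sqplus 0 = g z * (z - 0)) \<and> isCont g 0 \<and> g 0 = 0"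
    by (rule exI[of _ "\<lambda>z. max 0 z"]) (auto simp: sqplus_def intro!: continuous_intros)
  then show ?thesis using True by (simp add: CARAT_DERIV)
next
  case False
  then consider "x < 0" | "0 < x" by linarith
  then show ?thesis
  proof cases
    case 1
    have "((\<lambda>_. 0) has_field_derivative 0) (at x)" by simp
    then have "(sqplus has_field_derivative 0) (at x)"
      by (rule has_field_derivative_transform_within_open[where S="{..<0}"]) (use 1 in \<open>auto simp: sqplus_def\<close>)
    then show ?thesis using 1 by simp
  next
    case 2
    have "((\<lambda>x. x * x) has_field_derivative 2 * x) (at x)" by (auto intro!: derivative_eq_intros)
    then have "(sqplus has_field_derivative 2 * x) (at x)"
      by (rule has_field_derivative_transform_within_open[where S="{0<..}"]) (use 2 in \<open>auto simp: sqplus_def\<close>)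
    then show ?thesis using 2 by simp
  qed
qed

text \<open>A quadratic spline with knots at \<open>a\<close>, the midpoint and \<open>b\<close>,
  rising from 0 to 1: a scaled second difference of truncated squares.\<close>

definition ramp :: "real \<Rightarrow> real \<Rightarrow> real \<Rightarrow> real" where
  "ramp a b x = 2 * (sqplus ((x - a) / (b - a)) - 2 * sqplus ((x - a) / (b - a) - 1/2) + sqplus ((x - a) / (b - a) - 1))"

text \<open>The hat function over the interval from \<open>a\<close> to \<open>b\<close>, of height
  \<open>2 / (b - a)\<close> and integral 1.\<close>

definition ramp_deriv :: "real \<Rightarrow> real \<Rightarrow> real \<Rightarrow> real" where
  "ramp_deriv a b x = 4 * (max 0 ((x - a) / (b - a)) - 2 * max 0 ((x - a) / (b - a) - 1/2) + max 0 ((x - a) / (b - a) - 1)) / (b - a)"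

lemma ramp_has_deriv:
  assumes "a < b"
  shows "(ramp a b has_field_derivative ramp_deriv a b x) (at x)"
proof -
  have q: "((\<lambda>x. sqplus ((x - a) / (b - a) - k)) has_field_derivative 2 * max 0 ((x - a) / (b - a) - k) * (1 / (b - a))) (at x)" for k
  proof (rule DERIV_chain2[OF sqplus_deriv])
    have "((\<lambda>x. (x - a) / (b - a)) has_field_derivative 1 / (b - a)) (at x)"
      by (intro DERIV_cdivide DERIV_diff[OF DERIV_ident DERIV_const, of a x UNIV, simplified])
    from DERIV_diff[OF this DERIV_const[of k]]
    show "((\<lambda>x. (x - a) / (b - a) - k) has_field_derivative 1 / (b - a)) (at x)" by simp
  qed
  have "(ramp a b has_field_derivative 2 * ((2 * max 0 ((x - a) / (b - a) - 0) * (1 / (b - a))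
    - 2 * (2 * max 0 ((x - a) / (b - a) - 1/2) * (1 / (b - a)))) + 2 * max 0 ((x - a) / (b - a) - 1) * (1 / (b - a)))) (at x)"
    unfolding ramp_def[abs_def] using q[of 0] by (intro DERIV_cmult DERIV_add DERIV_diff q) simp
  then show ?thesis
    by (rule DERIV_cong) (simp add: ramp_deriv_def add_divide_distrib diff_divide_distrib distrib_left right_diff_distrib)
qed

lemma continuous_ramp_deriv: "a < b \<Longrightarrow> continuous_on UNIV (ramp_deriv a b)"
  unfolding ramp_deriv_def[abs_def] by (intro continuous_intros) auto

lemma ramp_left: "a < b \<Longrightarrow> x \<le> a \<Longrightarrow> ramp a b x = 0"
  using divide_nonpos_pos[of "x - a" "b - a"] by (simp add: ramp_def sqplus_def max_def)

lemma ramp_right: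
  assumes "a < b" "b \<le> x" shows "ramp a b x = 1"
proof -
  define y where "y = (x - a) / (b - a)"
  have "1 \<le> y" using assms by (simp add: y_def)
  then show ?thesis unfolding ramp_def y_def[symmetric] by (simp add: sqplus_def field_simps)
qed

lemma ramp_deriv_bounds:
  assumes "a < b" shows "0 \<le> ramp_deriv a b x" "ramp_deriv a b x \<le> 2 / (b - a)"
    "x \<le> a \<or> b \<le> x \<Longrightarrow> ramp_deriv a b x = 0"
proof -
  define y where "y = (x - a) / (b - a)"
  have "0 \<le> 4 * (max 0 y - 2 * max 0 (y - 1/2) + max 0 (y - 1))" "4 * (max 0 y - 2 * max 0 (y - 1/2) + max 0 (y - 1)) \<le> 2"
    by (auto simp: max_def)
  then show "0 \<le> ramp_deriv a b x" "ramp_deriv a b x \<le> 2 / (b - a)"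
    unfolding ramp_deriv_def y_def[symmetric] using assms by (auto intro!: divide_nonneg_pos divide_right_mono)
  assume "x \<le> a \<or> b \<le> x"
  then have "y \<le> 0 \<or> 1 \<le> y" using assms by (auto simp: y_def divide_nonpos_pos)
  then show "ramp_deriv a b x = 0"
    unfolding ramp_deriv_def y_def[symmetric] by (auto simp: max_def)
qed

lemma ramp_bounds:
  assumes "a < b" shows "0 \<le> ramp a b x" "ramp a b x \<le> 1"
proof -
  have "mono (ramp a b)"
  proof (rule monoI)
    fix u v :: real assume "u \<le> v"
    then show "ramp a b u \<le> ramp a b v"
      by (rule DERIV_nonneg_imp_nondecreasing) (use ramp_has_deriv[OF assms] ramp_deriv_bounds(1)[OF assms] in blast)
  qed
  then show "0 \<le> ramp a b x" "ramp a b x \<le> 1"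
    using ramp_left[OF assms, of "min a x"] ramp_right[OF assms, of "max b x"]
      monoD[of "ramp a b" "min a x" x] monoD[of "ramp a b" x "max b x"] by auto
qed

lemma LINT_ramp_deriv:
  assumes "a < b"
  shows "integrable lborel (ramp_deriv a b)" "(LINT x|lborel. ramp_deriv a b x) = 1"
proof -
  show "integrable lborel (ramp_deriv a b)"
    using continuous_ramp_deriv[OF assms] compact_Icc[of a b]
  proof (rule integrable_continuous_compact_support)
    fix x assume "x \<notin> {a..b}"
    then have "x \<le> a \<or> b \<le> x" by auto
    then show "ramp_deriv a b x = 0" by (rule ramp_deriv_bounds(3)[OF assms])
  qed
  have "ramp_deriv a b x = indicat_real {a<..<b} x * ramp_deriv a b x" for x
    using ramp_deriv_bounds(3)[OF assms, of x] by (cases "x \<le> a \<or> b \<le> x") (auto simp: indicator_def)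
  then have "(LINT x|lborel. ramp_deriv a b x) = (LINT x|lborel. indicat_real {a<..<b} x * ramp_deriv a b x)"
    by (intro Bochner_Integration.integral_cong) auto
  also have "\<dots> = ramp a b b - ramp a b a"
    by (rule LINT_open_interval_FTC) (use assms continuous_ramp_deriv ramp_has_deriv in auto)
  finally show "(LINT x|lborel. ramp_deriv a b x) = 1"
    using ramp_left[OF assms, of a] ramp_right[OF assms, of b] by simp
qed

definition plateau :: "real \<Rightarrow> real \<Rightarrow> real \<Rightarrow> real \<Rightarrow> real \<Rightarrow> real" where
  "plateau a b c d x = ramp a b x - ramp c d x"

lemma plateau_deriv:
  "a < b \<Longrightarrow> c < d \<Longrightarrow> (plateau a b c d has_field_derivative ramp_deriv a b x - ramp_deriv c d x) (at x)"
  unfolding plateau_def[abs_def] by (intro DERIV_diff ramp_has_deriv)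

lemma plateau_props:
  assumes "a < b" "b \<le> c" "c < d"
  shows "0 \<le> plateau a b c d x" "plateau a b c d x \<le> 1" "x \<le> a \<or> d \<le> x \<Longrightarrow> plateau a b c d x = 0"
    "b \<le> x \<Longrightarrow> x \<le> c \<Longrightarrow> plateau a b c d x = 1"
proof -
  consider "x \<le> b" | "b \<le> x" by linarith
  then have "0 \<le> plateau a b c d x \<and> plateau a b c d x \<le> 1"
    by cases (use ramp_bounds[OF assms(1), of x] ramp_bounds[OF assms(3), of x] ramp_left[OF assms(3), of x] ramp_right[OF assms(1), of x] assms
      in \<open>auto simp: plateau_def\<close>)
  then show "0 \<le> plateau a b c d x" "plateau a b c d x \<le> 1" by auto
  show "x \<le> a \<or> d \<le> x \<Longrightarrow> plateau a b c d x = 0"  "b \<le> x \<Longrightarrow> x \<le> c \<Longrightarrow> plateau a b c d x = 1"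
    using ramp_left[OF assms(1), of x] ramp_left[OF assms(3), of x] ramp_right[OF assms(1), of x] ramp_right[OF assms(3), of x] assms
    by (auto simp: plateau_def)
qed

lemma continuous_plateau: "a < b \<Longrightarrow> c < d \<Longrightarrow> continuous_on S (plateau a b c d)"
  by (intro continuous_at_imp_continuous_on ballI) (rule DERIV_isCont[OF plateau_deriv])

lemma LINT_plateau:
  assumes "a < b" "b \<le> c" "c < d"
  shows "integrable lborel (plateau a b c d)" "c - b \<le> (LINT x|lborel. plateau a b c d x)"
proof -
  show i: "integrable lborel (plateau a b c d)"
    using continuous_plateau[of a b c d UNIV] assms plateau_props(3)[OF assms]
    by (intro integrable_continuous_compact_support[of _ "{a..d}"]) auto
  have "(LINT x|lborel. indicat_real {b..c} x) \<le> (LINT x|lborel. plateau a b c d x)"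
  proof (rule integral_mono)
    show "indicat_real {b..c} x \<le> plateau a b c d x" for x
      using plateau_props[OF assms, of x] by (auto simp: indicator_def)
    have "integrable lborel (indicat_real {b..c})"
      using assms by (intro integrable_real_indicator) auto
    then show "integrable lborel (\<lambda>x. indicat_real {b..c} x)" .
  qed (rule i)
  then show "c - b \<le> (LINT x|lborel. plateau a b c d x)" using assms by simp
qed

text \<open>The explicit test fields below all have a constant direction \<open>w\<close>, so that
  their divergence is a single directional derivative of the scalar factor.\<close>

lemma test_field_scaleR:
  fixes g :: "real^2 \<Rightarrow> real" and w :: "real^2"
  assumes g: "\<And>x. (g has_derivative g' x) (at x)" and c: "\<And>v. continuous_on UNIV (\<lambda>x. g' x v)"
    and K: "compact K" "K \<subseteq> \<Omega>" "\<And>x. x \<notin> K \<Longrightarrow> g x = 0" and b: "\<And>x. \<bar>g x\<bar> \<le> 1" and w: "norm w \<le> 1"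
  shows "(\<lambda>x. g x *\<^sub>R w) \<in> test_fields \<Omega>" "divergence (\<lambda>x. g x *\<^sub>R w) x = g' x w"
proof -
  have h: "((\<lambda>x. g x *\<^sub>R w) has_derivative (\<lambda>h. g' x h *\<^sub>R w)) (at x)" for x
    by (rule has_derivative_scaleR_left[OF g])
  then have f: "frechet_derivative (\<lambda>x. g x *\<^sub>R w) (at x) = (\<lambda>h. g' x h *\<^sub>R w)" for x
    by (simp add: frechet_derivative_at[symmetric])
  have w2: "w = w$1 *\<^sub>R axis 1 1 + w$2 *\<^sub>R axis 2 1" by (simp add: vec_eq_iff forall_2 axis_def)
  have "linear (g' x)" using g by (rule has_derivative_linear)
  from arg_cong[OF w2, of "g' x"] this show "divergence (\<lambda>x. g x *\<^sub>R w) x = g' x w"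
    by (simp add: divergence_vec2 f linear_add linear_scale mult.commute)
  have s: "spt (\<lambda>x. g x *\<^sub>R w) \<subseteq> K"
    unfolding spt_def using K compact_imp_closed by (intro closure_minimal) auto
  then have "compact (spt (\<lambda>x. g x *\<^sub>R w))"
    using K(1) compact_Int_closed[of K "spt (\<lambda>x. g x *\<^sub>R w)"] by (simp add: spt_def Int_absorb1)
  moreover have "norm (g x *\<^sub>R w) \<le> 1" for x
    using mult_mono[OF b[of x] w] by simp
  moreover have "(\<lambda>x. g x *\<^sub>R w) differentiable at x" for x
    using h by (auto simp: differentiable_def)
  ultimately show "(\<lambda>x. g x *\<^sub>R w) \<in> test_fields \<Omega>"
    using s K(2) by (auto simp: test_fields_def f intro!: continuous_intros c)
qed

section \<open>Explicit test fields\<close>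

definition rot :: "real^2 \<Rightarrow> real^2" where "rot u = vector [- (u$2), u$1]"

lemma rot_nth [simp]: "rot u $ 1 = - (u$2)" "rot u $ 2 = u$1"
  by (simp_all add: rot_def)

lemma norm_rot [simp]: "norm (rot u) = norm u"
  by (simp add: norm_vec_def L2_set_def sum_2 add.commute)

lemma inner_rot: "rot u \<bullet> x = cross2 u x" "x \<bullet> rot u = cross2 u x"
  by (simp_all add: inner_vec_def sum_2 cross2_def mult.commute)

lemma cross2_rot: "cross2 u (rot v) = u \<bullet> v" "cross2 (rot u) v = - (u \<bullet> v)"
  by (simp_all add: inner_vec_def sum_2 cross2_def)

lemma unit_decomposition:
  assumes "norm u = 1"
  shows "x = (x \<bullet> u) *\<^sub>R u + cross2 u x *\<^sub>R rot u"
proof -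
  have "(u$1)\<^sup>2 + (u$2)\<^sup>2 = 1"
    using assms by (simp add: norm_vec_def L2_set_def sum_2)
  then have "x$1 = x$1 * ((u$1)\<^sup>2 + (u$2)\<^sup>2)" "x$2 = x$2 * ((u$1)\<^sup>2 + (u$2)\<^sup>2)" by simp_all
  then show ?thesis
    by (simp add: vec_eq_iff forall_2 inner_vec_def sum_2 cross2_def power2_eq_square algebra_simps)
qed

lemma norm_le_coordinates:
  assumes "norm u = 1"
  shows "norm x \<le> \<bar>x \<bullet> u\<bar> + \<bar>cross2 u x\<bar>"
proof -
  have "norm x = norm ((x \<bullet> u) *\<^sub>R u + cross2 u x *\<^sub>R rot u)" using unit_decomposition[OF assms, of x] by simp
  also have "\<dots> \<le> norm ((x \<bullet> u) *\<^sub>R u) + norm (cross2 u x *\<^sub>R rot u)" by (rule norm_triangle_ineq)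
  finally show ?thesis using assms by simp
qed

lemma coordinates:
  assumes "norm u = 1"
  shows "(s *\<^sub>R u + t *\<^sub>R rot u) \<bullet> u = s" "cross2 u (s *\<^sub>R u + t *\<^sub>R rot u) = t" "cross2 u (rot u) = 1"
proof -
  have "u \<bullet> u = 1" using assms by (simp add: norm_eq_1)
  moreover have "rot u \<bullet> u = 0" by (simp add: inner_rot cross2_simps)
  ultimately show "(s *\<^sub>R u + t *\<^sub>R rot u) \<bullet> u = s" "cross2 u (s *\<^sub>R u + t *\<^sub>R rot u) = t" "cross2 u (rot u) = 1"
    by (simp_all add: inner_add_left cross2_simps cross2_rot)
qed

lemma LINT_unit_coordinates:
  fixes f :: "real^2 \<Rightarrow> real"
  assumes "norm u = 1" "integrable lborel f"
  shows "integral\<^sup>L lborel f = (LINT s|lborel. LINT t|lborel. f (s *\<^sub>R u + t *\<^sub>R rot u))"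
  using integral_affine_plane_fst[of u "rot u" f 0] assms coordinates(3)[OF assms(1)] by simp

lemma has_derivative_compose_field:
  fixes F :: "real \<Rightarrow> real"
  assumes "(g has_derivative g') (at x)" "(F has_field_derivative F') (at (g x))"
  shows "((\<lambda>x. F (g x)) has_derivative (\<lambda>h. F' * g' h)) (at x)"
  using has_derivative_compose[OF assms(1)] assms(2) by (simp add: has_field_derivative_def)

lemma has_derivative_inner_unit: "((\<lambda>x. x \<bullet> u) has_derivative (\<lambda>h. h \<bullet> u)) (at x)"
  by (auto intro!: derivative_eq_intros)

lemma has_derivative_cross2_unit: "(cross2 u has_derivative cross2 u) (at x)"
  by (rule bounded_linear_imp_has_derivative[OF bounded_linear_cross2_right])

text \<open>The test field transports mass from a neighbourhood of \<open>y\<close> to one of \<open>z\<close>: its divergence is a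
  positive bump at \<open>y\<close> minus a translate of the same bump at \<open>z\<close>.\<close>

lemma perimeter_pos:
  fixes E :: "(real^2) set"
  assumes E: "open E" and V: "open V" "convex V" and y: "y \<in> E" "y \<in> V" and z: "z \<in> V" "z \<notin> closure E"
  shows "0 < perimeter E V"
proof -
  have "y \<noteq> z" using y z closure_subset by blast
  define L u where "L = norm (z - y)" and "u = (1 / L) *\<^sub>R (z - y)"
  have L: "0 < L" using \<open>y \<noteq> z\<close> by (simp add: L_def)
  have u: "norm u = 1" using L by (simp add: u_def L_def)
  have zy: "z = y + L *\<^sub>R u" using L by (simp add: u_def)
  have uu: "u \<bullet> u = 1" using u by (simp add: norm_eq_1)
  have "open (E \<inter> V)" "y \<in> E \<inter> V" using assms by auto
  then obtain e1 where e1: "0 < e1" "ball y e1 \<subseteq> E \<inter> V" by (rule openE)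
  have "open (V - closure E)" "z \<in> V - closure E" using assms by auto
  then obtain e2 where e2: "0 < e2" "ball z e2 \<subseteq> V - closure E" by (rule openE)
  \<comment> \<open>Boxes of half-width \<open>e\<close> lie in balls of radius
    \<open>3 * e\<close>, hence in \<open>E \<inter> V\<close> around \<open>y\<close> and in
    \<open>V - closure E\<close> around \<open>z\<close>. The bound \<open>2 * e \<le> L\<close>
    keeps the rise and the fall of \<open>F\<close> apart.\<close>
  define e where "e = min (L / 2) (min e1 e2 / 3)"
  have e: "0 < e" "2 * e \<le> L" "3 * e \<le> e1" "3 * e \<le> e2" using L e1 e2 by (auto simp: e_def)
  have box: "x \<in> ball p (3 * e)" if "\<bar>(x - p) \<bullet> u\<bar> \<le> e" "\<bar>cross2 u (x - p)\<bar> \<le> e" for x p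
    using norm_le_coordinates[OF u, of "x - p"] that e(1) by (simp add: dist_norm norm_minus_commute)
  define Y c where "Y = y \<bullet> u" and "c = cross2 u y"
  have Z: "z \<bullet> u = Y + L" "cross2 u z = c" by (simp_all add: zy Y_def c_def uu inner_add_left cross2_simps)
  \<comment> \<open>\<open>F\<close> rises near \<open>y\<close>, falls near \<open>z\<close>, and
    is 1 in between; \<open>G\<close> cuts off transversally. The field lives on a thin strip along
    the segment from \<open>y\<close> to \<open>z\<close>.\<close>
  define F where "F = plateau (Y - e) (Y + e) (Y + L - e) (Y + L + e)"
  define F' where "F' = (\<lambda>s. ramp_deriv (Y - e) (Y + e) s - ramp_deriv (Y + L - e) (Y + L + e) s)"
  define G where "G = plateau (c - e) (c - e/2) (c + e/2) (c + e)"
  define G' where "G' = (\<lambda>s. ramp_deriv (c - e) (c - e/2) s - ramp_deriv (c + e/2) (c + e) s)"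
  have lt: "Y - e < Y + e" "Y + e \<le> Y + L - e" "Y + L - e < Y + L + e" 
    and lt2: "c - e < c - e/2" "c - e/2 \<le> c + e/2" "c + e/2 < c + e" using e by auto
  have dF: "(F has_field_derivative F' s) (at s)" for s unfolding F_def F'_def by (rule plateau_deriv[OF lt(1,3)])
  have dG: "(G has_field_derivative G' s) (at s)" for s unfolding G_def G'_def by (rule plateau_deriv[OF lt2(1,3)])
  have cF: "continuous_on UNIV F" "continuous_on UNIV G" "continuous_on UNIV F'" "continuous_on UNIV G'"
    unfolding F_def G_def F'_def G'_def using lt lt2 by (auto intro!: continuous_intros continuous_plateau continuous_ramp_deriv)
  note pF = plateau_props[OF lt, folded F_def] and pG = plateau_props[OF lt2, folded G_def]
  define g where "g = (\<lambda>x. F (x \<bullet> u) * G (cross2 u x))"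
  define g' where "g' = (\<lambda>x h. F (x \<bullet> u) * (G' (cross2 u x) * cross2 u h) + (F' (x \<bullet> u) * (h \<bullet> u)) * G (cross2 u x))"
  have g: "(g has_derivative g' x) (at x)" for x
    unfolding g_def g'_def
    by (intro has_derivative_mult has_derivative_compose_field[OF has_derivative_inner_unit dF]
        has_derivative_compose_field[OF has_derivative_cross2_unit dG])
  have cg: "continuous_on UNIV (\<lambda>x. g' x v)" for v
    unfolding g'_def
    by (intro continuous_intros continuous_on_compose2[OF cF(1)] continuous_on_compose2[OF cF(2)]
       continuous_on_compose2[OF cF(3)] continuous_on_compose2[OF cF(4)]) auto
  define K where "K = {x. Y - e \<le> x \<bullet> u \<and> x \<bullet> u \<le> Y + L + e \<and> c - e \<le> cross2 u x \<and> cross2 u x \<le> c + e}"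
  have "closed K"
    unfolding K_def by (intro closed_Collect_conj closed_Collect_le continuous_intros)
  moreover have "bounded K"
  proof (rule boundedI)
    fix x assume "x \<in> K"
    then show "norm x \<le> \<bar>Y - e\<bar> + \<bar>Y + L + e\<bar> + \<bar>c - e\<bar> + \<bar>c + e\<bar>"
      using norm_le_coordinates[OF u, of x] by (auto simp: K_def)
  qed
  ultimately have "compact K" by (simp add: compact_eq_bounded_closed)
  \<comment> \<open>A point of the strip is a convex combination of \<open>y + w\<close> and
    \<open>z + w\<close> with one and the same small offset \<open>w\<close>, so convexity of
    \<open>V\<close> applies.\<close>
  moreover have "K \<subseteq> V"
  proof
    fix x assume x: "x \<in> K"
    define l where "l = max 0 (min L (x \<bullet> u - Y))"
    define w where "w = x - y - l *\<^sub>R u"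
    have l: "0 \<le> l" "l \<le> L" using L by (auto simp: l_def)
    have "w \<bullet> u = x \<bullet> u - Y - l" "cross2 u w = cross2 u x - c"
      by (simp_all add: w_def inner_diff_left uu Y_def c_def cross2_simps)
    then have w: "\<bar>w \<bullet> u\<bar> \<le> e" "\<bar>cross2 u w\<bar> \<le> e" using x e by (auto simp: K_def l_def)
    have "y + w \<in> ball y (3 * e)" "z + w \<in> ball z (3 * e)" by (rule box; use w in simp)+
    then have "y + w \<in> V" "z + w \<in> V" using e e1 e2 by (auto simp: subset_iff)
    then have "(1 - l / L) *\<^sub>R (y + w) + (l / L) *\<^sub>R (z + w) \<in> V"
      using V(2) l L by (intro convexD) auto
    also have "(1 - l / L) *\<^sub>R (y + w) + (l / L) *\<^sub>R (z + w) = x"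
      using L by (simp add: zy w_def algebra_simps)
    finally show "x \<in> V" .
  qed
  moreover have g0: "g x = 0" if "x \<notin> K" for x
  proof -
    have "(x \<bullet> u \<le> Y - e \<or> Y + L + e \<le> x \<bullet> u) \<or> (cross2 u x \<le> c - e \<or> c + e \<le> cross2 u x)"
      using that by (auto simp: K_def)
    then show ?thesis using pF(3) pG(3) by (auto simp: g_def)
  qed
  moreover have "\<bar>g x\<bar> \<le> 1" for x
    using pF(1,2)[of "x \<bullet> u"] pG(1,2)[of "cross2 u x"] by (simp add: g_def abs_mult mult_le_one)
  ultimately have T: "(\<lambda>x. g x *\<^sub>R u) \<in> test_fields V" and D: "divergence (\<lambda>x. g x *\<^sub>R u) x = F' (x \<bullet> u) * G (cross2 u x)" for x
    using test_field_scaleR[of g g' K V u] g cg u by (auto simp: g'_def cross2_simps uu)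
  \<comment> \<open>The bump at \<open>y\<close>, the only part of the divergence that
    \<open>E\<close> sees.\<close>
  define b where "b = (\<lambda>x. ramp_deriv (Y - e) (Y + e) (x \<bullet> u) * G (cross2 u x))"
  have eqb: "indicat_real E x * (F' (x \<bullet> u) * G (cross2 u x)) = b x" for x
  proof (cases "\<bar>cross2 u x - c\<bar> \<le> e")
    case False
    then have "cross2 u x \<le> c - e \<or> c + e \<le> cross2 u x" by auto
    then show ?thesis using pG(3) by (simp add: b_def)
  next
    case True
    consider "\<bar>x \<bullet> u - Y\<bar> \<le> e" | "\<bar>x \<bullet> u - (Y + L)\<bar> \<le> e" | "\<bar>x \<bullet> u - Y\<bar> > e" "\<bar>x \<bullet> u - (Y + L)\<bar> > e" by linarith
    then show ?thesis
    proof cases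
      case 1
      have "x \<in> ball y (3 * e)"
        using 1 True by (intro box) (simp_all add: inner_diff_left cross2_simps Y_def c_def)
      then have "x \<in> E" using e e1(2) by (auto simp: subset_iff)
      moreover have "ramp_deriv (Y + L - e) (Y + L + e) (x \<bullet> u) = 0"
        using 1 e by (intro ramp_deriv_bounds(3)) auto
      ultimately show ?thesis by (simp add: b_def F'_def)
    next
      case 2
      have "x \<in> ball z (3 * e)"
        using 2 True by (intro box) (simp_all add: inner_diff_left cross2_simps Z)
      then have "x \<in> V - closure E" using e e2(2) by (auto simp: subset_iff)
      then have "x \<notin> E" using closure_subset[of E] by auto
      moreover have "ramp_deriv (Y - e) (Y + e) (x \<bullet> u) = 0"
        using 2 e by (intro ramp_deriv_bounds(3)) auto
      ultimately show ?thesis by (simp add: b_def)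
    next
      case 3
      have "ramp_deriv (Y - e) (Y + e) (x \<bullet> u) = 0" "ramp_deriv (Y + L - e) (Y + L + e) (x \<bullet> u) = 0"
        using 3 e by (intro ramp_deriv_bounds(3); auto)+
      then show ?thesis by (simp add: b_def F'_def)
    qed
  qed
  have Eb: "E \<in> sets borel" using E by auto
  have int: "integrable lborel b"
    using integrable_indicator_divergence[OF T Eb] by (simp add: D eqb)
  have "(LINT x:E|lebesgue. divergence (\<lambda>x. g x *\<^sub>R u) x) = integral\<^sup>L lborel b"
    unfolding set_integral_lebesgue_divergence[OF T Eb] by (simp add: D eqb)
  also have "\<dots> = (LINT s|lborel. LINT t|lborel. ramp_deriv (Y - e) (Y + e) s * G t)"
    unfolding LINT_unit_coordinates[OF u int] by (simp add: b_def coordinates[OF u])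
  also have "\<dots> = (LINT t|lborel. G t)"
    using LINT_ramp_deriv[OF lt(1)] by simp
  also have "\<dots> > 0"
    using LINT_plateau(2)[OF lt2] e by (simp add: G_def)
  finally have "ereal 0 < ereal (LINT x:E|lebesgue. divergence (\<lambda>x. g x *\<^sub>R u) x)" by simp
  also have "\<dots> \<le> perimeter E V" by (rule perimeter_upper[OF T])
  finally show ?thesis by (simp add: zero_ereal_def)
qed

section \<open>Cones in slope coordinates\<close>

lemma cone_scale_iff:
  assumes "cone_at_origin C" "0 < t"
  shows "t *\<^sub>R x \<in> C \<longleftrightarrow> x \<in> C"
proof
  assume "t *\<^sub>R x \<in> C"
  moreover have "(\<lambda>x. (1 / t) *\<^sub>R x) ` C = C" using assms by (simp add: cone_at_origin_def)
  ultimately have "(1 / t) *\<^sub>R t *\<^sub>R x \<in> C" by (metis imageI)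
  then show "x \<in> C" using assms by simp
next
  assume "x \<in> C" then show "t *\<^sub>R x \<in> C" using assms unfolding cone_at_origin_def by blast
qed

context
  fixes A :: "(real^2) set" and u :: "real^2" and f f' :: "real \<Rightarrow> real" and p q :: real
  assumes A: "A \<in> sets borel" "cone_at_origin A" and u: "norm u = 1"
    and f: "\<And>x. (f has_field_derivative f' x) (at x)" "continuous_on UNIV f'"
      "\<And>m. m \<notin> {p..q} \<Longrightarrow> f m = 0" "\<And>m. \<bar>f m\<bar> \<le> 1"
begin

text \<open>In the slope coordinates \<open>x = s u + s m u\<^sup>\<perp>\<close> the cone is a product, and the field
  \<open>a(s) f(m) u\<^sup>\<perp>\<close> has divergence \<open>a(s) f'(m) / s\<close>.\<close>

lemma perimeter_cone_plateau:
  assumes s: "0 < s0" "s0 < s1" "s1 \<le> s2" "s2 < s3"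
    and sub: "\<And>x. s0 \<le> x \<bullet> u \<Longrightarrow> x \<bullet> u \<le> s3 \<Longrightarrow> p * (x \<bullet> u) \<le> cross2 u x \<Longrightarrow> cross2 u x \<le> q * (x \<bullet> u) \<Longrightarrow> x \<in> \<Omega>"
  shows "ereal ((LINT s|lborel. plateau s0 s1 s2 s3 s) * (LINT m|lborel. indicat_real A (u + m *\<^sub>R rot u) * f' m))
    \<le> perimeter A \<Omega>"
proof -
  define a where "a = plateau s0 s1 s2 s3"
  define a' where "a' = (\<lambda>s. ramp_deriv s0 s1 s - ramp_deriv s2 s3 s)"
  have da: "(a has_field_derivative a' s) (at s)" for s unfolding a_def a'_def by (rule plateau_deriv[OF s(2,4)])
  note pa = plateau_props[OF s(2-4), folded a_def]
  have a0: "a x = 0" "a' x = 0" if "x \<le> s0" for x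
    using that pa(3)[of x] ramp_deriv_bounds(3)[OF s(2), of x] ramp_deriv_bounds(3)[OF s(4), of x] s by (auto simp: a'_def)
  have cf: "continuous_on UNIV f" using f(1) by (intro continuous_at_imp_continuous_on ballI) (rule DERIV_isCont)
  have ca: "continuous_on UNIV a" "continuous_on UNIV a'"
    unfolding a_def a'_def using s by (auto intro!: continuous_intros continuous_plateau continuous_ramp_deriv)
  have uu: "u \<bullet> u = 1" using u by (simp add: norm_eq_1)
  define g where "g = (\<lambda>x. a (x \<bullet> u) * f (cross2 u x / (x \<bullet> u)))"
  define g' where "g' = (\<lambda>x h. a (x \<bullet> u) * (f' (cross2 u x / (x \<bullet> u)) *
     ((cross2 u h * (x \<bullet> u) - cross2 u x * (h \<bullet> u)) / ((x \<bullet> u) * (x \<bullet> u)))) + (a' (x \<bullet> u) * (h \<bullet> u)) * f (cross2 u x / (x \<bullet> u)))"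
  have g: "(g has_derivative g' x) (at x)" for x
  proof (cases "x \<bullet> u < s0")
    case True
    have z: "g' x = (\<lambda>_. 0)" using a0[of "x \<bullet> u"] True by (simp add: g'_def)
    have o: "open {x. x \<bullet> u < s0}" by (intro open_Collect_less continuous_intros)
    have "((\<lambda>_. 0) has_derivative (\<lambda>_. 0)) (at x)" by simp
    then show ?thesis unfolding z
      by (rule has_derivative_transform_within_open[OF _ o]) (use True a0 in \<open>auto simp: g_def\<close>)
  next
    case False
    then have nz: "x \<bullet> u \<noteq> 0" using s by auto
    have "((\<lambda>x. cross2 u x / (x \<bullet> u)) has_derivative (\<lambda>h. (cross2 u h * (x \<bullet> u) - cross2 u x * (h \<bullet> u)) / ((x \<bullet> u) * (x \<bullet> u)))) (at x)"
      by (rule has_derivative_divide'[OF has_derivative_cross2_unit has_derivative_inner_unit nz])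
    from has_derivative_mult[OF has_derivative_compose_field[OF has_derivative_inner_unit da] has_derivative_compose_field[OF this f(1)]]
    show ?thesis unfolding g_def g'_def .
  qed
  \<comment> \<open>The quotient in the slope is singular where \<open>x \<bullet> u = 0\<close>,
    but the cut-off vanishes for \<open>x \<bullet> u < s0\<close>. Two overlapping open half planes
    therefore suffice.\<close>
  have cg: "continuous_on UNIV (\<lambda>x. g' x v)" for v
  proof -
    have "continuous_on {x. x \<bullet> u < s0} (\<lambda>x. g' x v)"
      by (rule continuous_on_eq[where f="\<lambda>_. 0"]) (use a0 in \<open>auto simp: g'_def\<close>)
    moreover have "continuous_on {x. 0 < x \<bullet> u} (\<lambda>x. g' x v)"
      unfolding g'_def
      by (intro continuous_intros continuous_on_compose2[OF ca(1)] continuous_on_compose2[OF ca(2)]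
         continuous_on_compose2[OF cf] continuous_on_compose2[OF f(2)]) auto
    moreover have "open {x. x \<bullet> u < s0}" "open {x. 0 < x \<bullet> u}"
      by (intro open_Collect_less continuous_intros)+
    ultimately have "continuous_on ({x. x \<bullet> u < s0} \<union> {x. 0 < x \<bullet> u}) (\<lambda>x. g' x v)"
      by (intro continuous_on_open_Un)
    moreover have "{x. x \<bullet> u < s0} \<union> {x. 0 < x \<bullet> u} = UNIV" using s by auto
    ultimately show ?thesis by simp
  qed
  define K where "K = {x. s0 \<le> x \<bullet> u \<and> x \<bullet> u \<le> s3 \<and> p * (x \<bullet> u) \<le> cross2 u x \<and> cross2 u x \<le> q * (x \<bullet> u)}"
  have "closed K"
    unfolding K_def by (intro closed_Collect_conj closed_Collect_le continuous_intros)
  moreover have "bounded K"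
  proof (rule boundedI)
    fix x assume x: "x \<in> K"
    then have i: "0 \<le> x \<bullet> u" "x \<bullet> u \<le> s3" using s by (auto simp: K_def)
    have "\<bar>p * (x \<bullet> u)\<bar> \<le> \<bar>p\<bar> * s3" "\<bar>q * (x \<bullet> u)\<bar> \<le> \<bar>q\<bar> * s3"
      using i by (auto simp: abs_mult intro!: mult_left_mono)
    then show "norm x \<le> s3 + \<bar>p\<bar> * s3 + \<bar>q\<bar> * s3"
      using norm_le_coordinates[OF u, of x] x i by (auto simp: K_def)
  qed
  ultimately have "compact K" by (simp add: compact_eq_bounded_closed)
  moreover have "K \<subseteq> \<Omega>" using sub by (auto simp: K_def)
  moreover have "g x = 0" if "x \<notin> K" for x
  proof (cases "x \<bullet> u \<le> s0 \<or> s3 \<le> x \<bullet> u")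
    case True then show ?thesis using pa(3) by (auto simp: g_def)
  next
    case False
    then have "0 < x \<bullet> u" using s by auto
    moreover have "\<not> (p * (x \<bullet> u) \<le> cross2 u x \<and> cross2 u x \<le> q * (x \<bullet> u))"
      using that False by (auto simp: K_def)
    ultimately have "cross2 u x / (x \<bullet> u) \<notin> {p..q}" by (simp add: field_simps)
    then show ?thesis using f(3) by (simp add: g_def)
  qed
  moreover have "\<bar>g x\<bar> \<le> 1" for x
    using pa(1,2)[of "x \<bullet> u"] f(4)[of "cross2 u x / (x \<bullet> u)"] by (simp add: g_def abs_mult mult_le_one)
  ultimately have T: "(\<lambda>x. g x *\<^sub>R rot u) \<in> test_fields \<Omega>"
    and D: "divergence (\<lambda>x. g x *\<^sub>R rot u) x = a (x \<bullet> u) * (f' (cross2 u x / (x \<bullet> u)) * ((x \<bullet> u) / ((x \<bullet> u) * (x \<bullet> u))))" for x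
    using test_field_scaleR[of g g' K \<Omega> "rot u"] g cg u by (auto simp: g'_def cross2_simps cross2_rot inner_rot uu)
  let ?C = "LINT m|lborel. indicat_real A (u + m *\<^sub>R rot u) * f' m"
  \<comment> \<open>Substituting \<open>t = s * m\<close>, the factor \<open>s\<close> cancels the
    \<open>1 / s\<close> of the divergence, and the cone has the same set of slopes at every height.
    All slices thus give the same constant up to the factor \<open>a s\<close>.\<close>
  have inner: "(LINT t|lborel. indicat_real A (s *\<^sub>R u + t *\<^sub>R rot u) * (a s * (f' (t / s) * (s / (s * s))))) = a s * ?C" for s
  proof (cases "s \<le> 0")
    case True
    then show ?thesis using a0[of s] s by simp
  next
    case False
    then have s': "0 < s" "s \<noteq> 0" by auto
    have "(LINT t|lborel. indicat_real A (s *\<^sub>R u + t *\<^sub>R rot u) * (a s * (f' (t / s) * (s / (s * s)))))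
      = \<bar>s\<bar> *\<^sub>R (LINT m|lborel. indicat_real A (s *\<^sub>R u + (0 + s * m) *\<^sub>R rot u) * (a s * (f' ((0 + s * m) / s) * (s / (s * s)))))"
      by (rule lborel_integral_real_affine[OF s'(2)])
    also have "\<dots> = s * (LINT m|lborel. (a s / s) * (indicat_real A (u + m *\<^sub>R rot u) * f' m))"
    proof -
      have "indicat_real A (s *\<^sub>R u + (0 + s * m) *\<^sub>R rot u) = indicat_real A (u + m *\<^sub>R rot u)" for m
        using cone_scale_iff[OF A(2) s'(1), of "u + m *\<^sub>R rot u"] by (simp add: indicator_def scaleR_add_right)
      then show ?thesis using s' by (simp add: mult_ac)
    qed
    also have "\<dots> = s * ((a s / s) * ?C)" by (subst integral_mult_right_zero) simp
    finally show ?thesis using s' by simp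
  qed
  have "(LINT x:A|lebesgue. divergence (\<lambda>x. g x *\<^sub>R rot u) x) = (LINT s|lborel. a s * ?C)"
    unfolding set_integral_lebesgue_divergence[OF T A(1)] LINT_unit_coordinates[OF u integrable_indicator_divergence[OF T A(1)]]
    by (simp only: D coordinates[OF u] inner)
  also have "\<dots> = (LINT s|lborel. a s) * ?C" by simp
  finally show ?thesis using perimeter_upper[OF T, of A] by (simp add: a_def)
qed

text \<open>The plateau must stay away from the vertex, where the slope is undefined, but its
  integral can be made arbitrarily close to \<open>r\<close>.\<close>

lemma perimeter_cone_ge:
  assumes r: "0 < r" and C: "0 \<le> (LINT m|lborel. indicat_real A (u + m *\<^sub>R rot u) * f' m)"
    and sub: "\<And>x. 0 < x \<bullet> u \<Longrightarrow> x \<bullet> u < r \<Longrightarrow> p * (x \<bullet> u) \<le> cross2 u x \<Longrightarrow> cross2 u x \<le> q * (x \<bullet> u) \<Longrightarrow> x \<in> \<Omega>"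
  shows "ereal (r * (LINT m|lborel. indicat_real A (u + m *\<^sub>R rot u) * f' m)) \<le> perimeter A \<Omega>"
proof (rule ccontr)
  let ?C = "LINT m|lborel. indicat_real A (u + m *\<^sub>R rot u) * f' m"
  assume "\<not> ?thesis"
  then have less: "perimeter A \<Omega> < ereal (r * ?C)" by simp
  then obtain P where P: "perimeter A \<Omega> = ereal P" "0 \<le> P" "P < r * ?C"
    using perimeter_nonneg[of A \<Omega>] by (cases "perimeter A \<Omega>") auto
  then have C0: "0 < ?C" using r C by (cases "?C = 0") auto
  \<comment> \<open>Cutting off \<open>e\<close> at both ends loses \<open>2 * e\<close> times the
    constant, which is at most half of the assumed gap.\<close>
  define e where "e = min (r / 4) ((r * ?C - P) / (4 * ?C))"
  have e: "0 < e" "e \<le> r / 4" "e \<le> (r * ?C - P) / (4 * ?C)" using r P C0 by (auto simp: e_def)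
  have "e * (4 * ?C) \<le> r * ?C - P" using e(3) C0 by (simp add: pos_le_divide_eq)
  moreover have "0 < e * ?C" using e C0 by simp
  moreover have "(r - 2 * e) * ?C = r * ?C - 2 * (e * ?C)" by (simp add: algebra_simps)
  ultimately have "P < (r - 2 * e) * ?C" by linarith
  also have "\<dots> \<le> (LINT s|lborel. plateau (e/2) e (r - e) (r - e/2) s) * ?C"
    using LINT_plateau(2)[of "e/2" e "r - e" "r - e/2"] e r C by (intro mult_right_mono) auto
  finally have "ereal P < ereal \<dots>" by simp
  also have "\<dots> \<le> perimeter A \<Omega>"
    using e r by (intro perimeter_cone_plateau sub) auto
  finally show False using P by simp
qed

end

section \<open>Quantisation of the variation on the line\<close>

text \<open>A weak form of the Lebesgue density theorem. If \<open>F\<close> filled at most 3/4 of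
  every interval, then a cover by intervals of total length at most 5/4 of the measure of
  \<open>F\<close> would show that measure to be at most 15/16 of itself.\<close>

lemma exists_dense_interval:
  fixes F :: "real set"
  assumes F: "F \<in> lmeasurable" "F \<subseteq> {lo..hi}" and pos: "0 < measure lebesgue F"
  shows "\<exists>c d. c < d \<and> lo \<le> c \<and> d \<le> hi \<and> 3 / 4 * (d - c) \<le> measure lebesgue (F \<inter> {c..d})"
proof (rule ccontr)
  assume "\<not> ?thesis"
  then have small: "measure lebesgue (F \<inter> {c..d}) \<le> 3 / 4 * (d - c)" if "c < d" "lo \<le> c" "d \<le> hi" for c d
    using that by (meson linear)
  let ?m = "measure lebesgue F"
  have "F \<subseteq> cbox lo hi" "0 < ?m / 4" using F pos by auto
  from measurable_outer_intervals_bounded[OF F(1) this]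
  obtain D where D: "countable D"
    "\<And>K. K \<in> D \<Longrightarrow> K \<subseteq> cbox lo hi \<and> K \<noteq> {} \<and> (\<exists>c d. K = cbox c d)"
    "pairwise (\<lambda>A B. interior A \<inter> interior B = {}) D"
    "F \<subseteq> \<Union>D" "\<Union>D \<in> lmeasurable" "measure lebesgue (\<Union>D) \<le> ?m + ?m / 4"
    by metis
  have disj: "disjoint_family_on interior D"
    using D(3) by (auto simp: disjoint_family_on_def pairwise_def)
  have cnt: "countable (\<Union>K\<in>D. K - interior K)"
  proof (rule countable_UN[OF D(1)])
    fix K assume "K \<in> D"
    then obtain c d where "K = {c..d}" using D(2) by (metis cbox_interval)
    then have "K - interior K \<subseteq> {c, d}" by (auto simp: interior_atLeastAtMost_real)
    then show "countable (K - interior K)" by (meson countable_finite finite.emptyI finite.insertI finite_subset)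
  qed
  \<comment> \<open>The covering intervals are only disjoint in their interiors; their countably
    many endpoints are collected here.\<close>
  define N where "N = (\<Union>K\<in>D. K - interior K)"
  have null: "N \<in> null_sets lebesgue" unfolding N_def
    using countable_imp_null_set_lborel[OF cnt] by (rule null_sets_completionI)
  have Fs: "F \<in> sets lebesgue" using F by auto
  have "emeasure lebesgue F \<le> emeasure lebesgue ((\<Union>K\<in>D. F \<inter> interior K) \<union> N)"
  proof (rule emeasure_mono)
    show "F \<subseteq> (\<Union>K\<in>D. F \<inter> interior K) \<union> N" using D(4) by (auto simp: N_def)
    show "(\<Union>K\<in>D. F \<inter> interior K) \<union> N \<in> sets lebesgue"
      using D(1) null Fs by (intro sets.Un sets.countable_UN'') auto
  qed
  also have "\<dots> = emeasure lebesgue (\<Union>K\<in>D. F \<inter> interior K)"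
    using null D(1) Fs by (intro emeasure_Un_null_set sets.countable_UN'') auto
  also have "\<dots> = (\<integral>\<^sup>+K. emeasure lebesgue (F \<inter> interior K) \<partial>count_space D)"
    using D(1) Fs disj by (intro emeasure_UN_countable) (auto simp: disjoint_family_on_def)
  also have "\<dots> \<le> (\<integral>\<^sup>+K. ennreal (3/4) * emeasure lebesgue (interior K) \<partial>count_space D)"
  proof (rule nn_integral_mono)
    fix K assume "K \<in> space (count_space D)"
    then have K: "K \<in> D" by simp
    then obtain c d where cd: "K = {c..d}" "c \<le> d" "lo \<le> c" "d \<le> hi" using D(2)[OF K] by (auto simp: cbox_interval)
    show "emeasure lebesgue (F \<inter> interior K) \<le> ennreal (3/4) * emeasure lebesgue (interior K)"
    proof (cases "c < d")
      case True
      have "emeasure lebesgue (F \<inter> interior K) \<le> emeasure lebesgue (F \<inter> {c..d})"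
        using Fs cd by (intro emeasure_mono) (auto simp: interior_atLeastAtMost_real)
      also have "\<dots> = ennreal (measure lebesgue (F \<inter> {c..d}))"
        using F(1) by (intro emeasure_eq_measure2 fmeasurable.Int) auto
      also have "\<dots> \<le> ennreal (3 / 4 * (d - c))"
        using small[OF True cd(3,4)] by (intro ennreal_leI)
      also have "\<dots> = ennreal (3/4) * emeasure lebesgue (interior K)"
        using cd True ennreal_mult[of "3/4" "d - c"] by (simp add: interior_atLeastAtMost_real del: ennreal_mult')
      finally show ?thesis .
    next
      case False
      then show ?thesis using cd by (simp add: interior_atLeastAtMost_real)
    qed
  qed
  also have "\<dots> = ennreal (3/4) * (\<integral>\<^sup>+K. emeasure lebesgue (interior K) \<partial>count_space D)"
    by (intro nn_integral_cmult) auto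
  also have "(\<integral>\<^sup>+K. emeasure lebesgue (interior K) \<partial>count_space D) = emeasure lebesgue (\<Union>K\<in>D. interior K)"
    using D(1) disj by (intro emeasure_UN_countable[symmetric]) auto
  also have "ennreal (3/4) * \<dots> \<le> ennreal (3/4) * emeasure lebesgue (\<Union>D)"
    using D(5) interior_subset by (intro mult_left_mono emeasure_mono) auto
  also have "emeasure lebesgue (\<Union>D) = ennreal (measure lebesgue (\<Union>D))"
    by (rule emeasure_eq_measure2[OF D(5)])
  also have "ennreal (3/4) * \<dots> \<le> ennreal (3/4) * ennreal (?m + ?m / 4)"
    using D(6) by (intro mult_left_mono ennreal_leI) auto
  also have "\<dots> = ennreal (15 / 16 * ?m)" by (simp flip: ennreal_mult)
  finally have "ennreal ?m \<le> ennreal (15 / 16 * ?m)"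
    by (simp add: emeasure_eq_measure2[OF F(1)])
  then show False using pos by (simp add: ennreal_le_iff)
qed

lemma LINT_indicator_ramp_deriv:
  assumes M: "M \<in> sets borel" and "a < b"
  shows "integrable lborel (\<lambda>x. indicat_real M x * ramp_deriv a b x)"
    "{a<..<b} \<subseteq> M \<Longrightarrow> (LINT x|lborel. indicat_real M x * ramp_deriv a b x) = 1"
    "{a<..<b} \<inter> M = {} \<Longrightarrow> (LINT x|lborel. indicat_real M x * ramp_deriv a b x) = 0"
    "(LINT x|lborel. indicat_real M x * ramp_deriv a b x) \<le> 2 / (b - a) * measure lebesgue (M \<inter> {a..b})"
proof -
  note R = LINT_ramp_deriv[OF assms(2)] and B = ramp_deriv_bounds[OF assms(2)]
  show i: "integrable lborel (\<lambda>x. indicat_real M x * ramp_deriv a b x)"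
    using integrable_mult_indicator[OF _ R(1), of M] M by simp
  show "(LINT x|lborel. indicat_real M x * ramp_deriv a b x) = 1" if "{a<..<b} \<subseteq> M"
  proof -
    have "(\<lambda>x. indicat_real M x * ramp_deriv a b x) = ramp_deriv a b"
    proof
      fix x show "indicat_real M x * ramp_deriv a b x = ramp_deriv a b x"
        using that[THEN subsetD, of x] B(3)[of x] by (cases "x \<le> a \<or> b \<le> x") auto
    qed
    then show ?thesis using R(2) by simp
  qed
  show "(LINT x|lborel. indicat_real M x * ramp_deriv a b x) = 0" if "{a<..<b} \<inter> M = {}"
  proof -
    have "(\<lambda>x. indicat_real M x * ramp_deriv a b x) = (\<lambda>_. 0)"
    proof
      fix x show "indicat_real M x * ramp_deriv a b x = 0"
      proof (cases "x \<le> a \<or> b \<le> x")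
        case False
        then have "x \<in> {a<..<b}" by auto
        then have "x \<notin> M" using that by blast
        then show ?thesis by simp
      qed (simp add: B(3))
    qed
    then show ?thesis by simp
  qed
  have fin: "integrable lborel (indicat_real (M \<inter> {a..b}))"
  proof (rule integrable_real_indicator)
    have "emeasure lborel (M \<inter> {a..b}) \<le> emeasure lborel {a..b}" using M by (intro emeasure_mono) auto
    also have "\<dots> < \<infinity>" using assms(2) by simp
    finally show "emeasure lborel (M \<inter> {a..b}) < \<infinity>" .
  qed (use M in auto)
  have "(LINT x|lborel. indicat_real M x * ramp_deriv a b x) \<le> (LINT x|lborel. 2 / (b - a) * indicat_real (M \<inter> {a..b}) x)"
  proof (rule integral_mono[OF i])
    show "integrable lborel (\<lambda>x. 2 / (b - a) * indicat_real (M \<inter> {a..b}) x)"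
      using fin by (rule integrable_mult_right)
    show "indicat_real M x * ramp_deriv a b x \<le> 2 / (b - a) * indicat_real (M \<inter> {a..b}) x" for x
      using B(2,3)[of x] by (cases "x \<le> a \<or> b \<le> x") (auto simp: indicator_def assms(2) less_imp_le)
  qed
  also have "\<dots> = 2 / (b - a) * measure lborel (M \<inter> {a..b})" by simp
  also have "measure lborel (M \<inter> {a..b}) = measure lebesgue (M \<inter> {a..b})" using M by simp
  finally show "(LINT x|lborel. indicat_real M x * ramp_deriv a b x) \<le> 2 / (b - a) * measure lebesgue (M \<inter> {a..b})" .
qed

text \<open>The conditions that the cone lemmas impose on the factor \<open>f\<close> of the slope.
  For a set \<open>M\<close> of slopes, the integral of \<open>f'\<close> over \<open>M\<close> is
  bounded by the variation of the indicator of \<open>M\<close>.\<close>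

definition jump_profile :: "real \<Rightarrow> real \<Rightarrow> (real \<Rightarrow> real) \<Rightarrow> (real \<Rightarrow> real) \<Rightarrow> bool" where
  "jump_profile p q f f' \<longleftrightarrow> (\<forall>x. (f has_field_derivative f' x) (at x)) \<and> continuous_on UNIV f' \<and>
     (\<forall>m. m \<notin> {p..q} \<longrightarrow> f m = 0) \<and> (\<forall>m. \<bar>f m\<bar> \<le> 1)"

lemma jump_profile_ramps:
  assumes "a < b" "c < d" "p \<le> a" "p \<le> c" "b \<le> q" "d \<le> q"
  shows "jump_profile p q (\<lambda>x. ramp a b x - ramp c d x) (\<lambda>x. ramp_deriv a b x - ramp_deriv c d x)"
  unfolding jump_profile_def
proof (intro conjI allI impI)
  fix m
  show "((\<lambda>x. ramp a b x - ramp c d x) has_field_derivative ramp_deriv a b m - ramp_deriv c d m) (at m)"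
    by (intro DERIV_diff ramp_has_deriv assms)
  show "\<bar>ramp a b m - ramp c d m\<bar> \<le> 1"
    using ramp_bounds[OF assms(1), of m] ramp_bounds[OF assms(2), of m] by auto
  assume "m \<notin> {p..q}"
  then consider "m \<le> a \<and> m \<le> c" | "b \<le> m \<and> d \<le> m" using assms by force
  then show "ramp a b m - ramp c d m = 0"
    using ramp_left[OF assms(1), of m] ramp_left[OF assms(2), of m] ramp_right[OF assms(1), of m] ramp_right[OF assms(2), of m]
    by cases auto
qed (use assms in \<open>auto intro!: continuous_intros continuous_ramp_deriv\<close>)

text \<open>The variation of an indicator function is quantised: if it is not constant almost everywhere,
  it is at least \<open>1/2\<close>.\<close>

lemma variation_quantized:
  fixes M :: "real set"
  assumes M: "open M" and ne: "M \<inter> {p<..<q} \<noteq> {}" and n: "\<not> (AE x in lborel. p < x \<and> x < q \<longrightarrow> x \<in> M)"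
  shows "\<exists>f f' p' q'. p < p' \<and> q' < q \<and> jump_profile p' q' f f' \<and> 1/2 \<le> (LINT m|lborel. indicat_real M m * f' m)"
proof -
  have Mb: "M \<in> sets borel" using M by auto
  from ne obtain y where "y \<in> M \<inter> {p<..<q}" by blast
  moreover have "open (M \<inter> {p<..<q})" using M by auto
  ultimately obtain e where e: "0 < e" "ball y e \<subseteq> M \<inter> {p<..<q}" by (meson openE)
  define a b where "a = y - e/2" and "b = y + e/2"
  have ab: "a < b" "{a..b} \<subseteq> M" "{a..b} \<subseteq> {p<..<q}"
    using e by (auto simp: a_def b_def subset_iff dist_real_def abs_if split: if_splits)
  then have pq: "p < a" "b < q"
    using ab(1) ab(3)[THEN subsetD, of a] ab(3)[THEN subsetD, of b] by auto
  \<comment> \<open>Staying at positive distance from \<open>p\<close> and \<open>q\<close> leaves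
    room for the strict inequalities required of \<open>p'\<close> and \<open>q'\<close>.\<close>
  define F where "F k = {p + 1 / Suc k .. q - 1 / Suc k} - M" for k :: nat
  have Fb: "F k \<in> sets borel" for k using Mb by (auto simp: F_def)
  have "\<exists>k. F k \<notin> null_sets lborel"
  proof (rule ccontr)
    assume "\<not> ?thesis"
    then have "(\<Union>k. F k) \<in> null_sets lborel" by (intro null_sets_UN) auto
    then have "AE x in lborel. x \<notin> (\<Union>k. F k)" by (rule AE_not_in)
    then have "AE x in lborel. p < x \<and> x < q \<longrightarrow> x \<in> M"
    proof eventually_elim
      case (elim x)
      show ?case
      proof safe
        assume x: "p < x" "x < q"
        then obtain k where k: "1 / real (Suc k) < min (x - p) (q - x)"
          using reals_Archimedean[of "min (x - p) (q - x)"] by (auto simp: inverse_eq_divide)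
        then have "x \<in> {p + 1 / Suc k .. q - 1 / Suc k}" by auto
        then show "x \<in> M" using elim by (auto simp: F_def)
      qed
    qed
    then show False using n by simp
  qed
  then obtain k where k: "F k \<notin> null_sets lborel" by auto
  define lo hi where "lo = p + 1 / Suc k" and "hi = q - 1 / Suc k"
  have lohi: "p < lo" "hi < q" by (auto simp: lo_def hi_def)
  have split: "F k = (F k \<inter> {..a}) \<union> (F k \<inter> {b..})"
    using ab(1,2) by (auto simp: F_def) (meson atLeastAtMost_iff linear subsetD)
  have "F k \<inter> {..a} \<notin> null_sets lborel \<or> F k \<inter> {b..} \<notin> null_sets lborel"
    using k null_sets.Un[of "F k \<inter> {..a}" lborel "F k \<inter> {b..}"] split by auto
  then obtain l h where lh: "lo \<le> l" "h \<le> hi" "h \<le> a \<or> b \<le> l" and G: "F k \<inter> {l..h} \<notin> null_sets lborel"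
  proof
    assume *: "F k \<inter> {..a} \<notin> null_sets lborel"
    have "F k \<inter> {..a} = F k \<inter> {lo..min hi a}" by (auto simp: F_def lo_def hi_def)
    then show thesis using that[of lo "min hi a"] * by auto
  next
    assume *: "F k \<inter> {b..} \<notin> null_sets lborel"
    have "F k \<inter> {b..} = F k \<inter> {max lo b..hi}" by (auto simp: F_def lo_def hi_def)
    then show thesis using that[of "max lo b" hi] * by auto
  qed
  define S where "S = F k \<inter> {l..h}"
  have Sb: "S \<in> sets borel" using Fb by (auto simp: S_def)
  have S: "S \<in> lmeasurable" "S \<subseteq> {l..h}"
    using Sb by (auto simp: S_def intro!: fmeasurableI2[of "{l..h}" lebesgue])
  have "0 < measure lebesgue S"
  proof (rule ccontr)
    assume "\<not> ?thesis"
    then have "measure lebesgue S = 0" using measure_nonneg[of lebesgue S] by linarith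
    then have "emeasure lebesgue S = 0" using emeasure_eq_measure2[OF S(1)] by simp
    then show False using G Sb by (simp add: S_def null_sets_def)
  qed
  from exists_dense_interval[OF S this] obtain c d where cd: "c < d" "l \<le> c" "d \<le> h"
    and dense: "3 / 4 * (d - c) \<le> measure lebesgue (S \<inter> {c..d})" by blast
  have cdl: "{c..d} \<in> lmeasurable" by simp
  have "measure lebesgue (M \<inter> {c..d}) + measure lebesgue (S \<inter> {c..d}) \<le> measure lebesgue {c..d}"
  proof -
    have lm: "M \<inter> {c..d} \<in> lmeasurable" "S \<inter> {c..d} \<in> lmeasurable"
      using Mb Sb by (auto intro!: fmeasurableI2[OF cdl])
    have "measure lebesgue ((M \<inter> {c..d}) \<union> (S \<inter> {c..d})) = measure lebesgue (M \<inter> {c..d}) + measure lebesgue (S \<inter> {c..d})"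
      using fmeasurableD2[OF lm(1)] fmeasurableD2[OF lm(2)] fmeasurableD[OF lm(1)] fmeasurableD[OF lm(2)]
      by (intro measure_Union) (auto simp: S_def F_def)
    moreover have "measure lebesgue ((M \<inter> {c..d}) \<union> (S \<inter> {c..d})) \<le> measure lebesgue {c..d}"
      using lm by (intro measure_mono_fmeasurable cdl) auto
    ultimately show ?thesis by simp
  qed
  \<comment> \<open>\<open>M\<close> occupies at most a quarter of the interval from
    \<open>c\<close> to \<open>d\<close>, and the hat function there has height
    \<open>2 / (d - c)\<close>. It thus takes back at most 1/2 of the full integral 1 gained on the
    interval inside \<open>M\<close>.\<close>
  then have sm: "measure lebesgue (M \<inter> {c..d}) \<le> (d - c) / 4" using dense cd by simp
  let ?f' = "\<lambda>x. ramp_deriv a b x - ramp_deriv c d x"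
  have "2 / (d - c) * measure lebesgue (M \<inter> {c..d}) \<le> 2 / (d - c) * ((d - c) / 4)"
    using sm cd by (intro mult_left_mono) auto
  also have "\<dots> = 1 / 2" using cd by simp
  finally have "2 / (d - c) * measure lebesgue (M \<inter> {c..d}) \<le> 1 / 2" .
  moreover have "(LINT m|lborel. indicat_real M m * ?f' m) = 1 - (LINT m|lborel. indicat_real M m * ramp_deriv c d m)"
  proof -
    have "{a<..<b} \<subseteq> M" using ab by auto
    then show ?thesis
      using LINT_indicator_ramp_deriv(1,2)[OF Mb ab(1)] LINT_indicator_ramp_deriv(1)[OF Mb cd(1)]
      by (simp add: right_diff_distrib)
  qed
  ultimately have "1/2 \<le> (LINT m|lborel. indicat_real M m * ?f' m)"
    using LINT_indicator_ramp_deriv(4)[OF Mb cd(1)] by linarith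
  moreover have "jump_profile (min a c) (max b d) (\<lambda>x. ramp a b x - ramp c d x) ?f'"
    by (rule jump_profile_ramps) (use ab cd in auto)
  moreover have "p < min a c" "max b d < q" using pq lohi lh cd by auto
  ultimately show ?thesis by blast
qed

section \<open>Perimeter of a cone near a boundary ray\<close>

definition wedge :: "real^2 \<Rightarrow> real \<Rightarrow> (real^2) set" where
  "wedge u \<delta> = {x. 0 < x \<bullet> u \<and> \<bar>cross2 u x\<bar> < \<delta> * (x \<bullet> u)}"

lemma open_wedge: "open (wedge u \<delta>)"
  unfolding wedge_def by (intro open_Collect_conj open_Collect_less continuous_intros)

lemma wedge_self: "norm u = 1 \<Longrightarrow> 0 < \<delta> \<Longrightarrow> u \<in> wedge u \<delta>"
  by (simp add: wedge_def norm_eq_1 cross2_simps)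

text \<open>Two errors of size at most \<open>\<delta> * (x \<bullet> u)\<close> add up: the
  transversal component of \<open>x\<close>, and the difference between \<open>norm x\<close> and
  \<open>x \<bullet> u\<close>.\<close>

lemma wedge_direction:
  assumes u: "norm u = 1" and x: "x \<in> wedge u \<delta>" and \<delta>: "\<delta> \<le> 1"
  shows "x \<noteq> 0" "norm ((1 / norm x) *\<^sub>R x - u) \<le> 2 * \<delta>"
proof -
  let ?s = "x \<bullet> u"
  have s: "0 < ?s" "\<bar>cross2 u x\<bar> \<le> \<delta> * ?s" using x by (auto simp: wedge_def)
  then have d0: "0 \<le> \<delta>" by (meson abs_ge_zero less_le_not_le mult_nonneg_nonneg order.trans zero_le_mult_iff less_imp_le)
  show nz: "x \<noteq> 0" using s by auto
  have sx: "?s \<le> norm x" using Cauchy_Schwarz_ineq2[of x u] u by simp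
  have xs: "x - ?s *\<^sub>R u = cross2 u x *\<^sub>R rot u" using unit_decomposition[OF u, of x] by (simp add: algebra_simps)
  have n1: "norm (x - ?s *\<^sub>R u) \<le> \<delta> * ?s" using s u unfolding xs by simp
  have n2: "norm x \<le> ?s + \<delta> * ?s" using norm_le_coordinates[OF u, of x] s by simp
  have "norm (x - norm x *\<^sub>R u) \<le> norm (x - ?s *\<^sub>R u) + norm (?s *\<^sub>R u - norm x *\<^sub>R u)"
    by (metis add_diff_cancel_right' add_diff_eq diff_add_cancel norm_triangle_ineq)
  also have "norm (?s *\<^sub>R u - norm x *\<^sub>R u) = norm x - ?s"
    using u sx by (simp flip: scaleR_left_diff_distrib)
  finally have "norm (x - norm x *\<^sub>R u) \<le> 2 * (\<delta> * ?s)" using n1 n2 by simp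
  also have "\<dots> \<le> 2 * (\<delta> * norm x)" using sx d0 by (intro mult_left_mono) auto
  finally have "norm (x - norm x *\<^sub>R u) \<le> (2 * \<delta>) * norm x" by simp
  moreover have "(1 / norm x) *\<^sub>R x - u = (1 / norm x) *\<^sub>R (x - norm x *\<^sub>R u)"
    using nz by (simp add: scaleR_diff_right)
  ultimately show "norm ((1 / norm x) *\<^sub>R x - u) \<le> 2 * \<delta>"
    using nz by (simp add: divide_le_eq)
qed

lemma finite_disjoint_wedges:
  fixes X :: "(real^2) set"
  assumes "finite X" "\<And>u. u \<in> X \<Longrightarrow> norm u = 1" "0 < \<delta>0"
  obtains \<delta> :: real where "0 < \<delta>" "\<delta> \<le> 1" "\<delta> \<le> \<delta>0" "disjoint_family_on (\<lambda>u. wedge u \<delta>) X"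
proof -
  \<comment> \<open>The inserted 1 keeps the minimum meaningful when there are no two distinct
    directions.\<close>
  define e where "e = Min (insert 1 ((\<lambda>(u, v). dist u v) ` {(u, v) \<in> X \<times> X. u \<noteq> v}))"
  have fin: "finite ((\<lambda>(u, v). dist u v) ` {(u, v) \<in> X \<times> X. u \<noteq> v})"
    by (rule finite_imageI, rule finite_subset[of _ "X \<times> X"]) (use assms(1) in auto)
  have "0 < e" unfolding e_def using fin by (subst Min_gr_iff) auto
  moreover have "e \<le> dist u v" if "u \<in> X" "v \<in> X" "u \<noteq> v" for u v
    unfolding e_def using fin that by (intro Min_le) (auto intro!: image_eqI[of _ _ "(u, v)"])
  ultimately have e: "0 < e" "\<And>u v. u \<in> X \<Longrightarrow> v \<in> X \<Longrightarrow> dist u v < e \<Longrightarrow> u = v"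
    by (auto simp: not_le[symmetric])
  \<comment> \<open>Directions whose wedges meet are within \<open>4 * \<delta>\<close> of each
    other, which is less than \<open>e\<close>.\<close>
  define \<delta> where "\<delta> = min (min 1 \<delta>0) (e / 8)"
  have \<delta>: "0 < \<delta>" "\<delta> \<le> 1" "\<delta> \<le> \<delta>0" "\<delta> \<le> e / 8" using e assms(3) by (auto simp: \<delta>_def)
  have "disjoint_family_on (\<lambda>u. wedge u \<delta>) X"
    unfolding disjoint_family_on_def
  proof (intro ballI impI, rule ccontr)
    fix u v assume uv: "u \<in> X" "v \<in> X" "u \<noteq> v" and "wedge u \<delta> \<inter> wedge v \<delta> \<noteq> {}"
    then obtain x where x: "x \<in> wedge u \<delta>" "x \<in> wedge v \<delta>" by blast
    have "dist u v \<le> norm ((1 / norm x) *\<^sub>R x - u) + norm ((1 / norm x) *\<^sub>R x - v)"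
      using dist_triangle2[of u v "(1 / norm x) *\<^sub>R x"] by (simp add: dist_norm norm_minus_commute)
    also have "\<dots> \<le> 4 * \<delta>"
      using wedge_direction(2)[OF assms(2)[OF uv(1)] x(1) \<delta>(2)] wedge_direction(2)[OF assms(2)[OF uv(2)] x(2) \<delta>(2)] by simp
    also have "\<dots> < e" using \<delta> e by simp
    finally show False using e(2)[OF uv(1,2)] uv(3) by simp
  qed
  then show thesis using that \<delta> by blast
qed

lemma open_slopes:
  assumes "open (A :: (real^2) set)"
  shows "open {m::real. u + m *\<^sub>R rot u \<in> A}"
  using open_vimage[OF assms, of "\<lambda>m. u + m *\<^sub>R rot u"]
  by (simp add: vimage_def continuous_intros)

lemma wedge_slope:
  assumes u: "norm u = 1" and A: "cone_at_origin A" and x: "0 < x \<bullet> u"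
  shows "x \<in> A \<longleftrightarrow> u + (cross2 u x / (x \<bullet> u)) *\<^sub>R rot u \<in> A"
proof -
  have "(x \<bullet> u) *\<^sub>R (u + (cross2 u x / (x \<bullet> u)) *\<^sub>R rot u) = x"
    using unit_decomposition[OF u, of x] x by (simp add: scaleR_add_right)
  then show ?thesis using cone_scale_iff[OF A x] by metis
qed

text \<open>Each line \<open>x \<bullet> u = s\<close> with \<open>s > 0\<close> meets the cone in a
  scaled copy of the set of slopes. A null set of bad slopes therefore gives a null set on each
  slice, and Fubini's theorem a null set in the wedge.\<close>

lemma AE_wedge:
  fixes A :: "(real^2) set"
  assumes A: "open A" "cone_at_origin A" and u: "norm u = 1"
    and ae: "AE m in lborel. - \<delta> < m \<and> m < \<delta> \<longrightarrow> u + m *\<^sub>R rot u \<in> A"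
  shows "AE x in lborel. x \<in> wedge u \<delta> \<longrightarrow> x \<in> A"
proof -
  let ?L = "\<lambda>(s::real, t::real). 0 + s *\<^sub>R u + t *\<^sub>R rot u"
  let ?D = "distr (lborel \<Otimes>\<^sub>M lborel) borel ?L"
  have c: "cross2 u (rot u) = 1" by (rule coordinates(3)[OF u])
  have L: "lborel = density ?D (\<lambda>_. ennreal \<bar>cross2 u (rot u)\<bar>)"
    by (rule lborel_affine_plane) (simp add: c)
  have mL: "?L \<in> borel_measurable (lborel \<Otimes>\<^sub>M lborel)"
  proof -
    have "?L \<in> borel_measurable borel"
      by (intro borel_measurable_continuous_onI) (auto simp: split_beta intro!: continuous_intros)
    then show ?thesis by (simp add: lborel_prod)
  qed
  have meas: "{x. x \<in> wedge u \<delta> \<longrightarrow> x \<in> A} \<in> sets borel"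
  proof -
    have "{x. x \<in> wedge u \<delta> \<longrightarrow> x \<in> A} = - wedge u \<delta> \<union> A" by auto
    also have "\<dots> \<in> sets borel" using A open_wedge by auto
    finally show ?thesis .
  qed
  have slice: "AE t in lborel. s *\<^sub>R u + t *\<^sub>R rot u \<in> wedge u \<delta> \<longrightarrow> s *\<^sub>R u + t *\<^sub>R rot u \<in> A" for s
  proof (cases "0 < s")
    case False
    then show ?thesis by (simp add: wedge_def coordinates[OF u])
  next
    case True
    have oM: "open {m. u + m *\<^sub>R rot u \<in> A}" by (rule open_slopes[OF A(1)])
    have P: "Measurable.pred borel (\<lambda>m. - \<delta> < m \<and> m < \<delta> \<longrightarrow> u + m *\<^sub>R rot u \<in> A)"
    proof -
      have "{m. - \<delta> < m \<and> m < \<delta> \<longrightarrow> u + m *\<^sub>R rot u \<in> A} = - {-\<delta><..<\<delta>} \<union> {m. u + m *\<^sub>R rot u \<in> A}" by auto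
      also have "\<dots> \<in> sets borel" using oM by auto
      finally show ?thesis by (simp add: pred_def)
    qed
    have "AE t in lborel. - \<delta> < 0 + (1 / s) * t \<and> 0 + (1 / s) * t < \<delta> \<longrightarrow> u + (0 + (1 / s) * t) *\<^sub>R rot u \<in> A"
      using True by (intro AE_borel_affine[OF _ P ae]) auto
    then show ?thesis
    proof eventually_elim
      case (elim t)
      show ?case
      proof
        assume "s *\<^sub>R u + t *\<^sub>R rot u \<in> wedge u \<delta>"
        then have "\<bar>t\<bar> < \<delta> * s" by (simp add: wedge_def coordinates[OF u])
        then have "- \<delta> < t / s" "t / s < \<delta>" using True by (auto simp: field_simps abs_less_iff)
        then show "s *\<^sub>R u + t *\<^sub>R rot u \<in> A"
          using elim True by (subst wedge_slope[OF u A(2)]) (simp_all add: coordinates[OF u])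
      qed
    qed
  qed
  have "AE p in (lborel \<Otimes>\<^sub>M lborel). ?L p \<in> wedge u \<delta> \<longrightarrow> ?L p \<in> A"
  proof (rule lborel_pair.AE_pair_measure)
    have "{p \<in> space (lborel \<Otimes>\<^sub>M lborel). ?L p \<in> wedge u \<delta> \<longrightarrow> ?L p \<in> A} = ?L -` {x. x \<in> wedge u \<delta> \<longrightarrow> x \<in> A} \<inter> space (lborel \<Otimes>\<^sub>M lborel)"
      by auto
    also have "\<dots> \<in> sets (lborel \<Otimes>\<^sub>M lborel)"
      by (rule measurable_sets[OF mL meas])
    finally show "{p \<in> space (lborel \<Otimes>\<^sub>M lborel). ?L p \<in> wedge u \<delta> \<longrightarrow> ?L p \<in> A} \<in> sets (lborel \<Otimes>\<^sub>M lborel)" .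
    show "AE s in lborel. AE t in lborel. ?L (s, t) \<in> wedge u \<delta> \<longrightarrow> ?L (s, t) \<in> A"
      using slice by simp
  qed
  then have "AE x in ?D. x \<in> wedge u \<delta> \<longrightarrow> x \<in> A"
    using mL meas by (subst AE_distr_iff) auto
  then have "AE x in density ?D (\<lambda>_. ennreal \<bar>cross2 u (rot u)\<bar>). x \<in> wedge u \<delta> \<longrightarrow> x \<in> A"
    by (subst AE_density) auto
  then show ?thesis by (subst L)
qed

text \<open>The factor \<open>1 / (1 + \<delta>)\<close> compares height with distance: a point of
  the wedge at height below \<open>\<rho> / (1 + \<delta>)\<close> has norm below
  \<open>\<rho>\<close>.\<close>

lemma perimeter_wedge_ge:
  fixes A :: "(real^2) set"
  assumes A: "open A" "cone_at_origin A" and u: "norm u = 1"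
    and f: "jump_profile p q f f'" and pq: "- \<delta> < p" "q < \<delta>" and \<rho>: "0 < \<rho>" and \<delta>: "0 < \<delta>"
    and c: "0 \<le> (LINT m|lborel. indicat_real A (u + m *\<^sub>R rot u) * f' m)"
  shows "ereal (\<rho> / (1 + \<delta>) * (LINT m|lborel. indicat_real A (u + m *\<^sub>R rot u) * f' m)) \<le> perimeter A (wedge u \<delta> \<inter> ball 0 \<rho>)"
proof -
  have Ab: "A \<in> sets borel" using A by auto
  show ?thesis
  proof (rule perimeter_cone_ge[OF Ab A(2) u, of f f' p q])
    fix x :: "real^2"
    let ?s = "x \<bullet> u"
    assume x: "0 < ?s" "?s < \<rho> / (1 + \<delta>)" "p * ?s \<le> cross2 u x" "cross2 u x \<le> q * ?s"
    have l: "- \<delta> * ?s < p * ?s" by (rule mult_strict_right_mono[OF pq(1) x(1)])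
    have r: "q * ?s < \<delta> * ?s" by (rule mult_strict_right_mono[OF pq(2) x(1)])
    have c: "\<bar>cross2 u x\<bar> < \<delta> * ?s" using x l r by linarith
    have "norm x \<le> ?s + \<bar>cross2 u x\<bar>" using norm_le_coordinates[OF u, of x] x by simp
    also have "\<dots> < ?s * (1 + \<delta>)" using c by (simp add: algebra_simps)
    also have "\<dots> < \<rho>" using x \<delta> by (simp add: pos_less_divide_eq)
    finally show "x \<in> wedge u \<delta> \<inter> ball 0 \<rho>" using x c by (simp add: wedge_def)
  qed (use f \<rho> \<delta> c in \<open>auto simp: jump_profile_def\<close>)
qed

lemma indicator_slopes: "indicat_real A (u + m *\<^sub>R rot u) = indicat_real {m. u + m *\<^sub>R rot u \<in> A} m"
  by (simp add: indicator_def)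

text \<open>As a frontier direction, \<open>u\<close> has slopes of the cone arbitrarily close to 0.
  As a point of the perimeter support, it forbids the cone to fill the wedge up to a null set. So
  the set of slopes is not constant and its variation is at least 1/2.\<close>

lemma perimeter_wedge_frontier:
  fixes A :: "(real^2) set"
  assumes A: "open A" "cone_at_origin A" and u: "norm u = 1" and fr: "u \<in> frontier A" "u \<in> perimeter_support A"
    and \<rho>: "0 < \<rho>" and \<delta>: "0 < \<delta>"
  shows "ereal (\<rho> / (1 + \<delta>) / 2) \<le> perimeter A (wedge u \<delta> \<inter> ball 0 \<rho>)"
proof -
  let ?M = "{m. u + m *\<^sub>R rot u \<in> A}"
  have oM: "open ?M" by (rule open_slopes[OF A(1)])
  have uw: "u \<in> wedge u \<delta>" by (rule wedge_self[OF u \<delta>])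
  have "u \<in> closure A" using fr by (simp add: frontier_def)
  then obtain x where x: "x \<in> A" "x \<in> wedge u \<delta>"
    using uw open_wedge[of u \<delta>] open_Int_closure_eq_empty[of "wedge u \<delta>" A] by blast
  have xs: "0 < x \<bullet> u" "\<bar>cross2 u x\<bar> < \<delta> * (x \<bullet> u)" using x by (auto simp: wedge_def)
  then have "cross2 u x / (x \<bullet> u) \<in> {- \<delta><..<\<delta>}"
    by (auto simp: field_simps abs_less_iff)
  moreover have "cross2 u x / (x \<bullet> u) \<in> ?M" using wedge_slope[OF u A(2) xs(1)] x by simp
  ultimately have ne: "?M \<inter> {- \<delta><..<\<delta>} \<noteq> {}" by blast
  have n: "\<not> (AE m in lborel. - \<delta> < m \<and> m < \<delta> \<longrightarrow> m \<in> ?M)"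
  proof
    assume "AE m in lborel. - \<delta> < m \<and> m < \<delta> \<longrightarrow> m \<in> ?M"
    then have "AE x in lborel. x \<in> wedge u \<delta> \<longrightarrow> x \<in> A"
      by (intro AE_wedge[OF A u]) simp
    then have "perimeter A (wedge u \<delta>) = 0"
      using A(1) by (intro perimeter_null) auto
    then show False using fr(2) uw open_wedge[of u \<delta>] by (auto simp: perimeter_support_def)
  qed
  from variation_quantized[OF oM ne n] obtain f f' p q where f: "- \<delta> < p" "q < \<delta>" "jump_profile p q f f'"
    and C: "1/2 \<le> (LINT m|lborel. indicat_real ?M m * f' m)" by blast
  have "ereal (\<rho> / (1 + \<delta>) / 2) \<le> ereal (\<rho> / (1 + \<delta>) * (LINT m|lborel. indicat_real A (u + m *\<^sub>R rot u) * f' m))"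
    using mult_left_mono[OF C, of "\<rho> / (1 + \<delta>)"] \<rho> \<delta> by (simp add: indicator_slopes)
  also have "\<dots> \<le> perimeter A (wedge u \<delta> \<inter> ball 0 \<rho>)"
    using C by (intro perimeter_wedge_ge[OF A u f(3,1,2) \<rho> \<delta>]) (simp add: indicator_slopes)
  finally show ?thesis .
qed

lemma finite_frontier_directions:
  fixes A :: "(real^2) set"
  assumes A: "open A" "cone_at_origin A" "locally_finite_perimeter A" "frontier A = perimeter_support A"
  shows "finite (frontier A \<inter> sphere 0 1)"
proof (rule ccontr)
  assume inf: "infinite (frontier A \<inter> sphere 0 1)"
  have "perimeter A (ball 0 2) < \<infinity>" using A(3) by (simp add: locally_finite_perimeter_def)
  then obtain P where P: "perimeter A (ball 0 2) = ereal P"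
    using perimeter_nonneg[of A "ball 0 2"] by (cases "perimeter A (ball 0 2)") auto
  \<comment> \<open>More than twice the perimeter in the ball of radius 2. Each ray contributes at
    least 1/2 there, the radius 2 making up for the factor
    \<open>1 + \<delta> \<le> 2\<close>.\<close>
  define N where "N = nat \<lceil>2 * P\<rceil> + 1"
  from infinite_arbitrarily_large[OF inf, of N] obtain X where X: "finite X" "card X = N" "X \<subseteq> frontier A \<inter> sphere 0 1" by blast
  have nX: "norm u = 1" if "u \<in> X" for u using X(3) that by auto
  obtain \<delta> where \<delta>: "0 < \<delta>" "\<delta> \<le> 1" and d: "disjoint_family_on (\<lambda>u. wedge u \<delta>) X"
    by (rule finite_disjoint_wedges[OF X(1) nX zero_less_one])
  have "(\<Sum>u\<in>X. ereal (1/2)) \<le> (\<Sum>u\<in>X. perimeter A (wedge u \<delta> \<inter> ball 0 2))"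
  proof (rule sum_mono)
    fix u assume u: "u \<in> X"
    have "1 / 2 \<le> 2 / (1 + \<delta>) / 2" using \<delta> by (simp add: field_simps)
    then have "ereal (1/2) \<le> ereal (2 / (1 + \<delta>) / 2)" by simp
    also have "\<dots> \<le> perimeter A (wedge u \<delta> \<inter> ball 0 2)"
      using u X(3) \<delta> A(4) nX[OF u] by (intro perimeter_wedge_frontier A) auto
    finally show "ereal (1/2) \<le> perimeter A (wedge u \<delta> \<inter> ball 0 2)" .
  qed
  also have "\<dots> \<le> perimeter A (\<Union>u\<in>X. wedge u \<delta> \<inter> ball 0 2)"
    using d A(1) X(1) by (intro perimeter_superadditive_sum) (auto simp: disjoint_family_on_def)
  also have "\<dots> \<le> perimeter A (ball 0 2)" by (intro perimeter_mono) auto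
  finally have "ereal (real N / 2) \<le> ereal P" by (simp add: P X(2))
  then show False unfolding N_def by simp linarith
qed

text \<open>Here both sides of the ray are known, so ramps on the two sides see exactly 1 and 0.
  Shrinking the wedge to opening \<open>d\<close> improves the factor \<open>1 / (1 + d)\<close> to
  1, which yields the full length of the ray.\<close>

lemma perimeter_wedge_jump:
  fixes A :: "(real^2) set"
  assumes A: "open A" "cone_at_origin A" and u: "norm u = 1" and \<rho>: "0 < \<rho>" and \<delta>: "0 < \<delta>"
    and jump: "(\<forall>m. 0 < m \<and> m < \<delta> \<longrightarrow> u + m *\<^sub>R rot u \<in> A) \<and> (\<forall>m. - \<delta> < m \<and> m < 0 \<longrightarrow> u + m *\<^sub>R rot u \<notin> A) \<or>
       (\<forall>m. 0 < m \<and> m < \<delta> \<longrightarrow> u + m *\<^sub>R rot u \<notin> A) \<and> (\<forall>m. - \<delta> < m \<and> m < 0 \<longrightarrow> u + m *\<^sub>R rot u \<in> A)"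
  shows "ereal \<rho> \<le> perimeter A (wedge u \<delta> \<inter> ball 0 \<rho>)"
proof -
  let ?M = "{m. u + m *\<^sub>R rot u \<in> A}"
  have Mb: "?M \<in> sets borel" using open_slopes[OF A(1)] by auto
  have le: "ereal (\<rho> / (1 + d)) \<le> perimeter A (wedge u \<delta> \<inter> ball 0 \<rho>)" if d: "0 < d" "d < \<delta>" for d
  proof -
    have "\<exists>f f'. jump_profile (- d / 2) (d / 2) f f' \<and> (LINT m|lborel. indicat_real ?M m * f' m) = 1"
      using jump
    proof
      assume j: "(\<forall>m. 0 < m \<and> m < \<delta> \<longrightarrow> u + m *\<^sub>R rot u \<in> A) \<and> (\<forall>m. - \<delta> < m \<and> m < 0 \<longrightarrow> u + m *\<^sub>R rot u \<notin> A)"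
      have "{0<..<d/2} \<subseteq> ?M" "{-d/2<..<0} \<inter> ?M = {}" using j d by auto
      then have "(LINT m|lborel. indicat_real ?M m * (ramp_deriv 0 (d/2) m - ramp_deriv (-d/2) 0 m)) = 1"
        using LINT_indicator_ramp_deriv[OF Mb, of 0 "d/2"] LINT_indicator_ramp_deriv[OF Mb, of "-d/2" 0] d
        by (simp add: right_diff_distrib)
      moreover have "jump_profile (- d / 2) (d / 2) (\<lambda>x. ramp 0 (d/2) x - ramp (-d/2) 0 x) (\<lambda>x. ramp_deriv 0 (d/2) x - ramp_deriv (-d/2) 0 x)"
        using d by (intro jump_profile_ramps) auto
      ultimately show ?thesis by blast
    next
      assume j: "(\<forall>m. 0 < m \<and> m < \<delta> \<longrightarrow> u + m *\<^sub>R rot u \<notin> A) \<and> (\<forall>m. - \<delta> < m \<and> m < 0 \<longrightarrow> u + m *\<^sub>R rot u \<in> A)"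
      have "{0<..<d/2} \<inter> ?M = {}" "{-d/2<..<0} \<subseteq> ?M" using j d by auto
      then have "(LINT m|lborel. indicat_real ?M m * (ramp_deriv (-d/2) 0 m - ramp_deriv 0 (d/2) m)) = 1"
        using LINT_indicator_ramp_deriv[OF Mb, of 0 "d/2"] LINT_indicator_ramp_deriv[OF Mb, of "-d/2" 0] d
        by (simp add: right_diff_distrib)
      moreover have "jump_profile (- d / 2) (d / 2) (\<lambda>x. ramp (-d/2) 0 x - ramp 0 (d/2) x) (\<lambda>x. ramp_deriv (-d/2) 0 x - ramp_deriv 0 (d/2) x)"
        using d by (intro jump_profile_ramps) auto
      ultimately show ?thesis by blast
    qed
    then obtain f f' where f: "jump_profile (- d / 2) (d / 2) f f'" and C: "(LINT m|lborel. indicat_real ?M m * f' m) = 1" by blast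
    have "ereal (\<rho> / (1 + d) * (LINT m|lborel. indicat_real A (u + m *\<^sub>R rot u) * f' m)) \<le> perimeter A (wedge u d \<inter> ball 0 \<rho>)"
      using d C by (intro perimeter_wedge_ge[OF A u f _ _ \<rho>]) (auto simp: indicator_slopes)
    also have "\<dots> \<le> perimeter A (wedge u \<delta> \<inter> ball 0 \<rho>)"
    proof (intro perimeter_mono Int_mono order_refl subsetI)
      fix x assume x: "x \<in> wedge u d"
      then have s: "0 < x \<bullet> u" "\<bar>cross2 u x\<bar> < d * (x \<bullet> u)" by (auto simp: wedge_def)
      have "d * (x \<bullet> u) < \<delta> * (x \<bullet> u)" by (rule mult_strict_right_mono[OF d(2) s(1)])
      with s have "\<bar>cross2 u x\<bar> < \<delta> * (x \<bullet> u)" by linarith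
      then show "x \<in> wedge u \<delta>" using s(1) by (simp add: wedge_def)
    qed
    finally show ?thesis by (simp add: indicator_slopes C)
  qed
  show ?thesis
  proof (cases "perimeter A (wedge u \<delta> \<inter> ball 0 \<rho>)")
    case (real P)
    have "\<rho> \<le> P"
    proof (rule ccontr)
      assume "\<not> \<rho> \<le> P"
      have P0: "0 \<le> P" using perimeter_nonneg[of A "wedge u \<delta> \<inter> ball 0 \<rho>"] real by simp
      \<comment> \<open>From \<open>\<rho> \<le> P * (1 + d)\<close> and \<open>P < \<rho>\<close>
        this gives \<open>\<rho> \<le> P + (\<rho> - P) / 2\<close>, a contradiction.\<close>
      define d where "d = min (\<delta> / 2) ((\<rho> - P) / (2 * \<rho>))"
      have d: "0 < d" "d < \<delta>" "d \<le> (\<rho> - P) / (2 * \<rho>)" using \<delta> \<rho> \<open>\<not> \<rho> \<le> P\<close> by (auto simp: d_def)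
      have "\<rho> / (1 + d) \<le> P" using le[OF d(1,2)] real by simp
      then have "\<rho> \<le> P * (1 + d)" using d by (simp add: pos_divide_le_eq)
      also have "\<dots> \<le> P + \<rho> * d" using d \<open>\<not> \<rho> \<le> P\<close> by (simp add: algebra_simps)
      also have "\<rho> * d \<le> (\<rho> - P) / 2" using d(3) \<rho> by (simp add: field_simps)
      finally show False using \<open>\<not> \<rho> \<le> P\<close> by (simp add: field_simps)
    qed
    then show ?thesis using real by simp
  qed (use perimeter_nonneg[of A "wedge u \<delta> \<inter> ball 0 \<rho>"] in auto)
qed

section \<open>The fan structure of a permissible triple of cones\<close>

text \<open>The boundary rays have the directions \<open>\<theta> n\<close>, and \<open>\<Lambda> n\<close> is the label of the sector following the
  \<open>n\<close>-th of them. Both sequences run around the circle infinitely often, \<open>m\<close> steps per turn, so that any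
  sector can be moved to index \<open>1\<close> by a shift.\<close>

definition fan :: "nat \<Rightarrow> (nat \<Rightarrow> real) \<Rightarrow> (nat \<Rightarrow> nat) \<Rightarrow> (nat \<Rightarrow> (real^2) set) \<Rightarrow> bool" where
  "fan m \<theta> \<Lambda> A \<longleftrightarrow> 0 < m \<and> strict_mono \<theta> \<and> (\<forall>n. \<theta> (n + m) = \<theta> n + 2 * pi) \<and>
     (\<forall>n. \<Lambda> (n + m) = \<Lambda> n) \<and> (\<forall>n. \<Lambda> n \<le> 2) \<and> (\<forall>n. \<Lambda> (Suc n) \<noteq> \<Lambda> n) \<and>
     (\<forall>l\<le>2. A l = (\<Union>n\<in>{n. \<Lambda> n = l}. sector (\<theta> n) (\<theta> (Suc n) - \<theta> n)))"

lemma continuous_dir: "continuous_on S dir"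
proof -
  have eq: "dir = (\<lambda>t. cos t *\<^sub>R axis 1 1 + sin t *\<^sub>R axis 2 1)"
    by (simp add: fun_eq_iff vec_eq_iff forall_2 axis_def)
  show ?thesis unfolding eq by (intro continuous_intros)
qed

lemma frontier_dir:
  assumes A: "open A" and t: "t \<in> frontier {t. dir t \<in> A}"
  shows "dir t \<in> frontier A"
proof -
  have o: "open {t. dir t \<in> A}"
    using open_vimage[OF A continuous_dir] by (simp add: vimage_def)
  have "t \<in> closure {t. dir t \<in> A}" "dir t \<notin> A" using t o by (auto simp: frontier_def interior_open)
  moreover have "dir ` closure {t. dir t \<in> A} \<subseteq> closure (dir ` {t. dir t \<in> A})"
    by (rule image_closure_subset) (auto intro: continuous_dir closure_subset[THEN subsetD])
  moreover have "closure (dir ` {t. dir t \<in> A}) \<subseteq> closure A" by (rule closure_mono) auto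
  ultimately show ?thesis using A by (auto simp: frontier_def interior_open)
qed

lemma strict_mono_between:
  fixes \<theta> :: "nat \<Rightarrow> real"
  assumes "\<theta> 0 < t" "t \<le> \<theta> m"
  shows "\<exists>n<m. \<theta> n < t \<and> t \<le> \<theta> (Suc n)"
  using assms
proof (induction m)
  case (Suc m)
  show ?case
  proof (cases "t \<le> \<theta> m")
    case True
    then show ?thesis using Suc less_SucI by blast
  next
    case False
    then show ?thesis using Suc.prems by (intro exI[of _ m]) auto
  qed
qed auto

text \<open>One period is listed in increasing order and repeated by means of \<open>div\<close> and
  \<open>mod\<close>. As the period starts at the element \<open>t0\<close>, the gap after the last
  listed element ends exactly at \<open>t0 + p\<close>.\<close>

lemma periodic_enumeration:
  fixes \<Theta> :: "real set"
  assumes fin: "finite (\<Theta> \<inter> {t0..<t0 + p})" and t0: "t0 \<in> \<Theta>" and p: "0 < p"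
    and per: "\<And>t. t \<in> \<Theta> \<longleftrightarrow> t + p \<in> \<Theta>"
  obtains m and \<theta> :: "nat \<Rightarrow> real" where "0 < m" "strict_mono \<theta>" "\<And>n. \<theta> (n + m) = \<theta> n + p"
    "\<And>n. \<theta> n \<in> \<Theta>" "\<And>n t. \<theta> n < t \<Longrightarrow> t < \<theta> (Suc n) \<Longrightarrow> t \<notin> \<Theta>"
proof -
  define L where "L = sorted_list_of_set (\<Theta> \<inter> {t0..<t0 + p})"
  define m where "m = length L"
  have setL: "set L = \<Theta> \<inter> {t0..<t0 + p}" using fin by (simp add: L_def)
  have sL: "sorted_wrt (<) L" by (simp add: L_def)
  have t0L: "t0 \<in> set L" using setL t0 p by simp
  then have m: "0 < m" by (auto simp: m_def)
  have L0: "L ! 0 = t0"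
  proof -
    from t0L obtain i where i: "i < m" "L ! i = t0" by (auto simp: in_set_conv_nth m_def)
    have "t0 \<le> L ! 0" using setL m nth_mem[of 0 L] by (auto simp: m_def)
    moreover have "i = 0 \<or> L ! 0 < L ! i" using sL i by (auto simp: sorted_wrt_iff_nth_less m_def)
    ultimately show ?thesis using i by auto
  qed
  have Lless: "L ! i < L ! j" if "i < j" "j < m" for i j
    using sL that by (simp add: sorted_wrt_iff_nth_less m_def)
  have Lmem: "L ! i \<in> \<Theta>" "t0 \<le> L ! i" "L ! i < t0 + p" if "i < m" for i
    using setL that nth_mem[of i L] by (auto simp: m_def)
  define \<theta> where "\<theta> n = L ! (n mod m) + p * real (n div m)" for n
  have per': "t + p * real k \<in> \<Theta> \<longleftrightarrow> t \<in> \<Theta>" for t k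
  proof (induction k)
    case (Suc k)
    have "t + p * real (Suc k) = (t + p * real k) + p" by (simp add: algebra_simps)
    then show ?case using Suc per[of "t + p * real k"] by (simp only:)
  qed simp
  have nxt: "\<theta> (Suc n) = (if Suc (n mod m) < m then L ! Suc (n mod m) + p * real (n div m) else t0 + p + p * real (n div m))" for n
  proof (cases "Suc (n mod m) < m")
    case True
    then have "Suc n mod m = Suc (n mod m)" "Suc n div m = n div m"
      by (auto simp: mod_Suc div_Suc)
    then show ?thesis using True by (simp add: \<theta>_def)
  next
    case False
    then have "Suc (n mod m) = m" using m mod_less_divisor[of m n] by linarith
    then have "Suc n mod m = 0" "Suc n div m = Suc (n div m)"
      by (auto simp: mod_Suc div_Suc)
    then show ?thesis using False by (simp add: \<theta>_def L0 algebra_simps)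
  qed
  show thesis
  proof (rule that[OF m])
    show "strict_mono \<theta>"
      unfolding strict_mono_Suc_iff
    proof
      fix n show "\<theta> n < \<theta> (Suc n)"
        unfolding nxt using Lless[of "n mod m" "Suc (n mod m)"] Lmem(3)[of "n mod m"] m by (auto simp: \<theta>_def)
    qed
    show "\<theta> (n + m) = \<theta> n + p" for n using m by (simp add: \<theta>_def algebra_simps)
    show "\<theta> n \<in> \<Theta>" for n using Lmem(1)[of "n mod m"] m by (simp add: \<theta>_def per')
    fix n t assume t: "\<theta> n < t" "t < \<theta> (Suc n)"
    show "t \<notin> \<Theta>"
    proof
      assume "t \<in> \<Theta>"
      define t' where "t' = t - p * real (n div m)"
      have "t' \<in> \<Theta>" using per'[of t' "n div m"] \<open>t \<in> \<Theta>\<close> by (simp add: t'_def)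
      have l: "L ! (n mod m) < t'" using t(1) by (simp add: \<theta>_def t'_def)
      have u: "if Suc (n mod m) < m then t' < L ! Suc (n mod m) else t' < t0 + p"
        using t(2) unfolding nxt by (auto simp: t'_def split: if_splits)
      have "t0 \<le> t'" "t' < t0 + p" using l u Lmem[of "n mod m"] Lmem[of "Suc (n mod m)"] m by (auto split: if_splits)
      then have "t' \<in> set L" using \<open>t' \<in> \<Theta>\<close> setL by simp
      then obtain j where j: "j < m" "L ! j = t'" by (auto simp: in_set_conv_nth m_def)
      have "n mod m < j" using l j Lless[of j "n mod m"] m by (cases j "n mod m" rule: linorder_cases) auto
      moreover then have "Suc (n mod m) < m" using j by linarith
      moreover then have "j < Suc (n mod m)" using u j Lless[of "Suc (n mod m)" j] by (cases j "Suc (n mod m)" rule: linorder_cases) auto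
      ultimately show False by simp
    qed
  qed
qed

text \<open>Angles make the circle a periodic line. The boundary directions of the three cones are
  finitely many modulo a full turn, the label is constant between them by connectedness, and it
  changes at each of them by the normalization.\<close>

theorem fan_exists:
  assumes perm: "permissible A" and cone: "\<forall>j\<le>2. cone_at_origin (A j)" and ne: "\<forall>j\<le>2. A j \<noteq> {}"
  obtains m \<theta> \<Lambda> where "fan m \<theta> \<Lambda> A"
proof -
  have A: "open (A l)" "locally_finite_perimeter (A l)" "frontier (A l) = perimeter_support (A l)" "cone_at_origin (A l)" "A l \<noteq> {}"
    if "l \<le> 2" for l
    using perm cone ne that by (auto simp: permissible_def)
  have disj: "A l \<inter> A l' = {}" if "l \<le> 2" "l' \<le> 2" "l \<noteq> l'" for l l'
    using perm that by (auto simp: permissible_def disjoint_family_on_def)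
  have cover: "\<exists>l\<le>2. x \<in> closure (A l)" for x
    using perm by (auto simp: permissible_def)
  \<comment> \<open>An open cone containing its vertex contains a ball and hence the whole plane,
    leaving no room for another nonempty label.\<close>
  have zero: "0 \<notin> A l" if l: "l \<le> 2" for l
  proof
    assume "0 \<in> A l"
    then obtain e where e: "0 < e" "ball 0 e \<subseteq> A l" using A(1)[OF l] by (meson openE)
    have "x \<in> A l" for x
    proof (cases "x = 0")
      case False
      let ?t = "e / (2 * norm x)"
      have "0 < ?t" using False e by simp
      moreover have "?t *\<^sub>R x \<in> A l" using e False by (intro subsetD[OF e(2)]) simp
      ultimately show ?thesis using cone_scale_iff[OF A(4)[OF l]] by blast
    qed (use \<open>0 \<in> A l\<close> in simp)
    then have "A l = UNIV" by auto
    moreover obtain l' where "l' \<le> 2" "l' \<noteq> l" using that[of 0] that[of 1] by (cases "l = 0") (auto intro: that[of 1] that[of 0])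
    ultimately show False using disj[of l l'] A(5)[of l'] l by auto
  qed
  have polar: "\<exists>r t. 0 < r \<and> a < t \<and> t \<le> a + 2 * pi \<and> x = r *\<^sub>R dir t \<and> dir t \<in> A l" if "x \<in> A l" "l \<le> 2" for x l a
  proof -
    have "x \<noteq> 0" using zero that by auto
    then obtain r t where "0 < r" "a < t" "t \<le> a + 2 * pi" "x = r *\<^sub>R dir t" by (rule polar_exists)
    then show ?thesis using cone_scale_iff[OF A(4)[OF that(2)], of r "dir t"] that by auto
  qed
  define S where "S = (\<Union>l\<le>2. frontier (A l) \<inter> sphere 0 1)"
  have finS: "finite S" unfolding S_def
    by (rule finite_UN_I) (simp_all add: finite_frontier_directions[OF A(1,4,2,3)])
  define \<Theta> where "\<Theta> = {t. dir t \<in> S}"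
  have \<Theta>_iff: "t \<in> \<Theta> \<longleftrightarrow> (\<exists>l\<le>2. dir t \<in> frontier (A l))" for t
    by (auto simp: \<Theta>_def S_def)
  have per: "t \<in> \<Theta> \<longleftrightarrow> t + 2 * pi \<in> \<Theta>" for t by (simp add: \<Theta>_def dir_periodic)
  have fin: "finite (\<Theta> \<inter> {t0..<t0 + 2 * pi})" for t0
  proof (rule finite_imageD)
    show "finite (dir ` (\<Theta> \<inter> {t0..<t0 + 2 * pi}))"
      by (rule finite_subset[OF _ finS]) (auto simp: \<Theta>_def)
    show "inj_on dir (\<Theta> \<inter> {t0..<t0 + 2 * pi})"
    proof (rule inj_onI)
      fix s t assume "s \<in> \<Theta> \<inter> {t0..<t0 + 2 * pi}" "t \<in> \<Theta> \<inter> {t0..<t0 + 2 * pi}" "dir s = dir t"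
      then show "s = t" using polar_unique[of 1 s 1 t] by auto
    qed
  qed
  have oM: "open {t. dir t \<in> A l}" if "l \<le> 2" for l
    using open_vimage[OF A(1)[OF that] continuous_dir] by (simp add: vimage_def)
  \<comment> \<open>Labels 0 and 1 both occur, so the angles of \<open>A 0\<close> form a proper
    nonempty subset of the connected line and have a frontier point.\<close>
  have "\<exists>t0. t0 \<in> \<Theta>"
  proof -
    obtain x y where "x \<in> A 0" "y \<in> A 1" using A(5)[of 0] A(5)[of 1] by auto
    then obtain s t where "dir s \<in> A 0" "dir t \<in> A 1" using polar[of x 0 0] polar[of y 1 0] by auto
    moreover have "A 0 \<inter> A 1 = {}" by (rule disj) auto
    ultimately have "UNIV \<inter> {t. dir t \<in> A 0} \<noteq> {}" "UNIV - {t. dir t \<in> A 0} \<noteq> {}" by auto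
    then have "UNIV \<inter> frontier {t. dir t \<in> A 0} \<noteq> {}"
      by (intro connected_Int_frontier) auto
    then obtain t0 where "dir t0 \<in> frontier (A 0)" using frontier_dir[OF A(1)[of 0]] by auto
    then show ?thesis using \<Theta>_iff by blast
  qed
  then obtain t0 where t0: "t0 \<in> \<Theta>" by blast
  obtain m \<theta> where m: "0 < m" and \<theta>: "strict_mono \<theta>" "\<And>n. \<theta> (n + m) = \<theta> n + 2 * pi"
    "\<And>n. \<theta> n \<in> \<Theta>" "\<And>n t. \<theta> n < t \<Longrightarrow> t < \<theta> (Suc n) \<Longrightarrow> t \<notin> \<Theta>"
    by (rule periodic_enumeration[OF fin[of t0] t0 _ per]) (simp, blast)
  have less: "\<theta> n < \<theta> (Suc n)" for n using \<theta>(1) by (simp add: strict_mono_Suc_iff)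
  have "\<exists>l\<le>2. \<forall>t. \<theta> n < t \<and> t < \<theta> (Suc n) \<longrightarrow> dir t \<in> A l" for n
  proof -
    obtain t1 where t1: "\<theta> n < t1" "t1 < \<theta> (Suc n)" using dense[OF less] by blast
    obtain l where l: "l \<le> 2" "dir t1 \<in> closure (A l)" using cover by blast
    have "dir t1 \<notin> frontier (A l)" using \<theta>(4)[OF t1] \<Theta>_iff l by blast
    then have t1A: "dir t1 \<in> A l" using l A(1)[OF l(1)] by (auto simp: frontier_def interior_open)
    have "dir t \<in> A l" if t: "\<theta> n < t" "t < \<theta> (Suc n)" for t
    proof (rule ccontr)
      assume "dir t \<notin> A l"
      then have "{\<theta> n<..<\<theta> (Suc n)} \<inter> {t. dir t \<in> A l} \<noteq> {}" "{\<theta> n<..<\<theta> (Suc n)} - {t. dir t \<in> A l} \<noteq> {}"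
        using t t1 t1A by auto
      then have "{\<theta> n<..<\<theta> (Suc n)} \<inter> frontier {t. dir t \<in> A l} \<noteq> {}"
        by (intro connected_Int_frontier) auto
      then obtain t2 where t2: "t2 \<in> {\<theta> n<..<\<theta> (Suc n)}" "t2 \<in> frontier {t. dir t \<in> A l}" by blast
      then have "t2 \<in> \<Theta>" using frontier_dir[OF A(1)[OF l(1)] t2(2)] \<Theta>_iff l(1) by blast
      then show False using \<theta>(4)[of n t2] t2(1) by simp
    qed
    then show ?thesis using l by blast
  qed
  then obtain \<Lambda> where \<Lambda>: "\<And>n. \<Lambda> n \<le> 2" "\<And>n t. \<theta> n < t \<Longrightarrow> t < \<theta> (Suc n) \<Longrightarrow> dir t \<in> A (\<Lambda> n)"
    by metis
  have unique: "\<Lambda> n = l" if "\<theta> n < t" "t < \<theta> (Suc n)" "dir t \<in> A l" "l \<le> 2" for n t l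
    using \<Lambda>(2)[OF that(1,2)] disj[OF \<Lambda>(1)[of n] that(4)] that(3) by blast
  have sub: "sector (\<theta> n) (\<theta> (Suc n) - \<theta> n) \<subseteq> A (\<Lambda> n)" for n
    using \<Lambda>(2)[of n] cone_scale_iff[OF A(4)[OF \<Lambda>(1)[of n]]] by (auto simp: mem_sector)
  have \<Lambda>per: "\<Lambda> (n + m) = \<Lambda> n" for n
  proof -
    obtain t where t: "\<theta> n < t" "t < \<theta> (Suc n)" using dense[OF less] by blast
    have "\<theta> (n + m) < t + 2 * pi" "t + 2 * pi < \<theta> (Suc (n + m))" using t \<theta>(2)[of n] \<theta>(2)[of "Suc n"] by auto
    then show ?thesis using unique[of "n + m" "t + 2 * pi" "\<Lambda> n"] \<Lambda>(2)[OF t] \<Lambda>(1) dir_periodic(1) by simp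
  qed
  \<comment> \<open>With equal labels on both sides, one set would fill a neighbourhood
    \<open>W\<close> of the ray up to a null set. No set of the triple then has perimeter in
    \<open>W\<close>, yet the ray lies on the frontier of one of them, which is its perimeter
    support.\<close>
  have jump: "\<Lambda> (Suc n) \<noteq> \<Lambda> n" for n
  proof
    assume eq: "\<Lambda> (Suc n) = \<Lambda> n"
    let ?t = "\<theta> (Suc n)" and ?l = "\<Lambda> n"
    define W where "W = sector (\<theta> n) (\<theta> (Suc (Suc n)) - \<theta> n)"
    have uW: "dir ?t \<in> W" using dir_mem_sector[of "\<theta> n" ?t "\<theta> (Suc (Suc n)) - \<theta> n" 1] less[of n] less[of "Suc n"] by (simp add: W_def)
    have ae: "AE x in lborel. x \<in> W \<longrightarrow> x \<in> A ?l"
      using AE_not_line[OF dir_nonzero, of ?t]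
    proof eventually_elim
      case (elim x)
      show ?case
      proof
        assume "x \<in> W"
        then obtain r s where rs: "0 < r" "\<theta> n < s" "s < \<theta> (Suc (Suc n))" and x: "x = r *\<^sub>R dir s"
          by (auto simp: W_def mem_sector)
        have "s \<noteq> ?t" using elim x dir_in_line[of r ?t] by auto
        then consider "s < ?t" | "?t < s" by linarith
        then have "dir s \<in> A ?l" by cases (use \<Lambda>(2)[of n s] \<Lambda>(2)[of "Suc n" s] eq rs in auto)
        then show "x \<in> A ?l" using cone_scale_iff[OF A(4)[OF \<Lambda>(1)] rs(1)] x by simp
      qed
    qed
    obtain l where l: "l \<le> 2" "dir ?t \<in> frontier (A l)" using \<theta>(3)[of "Suc n"] \<Theta>_iff by blast
    have "(AE x in lborel. x \<in> W \<longrightarrow> x \<notin> A l) \<or> (AE x in lborel. x \<in> W \<longrightarrow> x \<in> A l)"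
    proof (cases "l = ?l")
      case False
      have "A l \<inter> A ?l = {}" by (rule disj[OF l(1) \<Lambda>(1) False])
      from ae have "AE x in lborel. x \<in> W \<longrightarrow> x \<notin> A l"
        by eventually_elim (use \<open>A l \<inter> A ?l = {}\<close> in blast)
      then show ?thesis ..
    qed (use ae in simp)
    then have "perimeter (A l) W = 0" using A(1)[OF l(1)] by (intro perimeter_null) auto
    moreover have "open W" by (simp add: W_def open_sector)
    ultimately show False using l A(3)[OF l(1)] uW by (auto simp: perimeter_support_def)
  qed
  have eq: "A l = (\<Union>n\<in>{n. \<Lambda> n = l}. sector (\<theta> n) (\<theta> (Suc n) - \<theta> n))" if l: "l \<le> 2" for l
  proof (intro equalityI subsetI)
    fix x assume "x \<in> A l"
    then obtain r t where rt: "0 < r" "\<theta> 0 < t" "t \<le> \<theta> 0 + 2 * pi" and x: "x = r *\<^sub>R dir t" and tA: "dir t \<in> A l"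
      using polar[of x l "\<theta> 0"] l by blast
    have "\<theta> 0 + 2 * pi = \<theta> m" using \<theta>(2)[of 0] by simp
    then obtain n where n: "\<theta> n < t" "t \<le> \<theta> (Suc n)" using strict_mono_between[of \<theta> t m] rt by auto
    \<comment> \<open>The ray lies in the frontier of some label \<open>l'\<close>. An open set
      contains none of its own frontier, and it does not meet the closure of a set disjoint from
      it.\<close>
    have "t \<noteq> \<theta> (Suc n)"
    proof
      assume "t = \<theta> (Suc n)"
      then obtain l' where l': "l' \<le> 2" "dir t \<in> frontier (A l')" using \<theta>(3)[of "Suc n"] \<Theta>_iff by blast
      have "A l \<inter> A l' = {} \<or> l' = l" using disj[OF l l'(1)] by blast
      then show False
      proof
        assume "A l \<inter> A l' = {}"
        then have "A l \<inter> closure (A l') = {}" using A(1)[OF l] open_Int_closure_eq_empty by blast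
        then show False using l' tA by (auto simp: frontier_def)
      next
        assume "l' = l"
        then show False using l' tA A(1)[OF l] by (auto simp: frontier_def interior_open)
      qed
    qed
    then have "t < \<theta> (Suc n)" using n by simp
    moreover then have "\<Lambda> n = l" using unique n tA l by blast
    ultimately show "x \<in> (\<Union>n\<in>{n. \<Lambda> n = l}. sector (\<theta> n) (\<theta> (Suc n) - \<theta> n))"
      using n rt x dir_mem_sector[of "\<theta> n" t "\<theta> (Suc n) - \<theta> n" r] by auto
  qed (use sub in auto)
  have "fan m \<theta> \<Lambda> A"
    unfolding fan_def using m \<theta>(1,2) \<Lambda>per \<Lambda>(1) jump eq by blast
  then show thesis by (rule that)
qed

section \<open>Integrals and perimeters of a fan\<close>

abbreviation fan_sector :: "(nat \<Rightarrow> real) \<Rightarrow> nat \<Rightarrow> (real^2) set" where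
  "fan_sector \<theta> n \<equiv> sector (\<theta> n) (\<theta> (Suc n) - \<theta> n)"

context
  fixes m \<theta> \<Lambda> A
  assumes fan: "fan m \<theta> \<Lambda> A"
begin

lemma fan_simps:
  shows fan_pos: "0 < m" and fan_mono: "strict_mono \<theta>" and fan_period: "\<theta> (n + m) = \<theta> n + 2 * pi"
    and fan_label_period: "\<Lambda> (n + m) = \<Lambda> n" and fan_label_le: "\<Lambda> n \<le> 2" and fan_jump: "\<Lambda> (Suc n) \<noteq> \<Lambda> n"
    and fan_eq: "l \<le> 2 \<Longrightarrow> A l = (\<Union>n\<in>{n. \<Lambda> n = l}. fan_sector \<theta> n)"
  using fan by (auto simp: fan_def)

lemma fan_less: "\<theta> n < \<theta> (Suc n)"
  using fan_mono by (simp add: strict_mono_Suc_iff)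

lemma fan_less_iff: "\<theta> i < \<theta> j \<longleftrightarrow> i < j" "\<theta> i \<le> \<theta> j \<longleftrightarrow> i \<le> j"
  using fan_mono by (simp_all add: strict_mono_less strict_mono_less_eq)

lemma fan_period_mult: "\<theta> (n + k * m) = \<theta> n + 2 * pi * real k" "\<Lambda> (n + k * m) = \<Lambda> n"
   "fan_sector \<theta> (n + k * m) = fan_sector \<theta> n"
proof -
  show t: "\<theta> (n + k * m) = \<theta> n + 2 * pi * real k" for n
  proof (induction k)
    case (Suc k)
    have "n + Suc k * m = (n + k * m) + m" by simp
    then have "\<theta> (n + Suc k * m) = \<theta> (n + k * m) + 2 * pi" by (simp only: fan_period)
    then show ?case unfolding Suc by (simp add: algebra_simps)
  qed simp
  show "\<Lambda> (n + k * m) = \<Lambda> n"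
  proof (induction k)
    case (Suc k)
    have "\<Lambda> (n + Suc k * m) = \<Lambda> ((n + k * m) + m)" by (simp add: algebra_simps)
    then show ?case using Suc fan_label_period by simp
  qed simp
  have sh: "sector (a + 2 * pi * real k) g = sector a g" for a g
  proof (induction k)
    case (Suc k)
    have "a + 2 * pi * real (Suc k) = (a + 2 * pi * real k) + 2 * pi" by (simp add: algebra_simps)
    then show ?case using Suc by (simp only: sector_shift)
  qed simp
  have "\<theta> (Suc (n + k * m)) = \<theta> (Suc n) + 2 * pi * real k" using t[of "Suc n"] by simp
  then show "fan_sector \<theta> (n + k * m) = fan_sector \<theta> n" using t[of n] sh by simp
qed

lemma fan_shift: "fan m (\<lambda>n. \<theta> (n + r)) (\<lambda>n. \<Lambda> (n + r)) A"
proof -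
  have "A l = (\<Union>n\<in>{n. \<Lambda> (n + r) = l}. fan_sector \<theta> (n + r))" if "l \<le> 2" for l
  proof -
    have "\<exists>n'. \<Lambda> (n' + r) = \<Lambda> n \<and> fan_sector \<theta> (n' + r) = fan_sector \<theta> n" for n
    proof -
      \<comment> \<open>This prevents truncation in \<open>n + r * m - r\<close>, the index that
        reaches sector \<open>n\<close> in the shifted sequence after \<open>r\<close> full
        turns.\<close>
      have "r * 1 \<le> r * m" using fan_pos by (intro mult_le_mono2) simp
      then have "(n + r * m - r) + r = n + r * m" by linarith
      then show ?thesis using fan_period_mult(2,3)[of n r] by metis
    qed
    then show ?thesis unfolding fan_eq[OF that] by (intro equalityI subsetI; clarsimp) metis+
  qed
  moreover have "strict_mono (\<lambda>n. \<theta> (n + r))" using fan_less by (simp add: strict_mono_Suc_iff)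
  ultimately show ?thesis
    using fan_pos fan_period[of "_ + r"] fan_label_period[of "_ + r"] fan_label_le fan_jump
    by (auto simp: fan_def add.assoc add.commute[of m])
qed

lemma fan_sector_disjoint:
  assumes "i < j" "j < i + m"
  shows "fan_sector \<theta> i \<inter> fan_sector \<theta> j = {}"
proof (rule sector_disjoint)
  have "\<theta> (Suc j) \<le> \<theta> (i + m)" using assms fan_less_iff by simp
  then show "\<theta> j + (\<theta> (Suc j) - \<theta> j) \<le> \<theta> i + 2 * pi" using fan_period by simp
  show "\<theta> i + (\<theta> (Suc i) - \<theta> i) \<le> \<theta> j" using assms fan_less_iff by simp
qed

lemma fan_eq_finite:
  assumes "l \<le> 2"
  shows "A l = (\<Union>n\<in>{n. n < m \<and> \<Lambda> n = l}. fan_sector \<theta> n)"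
proof -
  have "\<exists>n'<m. \<Lambda> n' = \<Lambda> n \<and> fan_sector \<theta> n' = fan_sector \<theta> n" for n
  proof -
    have "n mod m + n div m * m = n" by simp
    then show ?thesis using fan_period_mult(2,3)[of "n mod m" "n div m"] fan_pos by (metis mod_less_divisor)
  qed
  then show ?thesis unfolding fan_eq[OF assms] by (intro equalityI subsetI; clarsimp) metis+
qed

lemma fan_sector_subset: "fan_sector \<theta> n \<subseteq> A (\<Lambda> n)"
  using fan_eq[OF fan_label_le[of n]] by auto

lemma fan_sector_not_in:
  assumes "l \<le> 2" "l \<noteq> \<Lambda> n"
  shows "fan_sector \<theta> n \<inter> A l = {}"
proof -
  have d: "fan_sector \<theta> i \<inter> fan_sector \<theta> j = {}" if "i < m" "j < m" "i \<noteq> j" for i j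
  proof (cases "i < j")
    case True then show ?thesis using fan_sector_disjoint[of i j] that by auto
  next
    case False then show ?thesis using fan_sector_disjoint[of j i] that by auto
  qed
  define k where "k = n mod m"
  have k: "k < m" using fan_pos by (simp add: k_def)
  have "n = k + n div m * m" by (simp add: k_def)
  then have e: "fan_sector \<theta> n = fan_sector \<theta> k" "\<Lambda> n = \<Lambda> k"
    using fan_period_mult(2,3)[of k "n div m"] by simp_all
  show ?thesis
    unfolding fan_eq_finite[OF assms(1)] e using d[OF k] assms(2) e(2) by fastforce
qed

lemma fan_indicator:
  assumes "l \<le> 2"
  shows "indicat_real (A l) x = (\<Sum>n<m. of_bool (\<Lambda> n = l) * indicat_real (fan_sector \<theta> n) x)"
proof -
  have "disjoint_family_on (fan_sector \<theta>) {n. n < m \<and> \<Lambda> n = l}"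
    unfolding disjoint_family_on_def
  proof (intro ballI impI)
    fix i j assume "i \<in> {n. n < m \<and> \<Lambda> n = l}" "j \<in> {n. n < m \<and> \<Lambda> n = l}" "i \<noteq> j"
    then show "fan_sector \<theta> i \<inter> fan_sector \<theta> j = {}"
      using fan_sector_disjoint[of i j] fan_sector_disjoint[of j i] by (cases "i < j") auto
  qed
  then have "indicat_real (A l) x = (\<Sum>n\<in>{n. n < m \<and> \<Lambda> n = l}. indicat_real (fan_sector \<theta> n) x)"
    unfolding fan_eq_finite[OF assms] by (intro indicator_UN_disjoint) auto
  also have "\<dots> = (\<Sum>n<m. of_bool (\<Lambda> n = l) * indicat_real (fan_sector \<theta> n) x)"
    by (rule sum.mono_neutral_cong_left) auto
  finally show ?thesis .
qed

lemma fan_gap: "0 < \<theta> (Suc n) - \<theta> n" "\<theta> (Suc n) - \<theta> n \<le> 2 * pi"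
proof -
  have "Suc n \<le> n + m" using fan_pos by simp
  then have "\<theta> (Suc n) \<le> \<theta> (n + m)" using fan_less_iff(2) by blast
  then show "\<theta> (Suc n) - \<theta> n \<le> 2 * pi" using fan_period by simp
qed (use fan_less in simp)

lemma fan_flux_period: "flux \<phi> 0 (\<rho> *\<^sub>R dir (\<theta> (n + m))) = flux \<phi> 0 (\<rho> *\<^sub>R dir (\<theta> n))"
  using fan_period dir_periodic by simp

text \<open>Summation by parts around the circle: each ray is shared by two sectors, and its flux is
  weighted by the jump of the indicator of the label \<open>l\<close> across it. Periodicity removes
  the boundary terms.\<close>

lemma fan_divergence:
  assumes "l \<le> 2" and \<phi>: "\<phi> \<in> test_fields (ball 0 \<rho>)" and \<rho>: "0 < \<rho>"
  shows "(LINT x|lborel. indicat_real (A l) x * divergence \<phi> x) =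
    (\<Sum>n<m. (of_bool (\<Lambda> (Suc n) = l) - of_bool (\<Lambda> n = l)) * flux \<phi> 0 (\<rho> *\<^sub>R dir (\<theta> (Suc n))))"
proof -
  let ?x = "\<lambda>n. of_bool (\<Lambda> n = l) :: real" and ?F = "\<lambda>n. flux \<phi> 0 (\<rho> *\<^sub>R dir (\<theta> n))"
  have i: "integrable lborel (\<lambda>x. ?x n * (indicat_real (fan_sector \<theta> n) x * divergence \<phi> x))" for n
    using open_sector by (intro integrable_mult_right integrable_indicator_divergence[OF \<phi>]) auto
  have "(LINT x|lborel. indicat_real (A l) x * divergence \<phi> x) =
     (LINT x|lborel. (\<Sum>n<m. ?x n * (indicat_real (fan_sector \<theta> n) x * divergence \<phi> x)))"
    by (simp add: fan_indicator[OF assms(1)] sum_distrib_right mult.assoc)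
  also have "\<dots> = (\<Sum>n<m. (LINT x|lborel. ?x n * (indicat_real (fan_sector \<theta> n) x * divergence \<phi> x)))"
    using i by (rule Bochner_Integration.integral_sum)
  also have "\<dots> = (\<Sum>n<m. ?x n * (?F n - ?F (Suc n)))"
    using sector_divergence[OF \<phi> \<rho> fan_gap] by simp
  also have "\<dots> = (\<Sum>n<m. ?x n * ?F n) - (\<Sum>n<m. ?x n * ?F (Suc n))"
    by (simp add: right_diff_distrib sum_subtractf)
  also have "(\<Sum>n<m. ?x n * ?F n) = (\<Sum>n<m. ?x (Suc n) * ?F (Suc n))"
  proof -
    have "(\<Sum>n<m. ?x n * ?F n) + ?x m * ?F m = ?x 0 * ?F 0 + (\<Sum>n<m. ?x (Suc n) * ?F (Suc n))"
      using sum.lessThan_Suc_shift[of "\<lambda>n. ?x n * ?F n" m] by simp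
    moreover have "?x m * ?F m = ?x 0 * ?F 0"
      using fan_flux_period[of \<phi> \<rho> 0] fan_label_period[of 0] by simp
    ultimately show ?thesis by simp
  qed
  finally show ?thesis by (simp add: left_diff_distrib sum_subtractf)
qed

text \<open>Every ray at which \<open>l\<close> starts or ends contributes its full length
  \<open>\<rho>\<close> inside a wedge of its own, and these wedges are disjoint.\<close>

lemma fan_perimeter_ge:
  assumes l: "l \<le> 2" and A: "open (A l)" "cone_at_origin (A l)" and \<rho>: "0 < \<rho>"
  shows "ereal (\<rho> * (\<Sum>n<m. \<bar>of_bool (\<Lambda> (Suc n) = l) - of_bool (\<Lambda> n = l)\<bar>)) \<le> perimeter (A l) (ball 0 \<rho>)"
proof -
  define J where "J = {n. n < m \<and> (\<Lambda> (Suc n) = l) \<noteq> (\<Lambda> n = l)}"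
  define U where "U n = dir (\<theta> (Suc n))" for n
  have finJ: "finite J" by (simp add: J_def)
  have inj: "inj_on U J"
  proof (rule inj_onI)
    fix i j assume ij: "i \<in> J" "j \<in> J" "U i = U j"
    have b: "\<theta> 0 < \<theta> (Suc n) \<and> \<theta> (Suc n) \<le> \<theta> 0 + 2 * pi" if "n \<in> J" for n
      using that fan_less_iff(2)[of "Suc n" "0 + m"] fan_less_iff(1)[of 0 "Suc n"] fan_period[of 0] by (simp add: J_def)
    have "\<theta> (Suc i) = \<theta> (Suc j)"
      using polar_unique[of 1 "\<theta> (Suc i)" 1 "\<theta> (Suc j)"] ij(3) b[OF ij(1)] b[OF ij(2)] by (simp add: U_def abs_less_iff)
    then have "Suc i = Suc j" using fan_less_iff(2)[of "Suc i" "Suc j"] fan_less_iff(2)[of "Suc j" "Suc i"] by simp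
    then show "i = j" by simp
  qed
  \<comment> \<open>The rays \<open>\<theta> (Suc n)\<close> with \<open>n < m\<close> also border
    the sector of index \<open>m\<close>, so that index is included. The inserted 1 keeps
    \<open>g\<close> below \<open>pi\<close>.\<close>
  define g where "g = Min (insert 1 ((\<lambda>n. \<theta> (Suc n) - \<theta> n) ` {..m}))"
  have g: "0 < g" "g \<le> 1" unfolding g_def using fan_less by (subst Min_gr_iff) (auto intro: Min_le)
  have gap: "g \<le> \<theta> (Suc n) - \<theta> n" if "n \<le> m" for n
    unfolding g_def by (rule Min_le) (use that in auto)
  have gpi: "g < pi" using g pi_gt3 by linarith
  have sg: "0 < sin g" by (rule sin_gt_zero[OF g(1) gpi])
  obtain \<delta> where \<delta>: "0 < \<delta>" "\<delta> \<le> 1" "\<delta> \<le> sin g" and dis: "disjoint_family_on (\<lambda>u. wedge u \<delta>) (U ` J)"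
    by (rule finite_disjoint_wedges[of "U ` J" "sin g"]) (use finJ sg in \<open>auto simp: U_def\<close>)
  have each: "ereal \<rho> \<le> perimeter (A l) (wedge (U n) \<delta> \<inter> ball 0 \<rho>)" if n: "n \<in> J" for n
  proof -
    have nm: "n < m" using n by (simp add: J_def)
    let ?t = "\<theta> (Suc n)"
    \<comment> \<open>The left side is the cross product that decides whether slope \<open>k\<close>
      stays within the angle \<open>g\<close> of the ray. This is the origin of the condition
      \<open>\<delta> \<le> sin g\<close>.\<close>
    have sin_bound: "0 < sin g - k * cos g" if "0 < k" "k < \<delta>" for k
    proof -
      have "k * cos g \<le> k * 1" using that by (intro mult_left_mono) auto
      then show ?thesis using that \<delta> by linarith
    qed
    have right: "U n + k *\<^sub>R rot (U n) \<in> fan_sector \<theta> (Suc n)" if k: "0 < k" "k < \<delta>" for k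
    proof -
      have "cross2 (dir ?t) (U n + k *\<^sub>R rot (U n)) = k"
        by (simp add: U_def cross2_simps cross2_rot inner_dir)
      moreover have "cross2 (U n + k *\<^sub>R rot (U n)) (dir (?t + g)) = sin g - k * cos g"
        by (simp add: U_def cross2_simps cross2_rot cross2_dir inner_dir)
      ultimately have "U n + k *\<^sub>R rot (U n) \<in> sector ?t g"
        using sector_cross2[OF g(1) gpi] k sin_bound[OF k] by simp
      moreover have "sector ?t g \<subseteq> fan_sector \<theta> (Suc n)"
        using gap[of "Suc n"] nm by (intro sector_mono) auto
      ultimately show ?thesis by blast
    qed
    have left: "U n + k *\<^sub>R rot (U n) \<in> fan_sector \<theta> n" if k: "- \<delta> < k" "k < 0" for k
    proof -
      have k': "0 < - k" "- k < \<delta>" using k by auto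
      have "cross2 (U n + k *\<^sub>R rot (U n)) (dir (?t - g + g)) = - k"
        by (simp add: U_def cross2_simps cross2_rot inner_dir)
      moreover have "cross2 (dir (?t - g)) (U n + k *\<^sub>R rot (U n)) = sin g - (- k) * cos g"
        by (simp add: U_def cross2_simps cross2_rot cross2_dir inner_dir)
      ultimately have "U n + k *\<^sub>R rot (U n) \<in> sector (?t - g) g"
        using sector_cross2[OF g(1) gpi, of _ "?t - g"] k sin_bound[OF k'] by simp
      moreover have "sector (?t - g) g \<subseteq> fan_sector \<theta> n"
        using gap[of n] nm by (intro sector_mono) auto
      ultimately show ?thesis by blast
    qed
    have inA: "x \<in> A l \<longleftrightarrow> \<Lambda> k = l" if "x \<in> fan_sector \<theta> k" for x k
      using that fan_sector_subset[of k] fan_sector_not_in[OF l, of k] by blast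
    have nU: "norm (U n) = 1" by (simp add: U_def)
    show ?thesis
      by (rule perimeter_wedge_jump[OF A nU \<rho> \<delta>(1)]) (use n in \<open>auto simp: inA[OF right] inA[OF left] J_def\<close>)
  qed
  have "\<rho> * (\<Sum>n<m. \<bar>of_bool (\<Lambda> (Suc n) = l) - of_bool (\<Lambda> n = l)\<bar>) = \<rho> * real (card J)"
  proof -
    have "(\<Sum>n<m. \<bar>of_bool (\<Lambda> (Suc n) = l) - of_bool (\<Lambda> n = l) :: real\<bar>) = (\<Sum>n\<in>J. 1)"
      by (rule sum.mono_neutral_cong_right) (auto simp: J_def)
    then show ?thesis by simp
  qed
  then have "ereal (\<rho> * (\<Sum>n<m. \<bar>of_bool (\<Lambda> (Suc n) = l) - of_bool (\<Lambda> n = l)\<bar>)) = (\<Sum>n\<in>J. ereal \<rho>)"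
    by (simp add: mult.commute)
  also have "\<dots> \<le> (\<Sum>n\<in>J. perimeter (A l) (wedge (U n) \<delta> \<inter> ball 0 \<rho>))"
    by (rule sum_mono) (rule each)
  also have "\<dots> \<le> perimeter (A l) (\<Union>n\<in>J. wedge (U n) \<delta> \<inter> ball 0 \<rho>)"
  proof (rule perimeter_superadditive_sum[OF _ finJ])
    show "disjoint_family_on (\<lambda>n. wedge (U n) \<delta> \<inter> ball 0 \<rho>) J"
      using dis inj by (fastforce simp: disjoint_family_on_def inj_on_def)
  qed (use A in auto)
  also have "\<dots> \<le> perimeter (A l) (ball 0 \<rho>)" by (intro perimeter_mono) auto
  finally show ?thesis .
qed

lemma fan_frontier_null:
  assumes op: "\<And>l. l \<le> 2 \<Longrightarrow> open (A l)" and l: "l \<le> 2"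
  shows "AE x in lborel. x \<notin> frontier (A l)"
proof -
  have "AE x in lborel. \<forall>n\<in>{..m}. x \<notin> line (dir (\<theta> n))"
    by (intro AE_finite_allI finite_atMost AE_not_line dir_nonzero)
  then show ?thesis
  proof eventually_elim
    case (elim x)
    then have "x \<noteq> 0" by (auto simp: line_def cross2_simps)
    then obtain r t where rt: "0 < r" "\<theta> 0 < t" "t \<le> \<theta> 0 + 2 * pi" and x: "x = r *\<^sub>R dir t" by (rule polar_exists)
    then obtain n where n: "n < m" "\<theta> n < t" "t \<le> \<theta> (Suc n)"
      using strict_mono_between[of \<theta> t m] fan_period[of 0] by auto
    have "t \<noteq> \<theta> (Suc n)" using elim n(1) dir_in_line[of r t] by (auto simp: x)
    then have s: "x \<in> fan_sector \<theta> n" using n rt x by (auto intro: dir_mem_sector)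
    show ?case
    proof (cases "\<Lambda> n = l")
      case True
      then have "x \<in> A l" using s fan_sector_subset by blast
      then show ?thesis using op[OF l] by (simp add: frontier_def interior_open)
    next
      case False
      then have "fan_sector \<theta> n \<inter> closure (A l) = {}"
        using fan_sector_not_in[OF l, of n] open_Int_closure_eq_empty[OF open_sector] by auto
      then show ?thesis using s by (auto simp: frontier_def)
    qed
  qed
qed

end

section \<open>Relabelling disjoint pieces of a triple\<close>

lemma open_AE_empty:
  fixes V :: "'a::euclidean_space set"
  assumes "open V" "AE x in lborel. x \<notin> V"
  shows "V = {}"
proof (rule ccontr)
  assume "V \<noteq> {}"
  have "V \<in> null_sets lborel"
    using assms by (subst AE_iff_null_sets) auto
  then have "V \<in> null_sets lebesgue" by (rule null_sets_completionI)
  then have "negligible V" by (simp add: negligible_iff_null_sets)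
  then show False using open_not_negligible[OF assms(1) \<open>V \<noteq> {}\<close>] by simp
qed

lemma perimeter_support_subset_frontier:
  fixes E :: "(real^2) set"
  assumes "open E"
  shows "perimeter_support E \<subseteq> frontier E"
proof
  fix x assume x: "x \<in> perimeter_support E"
  have Eb: "E \<in> sets borel" using assms by auto
  have "x \<notin> E"
  proof
    assume "x \<in> E"
    moreover have "perimeter E E = 0" by (rule perimeter_null[OF Eb]) simp
    ultimately show False using x assms by (auto simp: perimeter_support_def)
  qed
  moreover have "x \<in> closure E"
  proof (rule ccontr)
    assume "x \<notin> closure E"
    moreover have "perimeter E (- closure E) = 0"
      using closure_subset[of E] by (intro perimeter_null[OF Eb]) (auto intro!: AE_I2)
    moreover have "open (- closure E)" by (intro open_Compl closed_closure)
    moreover have "0 < perimeter E (- closure E)"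
      using x calculation unfolding perimeter_support_def by blast
    ultimately show False by simp
  qed
  ultimately show "x \<in> frontier E" using assms by (simp add: frontier_def interior_open)
qed

text \<open>For a regular open set, a ball around a frontier point meets both the set and the
  complement of its closure. By \<open>perimeter_pos\<close> it carries positive perimeter.\<close>

lemma frontier_subset_perimeter_support:
  fixes E :: "(real^2) set"
  assumes E: "interior (closure E) = E"
  shows "frontier E \<subseteq> perimeter_support E"
proof
  fix x assume x: "x \<in> frontier E"
  have oE: "open E" using E by (metis open_interior)
  have "0 < perimeter E U" if U: "open U" "x \<in> U" for U
  proof -
    obtain r where r: "0 < r" "ball x r \<subseteq> U" using U by (meson openE)
    have "x \<in> closure E" "x \<notin> E" using x oE by (auto simp: frontier_def interior_open)
    then have "ball x r \<inter> E \<noteq> {}"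
      using centre_in_ball[of x r] r open_Int_closure_eq_empty[of "ball x r" E] by blast
    moreover have "\<not> ball x r \<subseteq> closure E"
    proof
      assume "ball x r \<subseteq> closure E"
      then have "ball x r \<subseteq> interior (closure E)" by (rule interior_maximal) auto
      then show False using E \<open>x \<notin> E\<close> centre_in_ball[of x r] r(1) by blast
    qed
    ultimately obtain y z where "y \<in> E" "y \<in> ball x r" "z \<in> ball x r" "z \<notin> closure E" by blast
    then have "0 < perimeter E (ball x r)" by (intro perimeter_pos oE) auto
    also have "\<dots> \<le> perimeter E U" using r by (intro perimeter_mono)
    finally show ?thesis .
  qed
  then show "x \<in> perimeter_support E" by (simp add: perimeter_support_def)
qed

lemma interior_closure_idem: "interior (closure (interior (closure D))) = interior (closure D)"
proof
  have "closure (interior (closure D)) \<subseteq> closure D"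
    using closure_mono[OF interior_subset[of "closure D"]] by simp
  then show "interior (closure (interior (closure D))) \<subseteq> interior (closure D)" by (rule interior_mono)
  show "interior (closure D) \<subseteq> interior (closure (interior (closure D)))"
    using closure_subset by (intro interior_maximal) auto
qed

lemma interior_closure_disjoint:
  assumes "open D" "open D'" "D \<inter> D' = {}"
  shows "interior (closure D) \<inter> interior (closure D') = {}"
proof -
  have "D \<inter> closure D' = {}" using assms open_Int_closure_eq_empty by blast
  then have "interior (closure D') \<inter> D = {}" using interior_subset by blast
  then have "interior (closure D') \<inter> closure D = {}" using open_Int_closure_eq_empty[OF open_interior] by blast
  then show ?thesis using interior_subset[of "closure D"] by blast
qed

context
  fixes A :: "nat \<Rightarrow> (real^2) set" and T :: "nat \<Rightarrow> (real^2) set" and I :: "nat set" and old new :: "nat \<Rightarrow> nat" and C :: "nat \<Rightarrow> real"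
  assumes perm: "permissible A" and null: "\<And>l. l \<le> 2 \<Longrightarrow> AE x in lborel. x \<notin> frontier (A l)"
    and I: "finite I" and T: "\<And>i. i \<in> I \<Longrightarrow> open (T i)" "\<And>i. i \<in> I \<Longrightarrow> AE x in lborel. x \<notin> frontier (T i)"
      "\<And>i. i \<in> I \<Longrightarrow> T i \<subseteq> A (old i)" "disjoint_family_on T I"
      "\<And>i. i \<in> I \<Longrightarrow> old i \<le> 2" "\<And>i. i \<in> I \<Longrightarrow> new i \<le> 2"
      "\<And>i U \<phi>. i \<in> I \<Longrightarrow> \<phi> \<in> test_fields U \<Longrightarrow> \<bar>LINT x|lborel. indicat_real (T i) x * divergence \<phi> x\<bar> \<le> C i"
begin

text \<open>The closed pieces are removed to keep the sets open, and the interior of the closure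
  then fills in the slits along former interfaces. The outcome is regular open, so its frontier is
  its perimeter support.\<close>

definition relabelled :: "nat \<Rightarrow> (real^2) set" where
  "relabelled l = interior (closure ((A l - (\<Union>i\<in>I. closure (T i))) \<union> (\<Union>i\<in>{i\<in>I. new i = l}. T i)))"

text \<open>Away from the null set \<open>N\<close> of all frontiers, a point has one label and lies
  in at most one piece, and the relabelling is read off pointwise. Finite perimeter follows field by
  field from the bounds \<open>C i\<close>.\<close>

lemma relabelled_props:
  shows "permissible relabelled"
    and "l \<le> 2 \<Longrightarrow> spt (\<lambda>x. indicat_real (A l) x - indicat_real (relabelled l) x) \<subseteq> (\<Union>i\<in>I. closure (T i))"
    and "l \<le> 2 \<Longrightarrow> AE x in lborel. indicat_real (relabelled l) x = indicat_real (A l) x +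
      (\<Sum>i\<in>I. (of_bool (new i = l) - of_bool (old i = l)) * indicat_real (T i) x)"
proof -
  define K where "K = (\<Union>i\<in>I. closure (T i))"
  define D where "D l = (A l - K) \<union> (\<Union>i\<in>{i\<in>I. new i = l}. T i)" for l
  define B where "B = relabelled"
  have B: "B l = interior (closure (D l))" for l by (simp add: B_def relabelled_def D_def K_def)
  have A: "open (A l)" "locally_finite_perimeter (A l)" "frontier (A l) = perimeter_support (A l)" if "l \<le> 2" for l
    using perm that by (auto simp: permissible_def)
  have disj: "A l \<inter> A l' = {}" if "l \<le> 2" "l' \<le> 2" "l \<noteq> l'" for l l'
    using perm that by (auto simp: permissible_def disjoint_family_on_def)
  have cover: "\<exists>l\<le>2. x \<in> closure (A l)" for x using perm by (auto simp: permissible_def)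
  have Tdisj: "T i \<inter> T j = {}" if "i \<in> I" "j \<in> I" "i \<noteq> j" for i j
    using T(4) that by (auto simp: disjoint_family_on_def)
  have TK: "T i \<subseteq> K" if "i \<in> I" for i using that closure_subset by (auto simp: K_def)
  have clK: "closed K" unfolding K_def using I by (intro closed_UN) auto
  have oD: "open (D l)" if "l \<le> 2" for l
    unfolding D_def using A(1)[OF that] clK T(1) by (intro open_Un open_Diff open_UN) auto
  have DB: "D l \<subseteq> B l" if "l \<le> 2" for l
    unfolding B using closure_subset oD[OF that] by (intro interior_maximal) auto
  have Ddisj: "D l \<inter> D l' = {}" if "l \<le> 2" "l' \<le> 2" "l \<noteq> l'" for l l'
  proof -
    have "T i \<inter> T j = {}" if "i \<in> I" "new i = l" "j \<in> I" "new j = l'" for i j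
      using Tdisj[of i j] that \<open>l \<noteq> l'\<close> by auto
    then show ?thesis using disj[OF that] TK unfolding D_def by blast
  qed
  define N where "N = (\<Union>l\<le>2. frontier (A l)) \<union> (\<Union>i\<in>I. frontier (T i))"
  have nullN: "AE x in lborel. x \<notin> N"
  proof -
    have "AE x in lborel. \<forall>l\<in>{..2}. x \<notin> frontier (A l)" using null by (intro AE_finite_allI) auto
    moreover have "AE x in lborel. \<forall>i\<in>I. x \<notin> frontier (T i)" using T(2) I by (intro AE_finite_allI) auto
    ultimately show ?thesis by eventually_elim (auto simp: N_def)
  qed
  have offN: "\<exists>l\<le>2. x \<in> A l \<and> ((x \<notin> K \<and> x \<in> D l) \<or> (\<exists>i\<in>I. x \<in> T i \<and> old i = l \<and> x \<in> D (new i)))" if x: "x \<notin> N" for x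
  proof -
    obtain l where l: "l \<le> 2" "x \<in> closure (A l)" using cover by blast
    then have xA: "x \<in> A l" using x A(1) by (auto simp: N_def frontier_def interior_open)
    show ?thesis
    proof (cases "x \<in> K")
      case True
      then obtain i where i: "i \<in> I" "x \<in> closure (T i)" by (auto simp: K_def)
      then have xT: "x \<in> T i" using x T(1) by (auto simp: N_def frontier_def interior_open)
      then have "x \<in> A (old i)" using T(3) i by blast
      then have "old i = l" using disj[OF l(1) T(5)[OF i(1)]] xA by auto
      moreover have "x \<in> D (new i)" using xT i by (auto simp: D_def)
      ultimately show ?thesis using l(1) xA xT i by blast
    qed (use l xA in \<open>auto simp: D_def\<close>)
  qed
  \<comment> \<open>The interior of the closure adds nothing off \<open>N\<close>: such a point lies
    in some \<open>D l'\<close>, which is open and, if \<open>l' \<noteq> l\<close>, disjoint from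
    \<open>D l\<close> and so from its closure.\<close>
  have BD: "x \<in> B l \<longleftrightarrow> x \<in> D l" if x: "x \<notin> N" and l: "l \<le> 2" for x l
  proof
    assume xB: "x \<in> B l"
    obtain l' where l': "l' \<le> 2" "x \<in> D l'" using offN[OF x] T(6) by blast
    show "x \<in> D l"
    proof (rule ccontr)
      assume "x \<notin> D l"
      then have "D l' \<inter> D l = {}" using Ddisj[OF l'(1) l] l' by auto
      then have "D l' \<inter> closure (D l) = {}" using oD[OF l'(1)] open_Int_closure_eq_empty by blast
      then show False using xB l' interior_subset unfolding B by blast
    qed
  qed (use DB[OF l] in auto)
  have Bind: "indicat_real (B l) x = indicat_real (A l) x + (\<Sum>i\<in>I. (of_bool (new i = l) - of_bool (old i = l)) * indicat_real (T i) x)"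
    if x: "x \<notin> N" and l: "l \<le> 2" for x l
  proof -
    obtain l0 where l0: "l0 \<le> 2" "x \<in> A l0" and cs: "(x \<notin> K \<and> x \<in> D l0) \<or> (\<exists>i\<in>I. x \<in> T i \<and> old i = l0 \<and> x \<in> D (new i))"
      using offN[OF x] by blast
    have xA: "x \<in> A l \<longleftrightarrow> l = l0" using disj[OF l l0(1)] l0(2) by auto
    from cs show ?thesis
    proof
      assume c: "x \<notin> K \<and> x \<in> D l0"
      have "(\<Sum>i\<in>I. (of_bool (new i = l) - of_bool (old i = l)) * indicat_real (T i) x) = 0"
        using c TK by (intro sum.neutral) (auto simp: indicator_def)
      moreover have "x \<in> D l \<longleftrightarrow> l = l0" using c Ddisj[OF l l0(1)] by auto
      ultimately show ?thesis using xA BD[OF x l] by (simp add: indicator_def)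
    next
      assume "\<exists>i\<in>I. x \<in> T i \<and> old i = l0 \<and> x \<in> D (new i)"
      then obtain i where i: "i \<in> I" "x \<in> T i" "old i = l0" "x \<in> D (new i)" by blast
      have "(\<Sum>j\<in>I. (of_bool (new j = l) - of_bool (old j = l)) * indicat_real (T j) x)
        = (\<Sum>j\<in>{i}. (of_bool (new j = l) - of_bool (old j = l)) * indicat_real (T j) x)"
        using I i(1,2) Tdisj[OF i(1)] by (intro sum.mono_neutral_right) (auto simp: indicator_def)
      moreover have "x \<in> D l \<longleftrightarrow> new i = l" using i(4) Ddisj[OF l T(6)[OF i(1)]] by auto
      ultimately show ?thesis using xA BD[OF x l] i by (auto simp: indicator_def)
    qed
  qed
  have ind: "AE x in lborel. indicat_real (B l) x = indicat_real (A l) x + (\<Sum>i\<in>I. (of_bool (new i = l) - of_bool (old i = l)) * indicat_real (T i) x)"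
    if l: "l \<le> 2" for l
    using nullN by eventually_elim (rule Bind[OF _ l])
  then show "l \<le> 2 \<Longrightarrow> AE x in lborel. indicat_real (relabelled l) x = indicat_real (A l) x +
      (\<Sum>i\<in>I. (of_bool (new i = l) - of_bool (old i = l)) * indicat_real (T i) x)" by (simp add: B_def)
  have oB: "open (B l)" for l by (simp add: B)
  have Bb: "B l \<in> sets borel" for l using oB by auto
  have Ab: "A l \<in> sets borel" if "l \<le> 2" for l using A(1)[OF that] by auto
  have Tb: "T i \<in> sets borel" if "i \<in> I" for i using T(1)[OF that] by auto
  have lfp: "locally_finite_perimeter (B l)" if l: "l \<le> 2" for l
    unfolding locally_finite_perimeter_def
  proof (intro conjI allI impI)
    show "B l \<in> sets lebesgue" using Bb by auto
    fix U :: "(real^2) set" assume U: "open U \<and> bounded U"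
    have "perimeter (A l) U < \<infinity>" using A(2)[OF l] U by (auto simp: locally_finite_perimeter_def)
    then obtain P where P: "perimeter (A l) U = ereal P"
      using perimeter_nonneg[of "A l" U] by (cases "perimeter (A l) U") auto
    have "perimeter (B l) U \<le> ereal (P + (\<Sum>i\<in>I. C i))"
    proof (rule perimeter_least)
      fix \<phi> :: "real^2 \<Rightarrow> real^2" assume \<phi>: "\<phi> \<in> test_fields U"
      let ?c = "\<lambda>i. of_bool (new i = l) - of_bool (old i = l) :: real"
      have iA: "integrable lborel (\<lambda>x. indicat_real (A l) x * divergence \<phi> x)"
        by (rule integrable_indicator_divergence[OF \<phi> Ab[OF l]])
      have iT: "integrable lborel (\<lambda>x. ?c i * (indicat_real (T i) x * divergence \<phi> x))" if "i \<in> I" for i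
        by (intro integrable_mult_right integrable_indicator_divergence[OF \<phi> Tb[OF that]])
      have "(LINT x:B l|lebesgue. divergence \<phi> x) = (LINT x|lborel. indicat_real (B l) x * divergence \<phi> x)"
        by (rule set_integral_lebesgue_divergence[OF \<phi> Bb])
      also have "\<dots> = (LINT x|lborel. indicat_real (A l) x * divergence \<phi> x + (\<Sum>i\<in>I. ?c i * (indicat_real (T i) x * divergence \<phi> x)))"
      proof (rule integral_cong_AE)
        show "AE x in lborel. indicat_real (B l) x * divergence \<phi> x = indicat_real (A l) x * divergence \<phi> x + (\<Sum>i\<in>I. ?c i * (indicat_real (T i) x * divergence \<phi> x))"
          using ind[OF l] by eventually_elim (simp add: distrib_right sum_distrib_right mult.assoc)
        show "(\<lambda>x. indicat_real (B l) x * divergence \<phi> x) \<in> borel_measurable lborel"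
          using integrable_indicator_divergence[OF \<phi> Bb] by (rule borel_measurable_integrable)
        show "(\<lambda>x. indicat_real (A l) x * divergence \<phi> x + (\<Sum>i\<in>I. ?c i * (indicat_real (T i) x * divergence \<phi> x))) \<in> borel_measurable lborel"
          by (intro borel_measurable_add borel_measurable_sum borel_measurable_integrable iA iT)
      qed
      also have "\<dots> = (LINT x|lborel. indicat_real (A l) x * divergence \<phi> x) + (\<Sum>i\<in>I. ?c i * (LINT x|lborel. indicat_real (T i) x * divergence \<phi> x))"
        using iA iT by (subst Bochner_Integration.integral_add) (auto simp: Bochner_Integration.integral_sum)
      also have "\<dots> \<le> P + (\<Sum>i\<in>I. C i)"
      proof (intro add_mono sum_mono)
        show "(LINT x|lborel. indicat_real (A l) x * divergence \<phi> x) \<le> P"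
          using perimeter_upper[OF \<phi>, of "A l"] P by (simp add: set_integral_lebesgue_divergence[OF \<phi> Ab[OF l]])
        fix i assume i: "i \<in> I"
        have "?c i * (LINT x|lborel. indicat_real (T i) x * divergence \<phi> x) \<le> \<bar>LINT x|lborel. indicat_real (T i) x * divergence \<phi> x\<bar>"
          by (auto simp: of_bool_def abs_if)
        then show "?c i * (LINT x|lborel. indicat_real (T i) x * divergence \<phi> x) \<le> C i" using T(7)[OF i \<phi>] by linarith
      qed
      finally show "(LINT x:B l|lebesgue. divergence \<phi> x) \<le> P + (\<Sum>i\<in>I. C i)" .
    qed
    then show "perimeter (B l) U < \<infinity>" by (rule le_less_trans) simp
  qed
  have fr: "frontier (B l) = perimeter_support (B l)" for l
    using perimeter_support_subset_frontier[OF oB] frontier_subset_perimeter_support[of "B l"] interior_closure_idem[of "D l"]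
    unfolding B by blast
  have "disjoint_family_on B {..2}"
    unfolding disjoint_family_on_def B
    by (intro ballI impI interior_closure_disjoint oD Ddisj) auto
  moreover have "(\<Union>l\<le>2. closure (B l)) = UNIV"
  proof -
    \<comment> \<open>The union of the closures is closed and contains almost every point, so its
      open complement is empty.\<close>
    have "- N \<subseteq> (\<Union>l\<le>2. D l)" using offN T(6) by fastforce
    also have "\<dots> \<subseteq> (\<Union>l\<le>2. closure (B l))" using DB closure_subset by fastforce
    finally have s: "- N \<subseteq> (\<Union>l\<le>2. closure (B l))" .
    have "closed (\<Union>l\<le>2. closure (B l))" by (intro closed_UN) auto
    then have "open (- (\<Union>l\<le>2. closure (B l)))" by auto
    moreover have "AE x in lborel. x \<notin> - (\<Union>l\<le>2. closure (B l))"
      using nullN by eventually_elim (use s in auto)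
    ultimately have "- (\<Union>l\<le>2. closure (B l)) = {}" by (rule open_AE_empty)
    then show ?thesis by blast
  qed
  ultimately have "permissible B" using oB lfp fr by (simp add: permissible_def)
  then show "permissible relabelled" by (simp add: B_def)
  have "indicat_real (A l) x - indicat_real (B l) x = 0" if l: "l \<le> 2" and xK: "x \<notin> K" for l x
  proof -
    \<comment> \<open>\<open>spt\<close> is pointwise, so agreement up to null sets outside
      \<open>K\<close> is not enough. On the open set \<open>V\<close> the set \<open>A l\<close>
      has full measure, hence no perimeter and, being normalized, no frontier; the rest of
      \<open>V\<close> outside \<open>closure (A l)\<close> is open and null.\<close>
    have "x \<in> A l" if xB: "x \<in> B l"
    proof (rule ccontr)
      assume xA: "x \<notin> A l"
      define V where "V = B l - K"
      have oV: "open V" using oB clK by (auto simp: V_def)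
      have xV: "x \<in> V" using xB xK by (simp add: V_def)
      have ae: "AE y in lborel. y \<in> V \<longrightarrow> y \<in> A l"
        using nullN
      proof eventually_elim
        case (elim y)
        then show ?case using BD[OF elim l] TK by (auto simp: V_def D_def)
      qed
      then have "perimeter (A l) V = 0" by (intro perimeter_null[OF Ab[OF l]]) simp
      then have "x \<notin> frontier (A l)" using A(3)[OF l] oV xV by (auto simp: perimeter_support_def)
      then have "x \<in> V - closure (A l)" using xA xV A(1)[OF l] by (auto simp: frontier_def interior_open)
      moreover have "V - closure (A l) = {}"
      proof (rule open_AE_empty)
        show "open (V - closure (A l))" using oV by auto
        show "AE y in lborel. y \<notin> V - closure (A l)"
          using ae by eventually_elim (use closure_subset in auto)
      qed
      ultimately show False by simp
    qed
    moreover have "x \<in> B l" if "x \<in> A l" using that xK DB[OF l] by (auto simp: D_def)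
    ultimately show ?thesis by (auto simp: indicator_def)
  qed
  then have "spt (\<lambda>x. indicat_real (A l) x - indicat_real (B l) x) \<subseteq> K" if "l \<le> 2" for l
    unfolding spt_def using that clK by (intro closure_minimal) auto
  then show "l \<le> 2 \<Longrightarrow> spt (\<lambda>x. indicat_real (A l) x - indicat_real (relabelled l) x) \<subseteq> (\<Union>i\<in>I. closure (T i))"
    by (simp add: B_def K_def)
qed

end

section \<open>Splitting the tip of a sector\<close>

lemma convex_triangle: "convex (triangle a b c)"
proof (rule convexI)
  fix x y and u v :: real
  assume x: "x \<in> triangle a b c" and y: "y \<in> triangle a b c" and uv: "0 \<le> u" "0 \<le> v" "u + v = 1"
  obtain s t where st: "0 < s" "0 < t" "s + t < 1" "x = a + s *\<^sub>R (b - a) + t *\<^sub>R (c - a)"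
    using x by (auto simp: triangle_def)
  obtain s' t' where st': "0 < s'" "0 < t'" "s' + t' < 1" "y = a + s' *\<^sub>R (b - a) + t' *\<^sub>R (c - a)"
    using y by (auto simp: triangle_def)
  have pos: "0 < u * k + v * k'" if "0 < k" "0 < k'" for k k' :: real
  proof (cases "u = 0")
    case False
    then have "0 < u * k" "0 \<le> v * k'" using uv that by auto
    then show ?thesis by linarith
  qed (use uv that in auto)
  have "u *\<^sub>R x + v *\<^sub>R y = (u + v) *\<^sub>R a + (u * s + v * s') *\<^sub>R (b - a) + (u * t + v * t') *\<^sub>R (c - a)"
    unfolding st(4) st'(4) scaleR_add_right scaleR_add_left scaleR_scaleR by (simp add: add_ac)
  moreover have "0 < u * s + v * s'" "0 < u * t + v * t'" using pos st st' by auto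
  moreover have "(u * s + v * s') + (u * t + v * t') < 1"
    using pos[of "1 - (s + t)" "1 - (s' + t')"] st st' uv by (simp add: algebra_simps)
  ultimately show "u *\<^sub>R x + v *\<^sub>R y \<in> triangle a b c"
    unfolding triangle_def using uv by auto
qed

lemma triangle_frontier_null: "AE x in lborel. x \<notin> frontier (triangle a b c)"
proof -
  have "negligible (frontier (triangle a b c))" by (rule negligible_convex_frontier[OF convex_triangle])
  then have "frontier (triangle a b c) \<in> null_sets lebesgue" by (simp add: negligible_iff_null_sets)
  then have "frontier (triangle a b c) \<in> null_sets lborel"
    by (auto simp: null_sets_def)
  then show ?thesis by (rule AE_not_in)
qed

lemma triangle_norm_le:
  assumes "norm a \<le> M" "norm b \<le> M" "norm c \<le> M"
  shows "closure (triangle a b c) \<subseteq> cball 0 M"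
proof (rule closure_minimal)
  show "triangle a b c \<subseteq> cball 0 M"
  proof
    fix x assume "x \<in> triangle a b c"
    then obtain s t where st: "0 < s" "0 < t" "s + t < 1" "x = a + s *\<^sub>R (b - a) + t *\<^sub>R (c - a)"
      by (auto simp: triangle_def)
    have "x = (1 - s - t) *\<^sub>R a + s *\<^sub>R b + t *\<^sub>R c" unfolding st by (simp add: algebra_simps)
    then have "norm x \<le> norm ((1 - s - t) *\<^sub>R a) + norm (s *\<^sub>R b) + norm (t *\<^sub>R c)"
      by (metis norm_triangle_ineq norm_triangle_mono order_refl)
    also have "\<dots> \<le> (1 - s - t) * M + s * M + t * M"
      using st assms by (auto intro!: add_mono mult_left_mono)
    finally show "x \<in> cball 0 M" by (simp add: algebra_simps)
  qed
qed auto

lemma triangle_divergence_bound: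
  assumes \<phi>: "\<phi> \<in> test_fields U" and c: "cross2 (b - a) (c - a) > 0"
  shows "\<bar>LINT x|lborel. indicat_real (triangle a b c) x * divergence \<phi> x\<bar> \<le> norm (b - a) + norm (c - b) + norm (a - c)"
  unfolding triangle_divergence[OF assms]
  using flux_bound[OF test_fieldsD(7,5)[OF \<phi>], of a b] flux_bound[OF test_fieldsD(7,5)[OF \<phi>], of b c]
    flux_bound[OF test_fieldsD(7,5)[OF \<phi>], of c a] by linarith

lemma triangle_integrable:
  assumes c: "cross2 (b - a) (c - a) > 0"
  shows "integrable lborel (indicat_real (triangle a b c))"
proof (rule integrable_real_indicator)
  show "triangle a b c \<in> sets lborel" using open_triangle[OF c] by auto
  define M where "M = norm a + norm b + norm c"
  have "closure (triangle a b c) \<subseteq> cball 0 M" by (rule triangle_norm_le) (auto simp: M_def)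
  then have "triangle a b c \<subseteq> cball 0 M" using closure_subset by blast
  then have "bounded (triangle a b c)" using bounded_cball bounded_subset by blast
  then show "emeasure lborel (triangle a b c) < \<infinity>" by (rule emeasure_bounded_finite)
qed

text \<open>Areas are only compared: triangles with equal cross products have equal area, whatever
  the value of the reference integral.\<close>

lemma LINT_indicator_triangle:
  assumes c: "cross2 (b - a) (c - a) > 0"
  shows "(LINT x|lborel. indicat_real (triangle a b c) x) =
    cross2 (b - a) (c - a) * (LINT (s::real, t::real)|(lborel \<Otimes>\<^sub>M lborel). of_bool (0 < s \<and> 0 < t \<and> s + t < 1))"
proof -
  have e: "(\<lambda>(s, t). indicat_real (triangle a b c) (a + s *\<^sub>R (b - a) + t *\<^sub>R (c - a))) = (\<lambda>(s, t). of_bool (0 < s \<and> 0 < t \<and> s + t < 1))"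
    using mem_triangle_iff[of b a c] c by (auto simp: fun_eq_iff indicator_def)
  have "cross2 (b - a) (c - a) \<noteq> 0" using c by simp
  from integral_affine_plane[OF this triangle_integrable[OF c], of a] show ?thesis
    unfolding e by (simp only: abs_of_pos[OF c])
qed

lemma norm_unit_coordinates:
  assumes "norm u = 1"
  shows "norm (a *\<^sub>R u + b *\<^sub>R rot u) = sqrt (a\<^sup>2 + b\<^sup>2)" "norm (a *\<^sub>R u - b *\<^sub>R rot u) = sqrt (a\<^sup>2 + b\<^sup>2)"
proof -
  have i: "u \<bullet> u = 1" "rot u \<bullet> rot u = 1" "u \<bullet> rot u = 0" "rot u \<bullet> u = 0"
    using assms norm_rot[of u] by (simp_all add: norm_eq_1 inner_rot cross2_simps cross2_rot)
  then show p: "norm (a *\<^sub>R u + b *\<^sub>R rot u) = sqrt (a\<^sup>2 + b\<^sup>2)" for b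
    by (simp add: norm_eq_sqrt_inner inner_add_left inner_add_right power2_eq_square)
  show "norm (a *\<^sub>R u - b *\<^sub>R rot u) = sqrt (a\<^sup>2 + b\<^sup>2)" using p[of "- b"] by simp
qed

text \<open>An interface between the labels \<open>i\<close> and \<open>j\<close> is counted once in
  the perimeter of each. Weighting by \<open>\<alpha>\<close> gives it the tension
  \<open>\<alpha> i + \<alpha> j\<close>.\<close>

lemma sum_abs_indicator_diff:
  fixes \<alpha> :: "nat \<Rightarrow> real"
  assumes "finite S" "i \<in> S" "j \<in> S" "i \<noteq> j"
  shows "(\<Sum>l\<in>S. \<alpha> l * \<bar>of_bool (i = l) - of_bool (j = l)\<bar>) = \<alpha> i + \<alpha> j"
proof -
  have "(\<Sum>l\<in>S. \<alpha> l * \<bar>of_bool (i = l) - of_bool (j = l)\<bar>) = (\<Sum>l\<in>S. (if i = l then \<alpha> l else 0) + (if j = l then \<alpha> l else 0))"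
    using assms(4) by (intro sum.cong) auto
  also have "\<dots> = \<alpha> i + \<alpha> j" using assms by (simp add: sum.distrib)
  finally show ?thesis .
qed

lemma small_of_linear_bound:
  fixes x C e :: real
  assumes "\<And>t. 0 < t \<Longrightarrow> t < e \<Longrightarrow> x \<le> C * t" "0 < e"
  shows "x \<le> 0"
proof (rule ccontr)
  assume "\<not> x \<le> 0"
  define t where "t = min (e / 2) (x / (2 * (\<bar>C\<bar> + 1)))"
  have t: "0 < t" "t < e" "t \<le> x / (2 * (\<bar>C\<bar> + 1))" using assms(2) \<open>\<not> x \<le> 0\<close> by (auto simp: t_def)
  have "x \<le> C * t" using assms(1) t by blast
  also have "\<dots> \<le> (\<bar>C\<bar> + 1) * t" using t by (intro mult_right_mono) auto
  also have "\<dots> \<le> (\<bar>C\<bar> + 1) * (x / (2 * (\<bar>C\<bar> + 1)))" using t by (intro mult_left_mono) auto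
  also have "\<dots> = x / 2" by (simp add: field_simps)
  finally show False using \<open>\<not> x \<le> 0\<close> by simp
qed

lemma measure_ball_indicator:
  fixes B :: "(real^2) set"
  assumes "B \<in> sets borel"
  shows "measure lebesgue (B \<inter> ball 0 r) = (LINT x|lborel. indicat_real B x * indicat_real (ball 0 r) x)"
    "integrable lborel (\<lambda>x. indicat_real B x * indicat_real (ball 0 r) x)"
proof -
  have e: "indicat_real B x * indicat_real (ball 0 r) x = indicat_real (B \<inter> ball 0 r) x" for x
    by (simp add: indicator_inter_arith)
  have "integrable lborel (indicat_real (B \<inter> ball 0 r))"
  proof (rule integrable_real_indicator)
    have "bounded (B \<inter> ball 0 r)" by auto
    then show "emeasure lborel (B \<inter> ball 0 r) < \<infinity>" by (rule emeasure_bounded_finite)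
  qed (use assms in auto)
  then show "integrable lborel (\<lambda>x. indicat_real B x * indicat_real (ball 0 r) x)" by (simp add: e)
  have "measure lebesgue (B \<inter> ball 0 r) = measure lborel (B \<inter> ball 0 r)" using assms by simp
  then show "measure lebesgue (B \<inter> ball 0 r) = (LINT x|lborel. indicat_real B x * indicat_real (ball 0 r) x)"
    by (simp add: e)
qed

text \<open>Competitors for a sector labelled \<open>j\<close> with neighbours \<open>i\<close> and \<open>k\<close>: its tip is cut along the
  segment from \<open>0\<close> to \<open>p\<close>, the triangle \<open>0, u\<^sub>1, p\<close> going to \<open>i\<close> and \<open>0, p, u\<^sub>2\<close> to \<open>k\<close>. Flat triangles of
  the same areas, erected on the segments \<open>[u\<^sub>1, 2 u\<^sub>1]\<close> and \<open>[u\<^sub>2, 2 u\<^sub>2]\<close>, give the area back to \<open>j\<close>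
  at a cost of second order only.\<close>

lemma tip_splitting_inequality:
  assumes fan: "fan m \<theta> \<Lambda> A" and m: "3 \<le> m" and V: "V_minimal \<alpha> A"
    and cone: "\<And>l. l \<le> 2 \<Longrightarrow> cone_at_origin (A l)" and \<alpha>: "\<And>l. l \<le> 2 \<Longrightarrow> 0 < \<alpha> l"
    and \<gamma>: "\<theta> 2 - \<theta> 1 < pi"
  defines "u1 \<equiv> dir (\<theta> 1)" and "u2 \<equiv> dir (\<theta> 2)"
    and "\<sigma>1 \<equiv> \<alpha> (\<Lambda> 0) + \<alpha> (\<Lambda> 1)" and "\<sigma>2 \<equiv> \<alpha> (\<Lambda> 1) + \<alpha> (\<Lambda> 2)"
    and "\<tau> \<equiv> (if \<Lambda> 0 = \<Lambda> 2 then 0 else \<alpha> (\<Lambda> 0) + \<alpha> (\<Lambda> 2))"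
  shows "\<exists>e>0. \<forall>t. 0 < t \<and> t < e \<longrightarrow>
    (let p = t *\<^sub>R (\<sigma>1 *\<^sub>R u1 + \<sigma>2 *\<^sub>R u2); h1 = t * \<sigma>2 * cross2 u1 u2; h2 = t * \<sigma>1 * cross2 u1 u2 in
     2 * \<sigma>1 + 2 * \<sigma>2 \<le> \<sigma>1 * (norm (p - u1) + 2 * sqrt (1/4 + h1\<^sup>2)) + \<sigma>2 * (norm (p - u2) + 2 * sqrt (1/4 + h2\<^sup>2)) + \<tau> * norm p)"
proof -
  define i j k where "i = \<Lambda> 0" and "j = \<Lambda> 1" and "k = \<Lambda> 2"
  have le2: "i \<le> 2" "j \<le> 2" "k \<le> 2" using fan_label_le[OF fan] by (auto simp: i_def j_def k_def)
  have ij: "i \<noteq> j" "j \<noteq> k" using fan_jump[OF fan, of 0] fan_jump[OF fan, of 1] by (auto simp: i_def j_def k_def numeral_2_eq_2)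
  have \<sigma>: "0 < \<sigma>1" "0 < \<sigma>2" using \<alpha> le2 by (auto simp: \<sigma>1_def \<sigma>2_def i_def j_def k_def intro!: add_pos_pos)
  have perm: "permissible A" using V by (simp add: V_minimal_def)
  have opA: "open (A l)" if "l \<le> 2" for l using perm that by (auto simp: permissible_def)
  define c where "c = cross2 u1 u2"
  have gap: "\<theta> n < \<theta> (Suc n)" for n by (rule fan_less[OF fan])
  have gap1: "0 < \<theta> 2 - \<theta> 1" using gap[of 1] by (simp add: numeral_2_eq_2)
  have c: "0 < c" unfolding c_def u1_def u2_def cross2_dir using gap1 \<gamma> by (intro sin_gt_zero) auto
  have nu: "norm u1 = 1" "norm u2 = 1" by (simp_all add: u1_def u2_def)
  have uu: "u1 \<bullet> u1 = 1" "u2 \<bullet> u2 = 1" using nu by (simp_all add: norm_eq_1)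
  have c21: "cross2 u2 u1 = - c" using cross2_commute[of u2 u1] by (simp add: c_def)
  define w where "w = \<sigma>1 *\<^sub>R u1 + \<sigma>2 *\<^sub>R u2"
  have cw: "cross2 u1 w = \<sigma>2 * c" "cross2 w u2 = \<sigma>1 * c" by (simp_all add: w_def cross2_simps c_def)
  \<comment> \<open>The angular room available to the flat triangles in the two neighbouring
    sectors.\<close>
  define g where "g = min 1 (min (\<theta> 1 - \<theta> 0) (\<theta> 3 - \<theta> 2))"
  have g: "0 < g" "g \<le> 1" "g \<le> \<theta> 1 - \<theta> 0" "g \<le> \<theta> 3 - \<theta> 2" using gap[of 0] gap[of 2] by (auto simp: g_def numeral_2_eq_2 numeral_3_eq_3)
  have gpi: "g < pi" using g pi_gt3 by linarith
  have sg: "0 < sin g" by (rule sin_gt_zero[OF g(1) gpi])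
  define S where "S = (\<sigma>1 + \<sigma>2) * c"
  have S: "0 < S" using \<sigma> c by (simp add: S_def)
  \<comment> \<open>The three bounds ensure \<open>norm p \<le> 1\<close>, heights below
    \<open>sin g\<close>, which keeps the flat triangles in the neighbouring sectors, and heights
    below 1/2, which keeps their apexes in the ball of radius 2.\<close>
  define E where "E = min (1 / (norm w + 1)) (min (sin g / S) (1 / (2 * S)))"
  have E: "0 < E" using sg S by (auto simp: E_def intro!: divide_pos_pos add_nonneg_pos)
  show ?thesis
  proof (intro exI[of _ E] conjI allI impI E)
    fix t assume t: "0 < t \<and> t < E"
    define p h1 h2 where "p = t *\<^sub>R w" and "h1 = t * \<sigma>2 * c" and "h2 = t * \<sigma>1 * c"
    have h: "0 < h1" "0 < h2" using t \<sigma> c by (simp_all add: h1_def h2_def)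
    have hsum: "h1 + h2 = t * S" by (simp add: h1_def h2_def S_def algebra_simps)
    have "t < sin g / S" "t < 1 / (2 * S)" "t < 1 / (norm w + 1)" using t by (auto simp: E_def)
    moreover have "0 < norm w + 1" by (simp add: add_nonneg_pos)
    ultimately have "t * S < sin g" "t * (2 * S) < 1" "t * (norm w + 1) < 1"
      using S by (simp_all add: pos_less_divide_eq)
    then have "h1 + h2 < sin g" "h1 + h2 < 1 / 2" "t * (norm w + 1) < 1"
      unfolding hsum by simp_all
    then have hs: "h1 < sin g" "h2 < sin g" "h1 < 1/2" "h2 < 1/2" and np: "norm p \<le> 1"
      using h t by (auto simp: p_def algebra_simps)
    \<comment> \<open>Apexes above the midpoints of the unit segments, on the sides away from sector
      1. The heights \<open>h1\<close> and \<open>h2\<close> equal the cross products of the two tip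
      triangles, so the areas match exactly.\<close>
    define q1 q2 where "q1 = (3/2) *\<^sub>R u1 - h1 *\<^sub>R rot u1" and "q2 = (3/2) *\<^sub>R u2 + h2 *\<^sub>R rot u2"
    define T where "T n = (if n = 0 then triangle 0 u1 p else if n = 1 then triangle 0 p u2
      else if n = 2 then triangle u1 q1 (2 *\<^sub>R u1) else triangle u2 (2 *\<^sub>R u2) q2)" for n :: nat
    \<comment> \<open>Pieces 0 and 1 are the halves of the tip and pass from \<open>j\<close> to
      \<open>i\<close> and \<open>k\<close>; pieces 2 and 3 are the flat triangles and pass from
      \<open>i\<close> and \<open>k\<close> back to \<open>j\<close>.\<close>
    define old new where "old n = (if n \<le> 1 then j else if n = 2 then i else k)" and
      "new n = (if n = 0 then i else if n = 1 then k else j)" for n :: nat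
    have q1: "q1 - u1 = (1/2) *\<^sub>R u1 - h1 *\<^sub>R rot u1" "2 *\<^sub>R u1 - q1 = (1/2) *\<^sub>R u1 + h1 *\<^sub>R rot u1" "2 *\<^sub>R u1 - u1 = u1"
      by (simp_all add: q1_def vec_eq_iff forall_2 algebra_simps)
    have q2: "q2 - u2 = (1/2) *\<^sub>R u2 + h2 *\<^sub>R rot u2" "2 *\<^sub>R u2 - q2 = (1/2) *\<^sub>R u2 - h2 *\<^sub>R rot u2" "2 *\<^sub>R u2 - u2 = u2"
      by (simp_all add: q2_def vec_eq_iff forall_2 algebra_simps)
    have cr: "cross2 (u1 - 0) (p - 0) = h1" "cross2 (p - 0) (u2 - 0) = h2"
      "cross2 (q1 - u1) (2 *\<^sub>R u1 - u1) = h1" "cross2 (2 *\<^sub>R u2 - u2) (q2 - u2) = h2"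
      unfolding q1 q2 by (simp_all add: p_def cross2_simps cw h1_def h2_def cross2_rot uu)
    have crp: "0 < cross2 (u1 - 0) (p - 0)" "0 < cross2 (p - 0) (u2 - 0)"
      "0 < cross2 (q1 - u1) (2 *\<^sub>R u1 - u1)" "0 < cross2 (2 *\<^sub>R u2 - u2) (q2 - u2)"
      unfolding cr using h by auto
    have sec1: "fan_sector \<theta> 1 = {x. 0 < cross2 u1 x \<and> 0 < cross2 x u2}"
      using sector_cross2[OF gap1 \<gamma>, of _ "\<theta> 1"] by (auto simp: u1_def u2_def numeral_2_eq_2)
    \<comment> \<open>The sign of \<open>cross2 p x\<close> tells the two sides of the cut along
      \<open>p\<close> apart, which makes pieces 0 and 1 disjoint.\<close>
    have T0: "T 0 \<subseteq> {x \<in> fan_sector \<theta> 1. cross2 p x < 0}"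
    proof
      fix x assume "x \<in> T 0"
      then obtain s r where sr: "0 < s" "0 < r" "x = s *\<^sub>R u1 + r *\<^sub>R p" by (auto simp: T_def triangle_def)
      have "cross2 u1 x = r * h1" "cross2 x u2 = s * c + r * h2" "cross2 p x = - (s * h1)"
        using cr cross2_commute[of p u1] by (simp_all add: sr(3) cross2_simps c_def)
      then show "x \<in> {x \<in> fan_sector \<theta> 1. cross2 p x < 0}" unfolding sec1 using sr(1,2) h c by (simp add: add_pos_pos)
    qed
    have T1: "T 1 \<subseteq> {x \<in> fan_sector \<theta> 1. 0 < cross2 p x}"
    proof
      fix x assume "x \<in> T 1"
      then obtain s r where sr: "0 < s" "0 < r" "x = s *\<^sub>R p + r *\<^sub>R u2" by (auto simp: T_def triangle_def)
      have "cross2 u1 x = s * h1 + r * c" "cross2 x u2 = s * h2" "cross2 p x = r * h2"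
        using cr by (simp_all add: sr(3) cross2_simps c_def)
      then show "x \<in> {x \<in> fan_sector \<theta> 1. 0 < cross2 p x}" unfolding sec1 using sr(1,2) h c by (simp add: add_pos_pos)
    qed
    have small: "0 < A * sin g - B * cos g" if "1 \<le> A" "0 \<le> B" "B < sin g" for A B
    proof -
      have "B * cos g \<le> B * 1" using that by (intro mult_left_mono) auto
      moreover have "1 * sin g \<le> A * sin g" using that sg by (intro mult_right_mono) auto
      ultimately show ?thesis using that by linarith
    qed
    have T2: "T 2 \<subseteq> fan_sector \<theta> 0"
    proof
      fix x assume "x \<in> T 2"
      then obtain s r where sr: "0 < s" "0 < r" "s + r < 1" "x = u1 + s *\<^sub>R (q1 - u1) + r *\<^sub>R (2 *\<^sub>R u1 - u1)" by (auto simp: T_def triangle_def)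
      then have x: "x = (1 + s / 2 + r) *\<^sub>R u1 - (s * h1) *\<^sub>R rot u1"
        unfolding q1 by (simp add: vec_eq_iff forall_2 algebra_simps)
      have "s * h1 \<le> 1 * h1" using sr h by (intro mult_right_mono) auto
      then have "s * h1 < sin g" using hs by simp
      have "cross2 (dir (\<theta> 1 - g)) x = (1 + s / 2 + r) * sin g - (s * h1) * cos g"
        by (simp add: x cross2_simps u1_def cross2_dir cross2_rot inner_dir)
      moreover have "cross2 x (dir (\<theta> 1 - g + g)) = s * h1"
        by (simp add: x cross2_simps cross2_rot u1_def cross2_dir inner_dir)
      ultimately have "x \<in> sector (\<theta> 1 - g) g"
        using sector_cross2[OF g(1) gpi, of x "\<theta> 1 - g"] small[of "1 + s / 2 + r" "s * h1"] \<open>s * h1 < sin g\<close> sr h by simp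
      moreover have "sector (\<theta> 1 - g) g \<subseteq> fan_sector \<theta> 0" using g by (intro sector_mono) auto
      ultimately show "x \<in> fan_sector \<theta> 0" by blast
    qed
    have T3: "T 3 \<subseteq> fan_sector \<theta> 2"
    proof
      fix x assume "x \<in> T 3"
      then obtain s r where sr: "0 < s" "0 < r" "s + r < 1" "x = u2 + s *\<^sub>R (2 *\<^sub>R u2 - u2) + r *\<^sub>R (q2 - u2)" by (auto simp: T_def triangle_def)
      then have x: "x = (1 + s + r / 2) *\<^sub>R u2 + (r * h2) *\<^sub>R rot u2"
        unfolding q2 by (simp add: vec_eq_iff forall_2 algebra_simps)
      have "r * h2 \<le> 1 * h2" using sr h by (intro mult_right_mono) auto
      then have "r * h2 < sin g" using hs by simp
      have "cross2 x (dir (\<theta> 2 + g)) = (1 + s + r / 2) * sin g - (r * h2) * cos g"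
        by (simp add: x cross2_simps u2_def cross2_dir cross2_rot inner_dir)
      moreover have "cross2 (dir (\<theta> 2)) x = r * h2"
        by (simp add: x cross2_simps cross2_rot u2_def cross2_dir inner_dir)
      ultimately have "x \<in> sector (\<theta> 2) g"
        using sector_cross2[OF g(1) gpi, of x "\<theta> 2"] small[of "1 + s + r / 2" "r * h2"] \<open>r * h2 < sin g\<close> sr h by simp
      moreover have "sector (\<theta> 2) g \<subseteq> fan_sector \<theta> 2" using g by (intro sector_mono) (auto simp: numeral_3_eq_3 numeral_2_eq_2)
      ultimately show "x \<in> fan_sector \<theta> 2" by blast
    qed
    let ?I = "{0, 1, 2, 3 :: nat}"
    have d: "fan_sector \<theta> 0 \<inter> fan_sector \<theta> 1 = {}" "fan_sector \<theta> 1 \<inter> fan_sector \<theta> 2 = {}" "fan_sector \<theta> 0 \<inter> fan_sector \<theta> 2 = {}"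
      using fan_sector_disjoint[OF fan, of 0 1] fan_sector_disjoint[OF fan, of 1 2] fan_sector_disjoint[OF fan, of 0 2] m by auto
    have Tdis: "disjoint_family_on T ?I"
    proof -
      have "T 0 \<inter> T 1 = {}" using T0 T1 by fastforce
      moreover have "T 0 \<inter> T 2 = {}" "T 1 \<inter> T 2 = {}" "T 0 \<inter> T 3 = {}" "T 1 \<inter> T 3 = {}" "T 2 \<inter> T 3 = {}"
        using T0 T1 T2 T3 d by blast+
      ultimately show ?thesis by (auto simp: disjoint_family_on_def Int_commute)
    qed
    have Told: "T n \<subseteq> A (old n)" if "n \<in> ?I" for n
      using that T0 T1 T2 T3 fan_sector_subset[OF fan, of 0] fan_sector_subset[OF fan, of 1] fan_sector_subset[OF fan, of 2]
      by (auto simp: old_def i_def j_def k_def)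
    have oT: "open (T n)" if "n \<in> ?I" for n using crp open_triangle that by (auto simp: T_def)
    have fT: "AE x in lborel. x \<notin> frontier (T n)" for n by (simp add: T_def triangle_frontier_null)
    define C where "C n = (if n = 0 then norm (u1 - 0) + norm (p - u1) + norm (0 - p)
      else if n = 1 then norm (p - 0) + norm (u2 - p) + norm (0 - u2)
      else if n = 2 then norm (q1 - u1) + norm (2 *\<^sub>R u1 - q1) + norm (u1 - 2 *\<^sub>R u1)
      else norm (2 *\<^sub>R u2 - u2) + norm (q2 - 2 *\<^sub>R u2) + norm (u2 - q2))" for n :: nat
    have bT: "\<bar>LINT x|lborel. indicat_real (T n) x * divergence \<phi> x\<bar> \<le> C n" if n: "n \<in> ?I" and \<phi>: "\<phi> \<in> test_fields U" for n U \<phi>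
      using triangle_divergence_bound[OF \<phi> crp(1)] triangle_divergence_bound[OF \<phi> crp(2)]
        triangle_divergence_bound[OF \<phi> crp(3)] triangle_divergence_bound[OF \<phi> crp(4)]
      unfolding T_def C_def by presburger
    have old2: "old n \<le> 2" and new2: "new n \<le> 2" for n using le2 by (auto simp: old_def new_def)
    have nullA: "AE x in lborel. x \<notin> frontier (A l)" if "l \<le> 2" for l
      by (rule fan_frontier_null[OF fan opA that])
    have finI: "finite ?I" by simp
    define B where "B = relabelled A T ?I new"
    have B1: "permissible B"
      unfolding B_def
      by (rule relabelled_props(1)[where old=old and C=C])
        (rule perm finI fT Tdis old2 new2 | erule nullA oT Told | erule (1) bT)+
    have B2: "spt (\<lambda>x. indicat_real (A l) x - indicat_real (B l) x) \<subseteq> (\<Union>n\<in>?I. closure (T n))" if "l \<le> 2" for l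
      unfolding B_def
      by (rule relabelled_props(2)[where old=old and C=C, OF _ _ _ _ _ _ _ _ _ _ that])
        (rule perm finI fT Tdis old2 new2 | erule nullA oT Told | erule (1) bT)+
    have B3: "AE x in lborel. indicat_real (B l) x = indicat_real (A l) x +
      (\<Sum>n\<in>?I. (of_bool (new n = l) - of_bool (old n = l)) * indicat_real (T n) x)" if "l \<le> 2" for l
      unfolding B_def
      by (rule relabelled_props(3)[where old=old and C=C, OF _ _ _ _ _ _ _ _ _ _ that])
        (rule perm finI fT Tdis old2 new2 | erule nullA oT Told | erule (1) bT)+
    have Ab: "A l \<in> sets borel" if "l \<le> 2" for l using opA[OF that] by auto
    have Bb: "B l \<in> sets borel" if "l \<le> 2" for l using B1 that by (auto simp: permissible_def)
    have Tb: "T n \<in> sets borel" if "n \<in> ?I" for n using oT[OF that] by auto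
    \<comment> \<open>\<open>s1 l\<close> and \<open>s2 l\<close> are the changes of the indicator
      of label \<open>l\<close> on pieces 0 and 1. On pieces 2 and 3 the changes are their
      negatives, so the areas cancel in pairs.\<close>
    define s1 where "s1 l = of_bool (i = l) - (of_bool (j = l) :: real)" for l
    define s2 where "s2 l = of_bool (k = l) - (of_bool (j = l) :: real)" for l
    define J where "J n g = (LINT x|lborel. indicat_real (T n) x * g x)" for n and g :: "real^2 \<Rightarrow> real"
    have lin: "(LINT x|lborel. indicat_real (B l) x * f x) = (LINT x|lborel. indicat_real (A l) x * f x)
        + s1 l * (J 0 f - J 2 f) + s2 l * (J 1 f - J 3 f)" if l: "l \<le> 2" and f: "integrable lborel f" for l f
    proof -
      have int: "integrable lborel (\<lambda>x. indicat_real S x * f x)" if "S \<in> sets borel" for S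
        using integrable_mult_indicator[OF _ f, of S] that by simp
      have iT: "integrable lborel (\<lambda>x. a * (indicat_real (T n) x * f x))" if "n \<in> ?I" for n a
        by (intro integrable_mult_right int Tb[OF that])
      have "(LINT x|lborel. indicat_real (B l) x * f x) = (LINT x|lborel. indicat_real (A l) x * f x +
         (s1 l * (indicat_real (T 0) x * f x) + (s2 l * (indicat_real (T 1) x * f x) +
          ((- s1 l) * (indicat_real (T 2) x * f x) + (- s2 l) * (indicat_real (T 3) x * f x)))))"
      proof (rule integral_cong_AE)
        show "AE x in lborel. indicat_real (B l) x * f x = indicat_real (A l) x * f x +
         (s1 l * (indicat_real (T 0) x * f x) + (s2 l * (indicat_real (T 1) x * f x) +
          ((- s1 l) * (indicat_real (T 2) x * f x) + (- s2 l) * (indicat_real (T 3) x * f x))))"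
          using B3[OF l]
        proof eventually_elim
          case (elim x)
          show ?case unfolding elim by (simp add: old_def new_def s1_def s2_def algebra_simps)
        qed
        show "(\<lambda>x. indicat_real (B l) x * f x) \<in> borel_measurable lborel"
          by (rule borel_measurable_integrable[OF int[OF Bb[OF l]]])
        show "(\<lambda>x. indicat_real (A l) x * f x +
         (s1 l * (indicat_real (T 0) x * f x) + (s2 l * (indicat_real (T 1) x * f x) +
          ((- s1 l) * (indicat_real (T 2) x * f x) + (- s2 l) * (indicat_real (T 3) x * f x))))) \<in> borel_measurable lborel"
          by (intro borel_measurable_add borel_measurable_integrable iT int Ab l) auto
      qed
      also have "\<dots> = (LINT x|lborel. indicat_real (A l) x * f x) +
         (s1 l * J 0 f + (s2 l * J 1 f + ((- s1 l) * J 2 f + (- s2 l) * J 3 f)))"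
        unfolding J_def integral_mult_right_zero[symmetric]
        by (simp only: Bochner_Integration.integral_add Bochner_Integration.integrable_add iT int Ab[OF l] insertI1 insertI2)
      finally show ?thesis by (simp add: algebra_simps)
    qed
    have sub: "closure (T n) \<subseteq> ball 0 3" if n: "n \<in> ?I" for n
    proof -
      have nq: "norm q1 \<le> 2" "norm q2 \<le> 2"
        using norm_triangle_ineq4[of "(3/2) *\<^sub>R u1" "h1 *\<^sub>R rot u1"] norm_triangle_ineq[of "(3/2) *\<^sub>R u2" "h2 *\<^sub>R rot u2"] hs h nu
        by (simp_all add: q1_def q2_def)
      have "closure (T n) \<subseteq> cball 0 2"
        using n nq nu np by (elim insertE emptyE) (simp_all add: T_def triangle_norm_le)
      then show ?thesis by auto
    qed
    \<comment> \<open>All pieces lie within distance 2 of the origin, so their closures are inside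
      this open ball.\<close>
    define U where "U = ball (0 :: real^2) 3"
    have U: "open U" "bounded U" by (auto simp: U_def)
    have "measure lebesgue (B l \<inter> U) = measure lebesgue (A l \<inter> U)" if l: "l \<le> 2" for l
    proof -
      let ?f = "indicat_real U"
      have "integrable lborel ?f"
        unfolding U_def by (intro integrable_real_indicator emeasure_bounded_finite) auto
      note L = lin[OF l this]
      have JT: "J n ?f = (LINT x|lborel. indicat_real (T n) x)" if "n \<in> ?I" for n
      proof -
        have "T n \<subseteq> U" using sub[OF that] closure_subset by (auto simp: U_def)
        then have "(\<lambda>x. indicat_real (T n) x * ?f x) = indicat_real (T n)" by (auto simp: indicator_def fun_eq_iff)
        then show ?thesis unfolding J_def by (simp only:)
      qed
      have JT': "J 0 ?f = (LINT x|lborel. indicat_real (T 0) x)" "J 1 ?f = (LINT x|lborel. indicat_real (T 1) x)"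
        "J 2 ?f = (LINT x|lborel. indicat_real (T 2) x)" "J 3 ?f = (LINT x|lborel. indicat_real (T 3) x)"
        by (rule JT; simp)+
      have "J 0 ?f = J 2 ?f" "J 1 ?f = J 3 ?f"
        unfolding JT' T_def using LINT_indicator_triangle[OF crp(1)] LINT_indicator_triangle[OF crp(2)]
          LINT_indicator_triangle[OF crp(3)] LINT_indicator_triangle[OF crp(4)] cr
        by simp_all
      then show ?thesis
        using L by (simp add: U_def measure_ball_indicator(1)[OF Ab[OF l]] measure_ball_indicator(1)[OF Bb[OF l]])
    qed
    then have "\<forall>l\<le>2. measure lebesgue (B l \<inter> U) = measure lebesgue (A l \<inter> U)" by blast
    moreover have "(\<Union>n\<in>?I. closure (T n)) \<subseteq> U"
      unfolding U_def by (rule UN_least) (rule sub)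
    then have "competitor A U B"
      unfolding competitor_def using B1 B2 by (meson order_trans)
    ultimately have min: "surface_energy \<alpha> A U \<le> surface_energy \<alpha> B U"
      using V U unfolding V_minimal_def by meson
    define d where "d l n = of_bool (\<Lambda> (Suc n) = l) - (of_bool (\<Lambda> n = l) :: real)" for l n
    \<comment> \<open>Contribution of the rays other than \<open>u1\<close> and \<open>u2\<close>.
      The competitor does not touch them, and they cancel in the final inequality.\<close>
    define rest where "rest l = (\<Sum>n\<in>{2..<m}. \<bar>d l n\<bar>)" for l
    have split: "sum f {..<m} = f 0 + f 1 + sum f {2..<m}" for f :: "nat \<Rightarrow> real"
      using m by (simp add: lessThan_atLeast0 sum.atLeast_Suc_lessThan numeral_2_eq_2)
    have d01: "d l 0 = - s1 l" "d l 1 = s2 l" for l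
      by (simp_all add: d_def s1_def s2_def i_def j_def k_def numeral_2_eq_2)
    \<comment> \<open>Lengths that replace the original 3 on each ray: the untouched last unit, the
      edge from \<open>p\<close>, and the two equal sides of the flat triangle.\<close>
    define X1 X2 where "X1 = 1 + norm (p - u1) + 2 * sqrt (1/4 + h1\<^sup>2)" and "X2 = 1 + norm (p - u2) + 2 * sqrt (1/4 + h2\<^sup>2)"
    have lowA: "ereal (3 * (\<bar>s1 l\<bar> + \<bar>s2 l\<bar> + rest l)) \<le> perimeter (A l) U" if l: "l \<le> 2" for l
    proof -
      have "(\<Sum>n<m. \<bar>d l n\<bar>) = \<bar>s1 l\<bar> + \<bar>s2 l\<bar> + rest l"
        unfolding split d01 rest_def by simp
      then show ?thesis using fan_perimeter_ge[OF fan l opA[OF l] cone[OF l], of 3] by (simp add: U_def d_def)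
    qed
    have upB: "perimeter (B l) U \<le> ereal (3 * rest l + \<bar>s1 l\<bar> * X1 + \<bar>s2 l\<bar> * X2 + \<bar>of_bool (i = l) - of_bool (k = l)\<bar> * norm p)"
      if l: "l \<le> 2" for l
    proof (rule perimeter_least)
      fix \<phi> :: "real^2 \<Rightarrow> real^2" assume \<phi>U: "\<phi> \<in> test_fields U"
      then have \<phi>: "\<phi> \<in> test_fields (ball 0 3)" by (simp add: U_def)
      let ?F = "flux \<phi>"
      have Fb: "\<bar>?F a b\<bar> \<le> norm (b - a)" for a b
        by (rule flux_bound[OF test_fieldsD(7,5)[OF \<phi>]])
      \<comment> \<open>Splitting at \<open>u\<close> and \<open>2 *\<^sub>R u\<close> isolates the
        two unit segments that are also edges of the pieces.\<close>
      have F3: "?F 0 (3 *\<^sub>R u) = ?F 0 u + ?F u (2 *\<^sub>R u) + ?F (2 *\<^sub>R u) (3 *\<^sub>R u)" for u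
        using flux_split[OF test_fieldsD(7)[OF \<phi>], of 1 2 0 u] flux_split[OF test_fieldsD(7)[OF \<phi>], of 2 3 0 u] by simp
      define R where "R = (\<Sum>n\<in>{2..<m}. d l n * ?F 0 (3 *\<^sub>R dir (\<theta> (Suc n))))"
      have "R \<le> (\<Sum>n\<in>{2..<m}. \<bar>d l n\<bar> * 3)"
        unfolding R_def
      proof (rule sum_mono)
        fix n
        have "d l n * ?F 0 (3 *\<^sub>R dir (\<theta> (Suc n))) \<le> \<bar>d l n\<bar> * \<bar>?F 0 (3 *\<^sub>R dir (\<theta> (Suc n)))\<bar>"
          by (simp flip: abs_mult)
        also have "\<dots> \<le> \<bar>d l n\<bar> * 3"
          using Fb[of 0 "3 *\<^sub>R dir (\<theta> (Suc n))"] by (intro mult_left_mono) auto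
        finally show "d l n * ?F 0 (3 *\<^sub>R dir (\<theta> (Suc n))) \<le> \<bar>d l n\<bar> * 3" .
      qed
      then have R: "R \<le> 3 * rest l" by (simp add: rest_def sum_distrib_right mult.commute flip: sum_distrib_left)
      have IA: "(LINT x|lborel. indicat_real (A l) x * divergence \<phi> x) = - s1 l * ?F 0 (3 *\<^sub>R u1) + s2 l * ?F 0 (3 *\<^sub>R u2) + R"
        using fan_divergence[OF fan l \<phi>, unfolded d_def[symmetric]] unfolding split d01 R_def
        by (simp add: u1_def u2_def numeral_2_eq_2)
      have JJ: "J 0 (divergence \<phi>) = ?F 0 u1 + ?F u1 p + ?F p 0" "J 1 (divergence \<phi>) = ?F 0 p + ?F p u2 + ?F u2 0"
        "J 2 (divergence \<phi>) = ?F u1 q1 + ?F q1 (2 *\<^sub>R u1) + ?F (2 *\<^sub>R u1) u1"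
        "J 3 (divergence \<phi>) = ?F u2 (2 *\<^sub>R u2) + ?F (2 *\<^sub>R u2) q2 + ?F q2 u2"
        using triangle_divergence[OF \<phi> crp(1)] triangle_divergence[OF \<phi> crp(2)] triangle_divergence[OF \<phi> crp(3)] triangle_divergence[OF \<phi> crp(4)]
        by (simp_all add: J_def T_def)
      \<comment> \<open>The fluxes left on the new interfaces between \<open>i\<close> and
        \<open>j\<close> and between \<open>j\<close> and \<open>k\<close>.\<close>
      define Y1 Y2 where "Y1 = - ?F (2 *\<^sub>R u1) (3 *\<^sub>R u1) + ?F u1 p - ?F u1 q1 - ?F q1 (2 *\<^sub>R u1)"
        and "Y2 = ?F (2 *\<^sub>R u2) (3 *\<^sub>R u2) + ?F p u2 - ?F (2 *\<^sub>R u2) q2 - ?F q2 u2"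
      have rev: "?F p 0 = - ?F 0 p" "?F u2 0 = - ?F 0 u2" "?F (2 *\<^sub>R u1) u1 = - ?F u1 (2 *\<^sub>R u1)"
        by (rule flux_reverse)+
      have "(LINT x:B l|lebesgue. divergence \<phi> x) = (LINT x|lborel. indicat_real (B l) x * divergence \<phi> x)"
        by (rule set_integral_lebesgue_divergence[OF \<phi> Bb[OF l]])
      \<comment> \<open>The fluxes along the old segments up to \<open>2 *\<^sub>R u1\<close> and
        \<open>2 *\<^sub>R u2\<close> cancel. On the segment to \<open>p\<close> the weight
        \<open>s2 l - s1 l\<close> no longer involves \<open>j\<close>: only \<open>i\<close> and
        \<open>k\<close> meet there, and nothing remains if they coincide.\<close>
      also have "\<dots> = R + s1 l * Y1 + s2 l * Y2 + (s2 l - s1 l) * ?F 0 p"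
        unfolding lin[OF l integrable_divergence[OF \<phi>]] IA JJ F3 rev Y1_def Y2_def by (simp add: algebra_simps)
      also have "\<dots> \<le> 3 * rest l + \<bar>s1 l\<bar> * X1 + \<bar>s2 l\<bar> * X2 + \<bar>of_bool (i = l) - of_bool (k = l)\<bar> * norm p"
      proof (intro add_mono R)
        have nn: "norm (q1 - u1) = sqrt (1/4 + h1\<^sup>2)" "norm (2 *\<^sub>R u1 - q1) = sqrt (1/4 + h1\<^sup>2)"
          "norm (q2 - u2) = sqrt (1/4 + h2\<^sup>2)" "norm (2 *\<^sub>R u2 - q2) = sqrt (1/4 + h2\<^sup>2)"
          unfolding q1 q2 using norm_unit_coordinates[OF nu(1), of "1/2" h1] norm_unit_coordinates[OF nu(2), of "1/2" h2]
          by (simp_all add: power_divide)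
        have n1: "norm (3 *\<^sub>R u - 2 *\<^sub>R u) = norm u" for u :: "real^2"
          by (simp flip: scaleR_left_diff_distrib)
        have "\<bar>Y1\<bar> \<le> X1"
          using Fb[of "2 *\<^sub>R u1" "3 *\<^sub>R u1"] Fb[of u1 p] Fb[of u1 q1] Fb[of q1 "2 *\<^sub>R u1"]
          unfolding Y1_def X1_def nn n1 nu by linarith
        then have "\<bar>s1 l\<bar> * \<bar>Y1\<bar> \<le> \<bar>s1 l\<bar> * X1" by (intro mult_left_mono) auto
        then show "s1 l * Y1 \<le> \<bar>s1 l\<bar> * X1" using abs_ge_self[of "s1 l * Y1"] by (simp add: abs_mult)
        have "\<bar>Y2\<bar> \<le> X2"
          using Fb[of "2 *\<^sub>R u2" "3 *\<^sub>R u2"] Fb[of p u2] Fb[of "2 *\<^sub>R u2" q2] Fb[of q2 u2] nn n1[of u2] nu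
            norm_minus_commute[of p u2] norm_minus_commute[of q2 u2] norm_minus_commute[of q2 "2 *\<^sub>R u2"]
          unfolding Y2_def X2_def by linarith
        then have "\<bar>s2 l\<bar> * \<bar>Y2\<bar> \<le> \<bar>s2 l\<bar> * X2" by (intro mult_left_mono) auto
        then show "s2 l * Y2 \<le> \<bar>s2 l\<bar> * X2" using abs_ge_self[of "s2 l * Y2"] by (simp add: abs_mult)
        have "\<bar>s2 l - s1 l\<bar> * \<bar>?F 0 p\<bar> \<le> \<bar>s2 l - s1 l\<bar> * norm p" using Fb[of 0 p] by (intro mult_left_mono) auto
        then have "(s2 l - s1 l) * ?F 0 p \<le> \<bar>s2 l - s1 l\<bar> * norm p"
          using abs_ge_self[of "(s2 l - s1 l) * ?F 0 p"] by (simp add: abs_mult)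
        moreover have "\<bar>s2 l - s1 l\<bar> = \<bar>of_bool (i = l) - of_bool (k = l)\<bar>" by (simp add: s1_def s2_def abs_minus_commute)
        ultimately show "(s2 l - s1 l) * ?F 0 p \<le> \<bar>of_bool (i = l) - of_bool (k = l)\<bar> * norm p" by simp
      qed
      finally show "(LINT x:B l|lebesgue. divergence \<phi> x) \<le> 3 * rest l + \<bar>s1 l\<bar> * X1 + \<bar>s2 l\<bar> * X2 + \<bar>of_bool (i = l) - of_bool (k = l)\<bar> * norm p" .
    qed
    have "ereal (\<Sum>l\<le>2. \<alpha> l * (3 * (\<bar>s1 l\<bar> + \<bar>s2 l\<bar> + rest l))) \<le> surface_energy \<alpha> A U"
      unfolding surface_energy_def sum_ereal[symmetric] times_ereal.simps(1)[symmetric]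
      using \<alpha> lowA by (intro sum_mono ereal_mult_left_mono) (auto simp: less_imp_le)
    also note min
    also have "surface_energy \<alpha> B U \<le> ereal (\<Sum>l\<le>2. \<alpha> l * (3 * rest l + \<bar>s1 l\<bar> * X1 + \<bar>s2 l\<bar> * X2 + \<bar>of_bool (i = l) - of_bool (k = l)\<bar> * norm p))"
      unfolding surface_energy_def sum_ereal[symmetric] times_ereal.simps(1)[symmetric]
      using \<alpha> upB by (intro sum_mono ereal_mult_left_mono) (auto simp: less_imp_le)
    finally have ineq: "(\<Sum>l\<le>2. \<alpha> l * (3 * (\<bar>s1 l\<bar> + \<bar>s2 l\<bar> + rest l)))
      \<le> (\<Sum>l\<le>2. \<alpha> l * (3 * rest l + \<bar>s1 l\<bar> * X1 + \<bar>s2 l\<bar> * X2 + \<bar>of_bool (i = l) - of_bool (k = l)\<bar> * norm p))"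
      by simp
    have S1: "(\<Sum>l\<le>2. \<alpha> l * \<bar>s1 l\<bar>) = \<sigma>1"
      unfolding s1_def \<sigma>1_def i_def[symmetric] j_def[symmetric] using le2 ij by (intro sum_abs_indicator_diff) auto
    have S2: "(\<Sum>l\<le>2. \<alpha> l * \<bar>s2 l\<bar>) = \<sigma>2"
      unfolding s2_def \<sigma>2_def j_def[symmetric] k_def[symmetric] using le2 ij
      by (subst sum_abs_indicator_diff) auto
    have S3: "(\<Sum>l\<le>2. \<alpha> l * \<bar>of_bool (i = l) - of_bool (k = l)\<bar>) = \<tau>"
      unfolding \<tau>_def i_def[symmetric] k_def[symmetric] using le2 by (cases "i = k") (auto simp: sum_abs_indicator_diff)
    have "(\<Sum>l\<le>2. \<alpha> l * (3 * (\<bar>s1 l\<bar> + \<bar>s2 l\<bar> + rest l)))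
       = 3 * (\<Sum>l\<le>2. \<alpha> l * \<bar>s1 l\<bar>) + 3 * (\<Sum>l\<le>2. \<alpha> l * \<bar>s2 l\<bar>) + 3 * (\<Sum>l\<le>2. \<alpha> l * rest l)"
      unfolding sum_distrib_left sum.distrib[symmetric] by (rule sum.cong) (auto simp: algebra_simps)
    moreover have "(\<Sum>l\<le>2. \<alpha> l * (3 * rest l + \<bar>s1 l\<bar> * X1 + \<bar>s2 l\<bar> * X2 + \<bar>of_bool (i = l) - of_bool (k = l)\<bar> * norm p))
       = 3 * (\<Sum>l\<le>2. \<alpha> l * rest l) + X1 * (\<Sum>l\<le>2. \<alpha> l * \<bar>s1 l\<bar>) + X2 * (\<Sum>l\<le>2. \<alpha> l * \<bar>s2 l\<bar>)
         + norm p * (\<Sum>l\<le>2. \<alpha> l * \<bar>of_bool (i = l) - of_bool (k = l)\<bar>)"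
      unfolding sum_distrib_left sum.distrib[symmetric] by (rule sum.cong) (auto simp: algebra_simps)
    ultimately have "3 * \<sigma>1 + 3 * \<sigma>2 \<le> X1 * \<sigma>1 + X2 * \<sigma>2 + norm p * \<tau>"
      using ineq unfolding S1 S2 S3 by linarith
    then have "2 * \<sigma>1 + 2 * \<sigma>2 \<le> \<sigma>1 * (norm (p - u1) + 2 * sqrt (1/4 + h1\<^sup>2)) + \<sigma>2 * (norm (p - u2) + 2 * sqrt (1/4 + h2\<^sup>2)) + \<tau> * norm p"
      unfolding X1_def X2_def by (simp add: algebra_simps)
    then show "let p = t *\<^sub>R (\<sigma>1 *\<^sub>R u1 + \<sigma>2 *\<^sub>R u2); h1 = t * \<sigma>2 * cross2 u1 u2; h2 = t * \<sigma>1 * cross2 u1 u2 in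
     2 * \<sigma>1 + 2 * \<sigma>2 \<le> \<sigma>1 * (norm (p - u1) + 2 * sqrt (1/4 + h1\<^sup>2)) + \<sigma>2 * (norm (p - u2) + 2 * sqrt (1/4 + h2\<^sup>2)) + \<tau> * norm p"
      unfolding Let_def p_def h1_def h2_def w_def c_def .
  qed
qed

section \<open>The angle condition\<close>

text \<open>The first-order part of the preceding inequality: after expansion and division by
  \<open>t\<close> it reads \<open>(norm w)\<^sup>2 - \<tau> * norm w \<le> K * t\<close>, and
  \<open>t\<close> tends to 0.\<close>

lemma tip_splitting:
  assumes fan: "fan m \<theta> \<Lambda> A" and m: "3 \<le> m" and V: "V_minimal \<alpha> A"
    and cone: "\<And>l. l \<le> 2 \<Longrightarrow> cone_at_origin (A l)" and \<alpha>: "\<And>l. l \<le> 2 \<Longrightarrow> 0 < \<alpha> l"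
    and \<gamma>: "\<theta> 2 - \<theta> 1 < pi"
  shows "norm ((\<alpha> (\<Lambda> 0) + \<alpha> (\<Lambda> 1)) *\<^sub>R dir (\<theta> 1) + (\<alpha> (\<Lambda> 1) + \<alpha> (\<Lambda> 2)) *\<^sub>R dir (\<theta> 2))
    \<le> (if \<Lambda> 0 = \<Lambda> 2 then 0 else \<alpha> (\<Lambda> 0) + \<alpha> (\<Lambda> 2))"
proof -
  define u1 u2 where "u1 = dir (\<theta> 1)" and "u2 = dir (\<theta> 2)"
  define \<sigma>1 \<sigma>2 \<tau> where "\<sigma>1 = \<alpha> (\<Lambda> 0) + \<alpha> (\<Lambda> 1)" and "\<sigma>2 = \<alpha> (\<Lambda> 1) + \<alpha> (\<Lambda> 2)"
    and "\<tau> = (if \<Lambda> 0 = \<Lambda> 2 then 0 else \<alpha> (\<Lambda> 0) + \<alpha> (\<Lambda> 2))"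
  define w c where "w = \<sigma>1 *\<^sub>R u1 + \<sigma>2 *\<^sub>R u2" and "c = cross2 u1 u2"
  have pos: "0 < \<alpha> (\<Lambda> n)" for n using \<alpha> fan_label_le[OF fan] by blast
  have \<sigma>: "0 < \<sigma>1" "0 < \<sigma>2" "0 \<le> \<tau>"
    using pos[of 0] pos[of 1] pos[of 2] by (auto simp: \<sigma>1_def \<sigma>2_def \<tau>_def)
  obtain e where e: "0 < e" and ineq: "\<And>t. 0 < t \<Longrightarrow> t < e \<Longrightarrow>
     2 * \<sigma>1 + 2 * \<sigma>2 \<le> \<sigma>1 * (norm (t *\<^sub>R w - u1) + 2 * sqrt (1/4 + (t * \<sigma>2 * c)\<^sup>2))
       + \<sigma>2 * (norm (t *\<^sub>R w - u2) + 2 * sqrt (1/4 + (t * \<sigma>1 * c)\<^sup>2)) + \<tau> * norm (t *\<^sub>R w)"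
    using tip_splitting_inequality[OF fan m V cone \<alpha> \<gamma>] unfolding Let_def
    unfolding u1_def[symmetric] u2_def[symmetric] \<sigma>1_def[symmetric] \<sigma>2_def[symmetric] \<tau>_def[symmetric] w_def[symmetric] c_def[symmetric]
    by blast
  define K where "K = (\<sigma>1 + \<sigma>2) * (norm w)\<^sup>2 / 2 + 2 * \<sigma>1 * (\<sigma>2 * c)\<^sup>2 + 2 * \<sigma>2 * (\<sigma>1 * c)\<^sup>2"
  \<comment> \<open>This bound, exact at \<open>x = 1\<close>, linearises every norm and square root
    at its value for \<open>t = 0\<close> and leaves an explicit second-order error, collected in
    \<open>K\<close>.\<close>
  have am: "x \<le> (1 + x\<^sup>2) / 2" for x :: real
    using zero_le_power2[of "x - 1"] by (simp add: power2_eq_square algebra_simps)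
  have n: "norm (t *\<^sub>R w - u) \<le> 1 - t * (u \<bullet> w) + t\<^sup>2 * (norm w)\<^sup>2 / 2" if "norm u = 1" for t u
  proof -
    have "(norm (t *\<^sub>R w - u))\<^sup>2 = t\<^sup>2 * (norm w)\<^sup>2 - 2 * (t * (u \<bullet> w)) + 1"
      using that unfolding power2_norm_eq_inner
      by (simp add: inner_diff_left inner_diff_right inner_commute power2_eq_square norm_eq_1)
    then show ?thesis using am[of "norm (t *\<^sub>R w - u)"] by simp
  qed
  have s: "2 * sqrt (1/4 + h\<^sup>2) \<le> 1 + 2 * h\<^sup>2" for h
  proof -
    have "(2 * sqrt (1/4 + h\<^sup>2))\<^sup>2 = 1 + 4 * h\<^sup>2" by (simp add: power_mult_distrib)
    then show ?thesis using am[of "2 * sqrt (1/4 + h\<^sup>2)"] by simp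
  qed
  \<comment> \<open>The first-order gain in direction \<open>w\<close>; it is a full square because
    \<open>w\<close> is minus the gradient of the weighted distances.\<close>
  have ww: "\<sigma>1 * (u1 \<bullet> w) + \<sigma>2 * (u2 \<bullet> w) = (norm w)\<^sup>2"
    unfolding power2_norm_eq_inner by (subst (3) w_def) (simp add: inner_add_left)
  have "(norm w)\<^sup>2 - \<tau> * norm w \<le> K * t" if t: "0 < t" "t < e" for t
  proof -
    have "\<sigma>1 * (norm (t *\<^sub>R w - u1) + 2 * sqrt (1/4 + (t * \<sigma>2 * c)\<^sup>2))
      \<le> \<sigma>1 * ((1 - t * (u1 \<bullet> w) + t\<^sup>2 * (norm w)\<^sup>2 / 2) + (1 + 2 * (t * \<sigma>2 * c)\<^sup>2))"
      using \<sigma> by (intro mult_left_mono add_mono n s) (auto simp: u1_def)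
    moreover have "\<sigma>2 * (norm (t *\<^sub>R w - u2) + 2 * sqrt (1/4 + (t * \<sigma>1 * c)\<^sup>2))
      \<le> \<sigma>2 * ((1 - t * (u2 \<bullet> w) + t\<^sup>2 * (norm w)\<^sup>2 / 2) + (1 + 2 * (t * \<sigma>1 * c)\<^sup>2))"
      using \<sigma> by (intro mult_left_mono add_mono n s) (auto simp: u2_def)
    moreover have "\<tau> * norm (t *\<^sub>R w) = t * (\<tau> * norm w)" using t by simp
    ultimately have "0 \<le> \<sigma>1 * ((1 - t * (u1 \<bullet> w) + t\<^sup>2 * (norm w)\<^sup>2 / 2) + (1 + 2 * (t * \<sigma>2 * c)\<^sup>2))
       + \<sigma>2 * ((1 - t * (u2 \<bullet> w) + t\<^sup>2 * (norm w)\<^sup>2 / 2) + (1 + 2 * (t * \<sigma>1 * c)\<^sup>2)) + t * (\<tau> * norm w) - 2 * \<sigma>1 - 2 * \<sigma>2"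
      using ineq[OF t] by linarith
    also have "\<dots> = t * (K * t + \<tau> * norm w - (\<sigma>1 * (u1 \<bullet> w) + \<sigma>2 * (u2 \<bullet> w)))"
      by (simp add: K_def power2_eq_square field_simps)
    finally have "0 \<le> K * t + \<tau> * norm w - (\<sigma>1 * (u1 \<bullet> w) + \<sigma>2 * (u2 \<bullet> w))"
      using t by (simp add: zero_le_mult_iff)
    then show ?thesis unfolding ww by linarith
  qed
  then have "(norm w)\<^sup>2 - \<tau> * norm w \<le> 0" by (rule small_of_linear_bound[OF _ e])
  then have "norm w * norm w \<le> \<tau> * norm w" by (simp add: power2_eq_square)
  then have "norm w \<le> \<tau>" using \<sigma>(3) by (cases "norm w = 0") (auto simp: mult_le_cancel_right)
  then show ?thesis unfolding w_def \<sigma>1_def \<sigma>2_def \<tau>_def u1_def u2_def .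
qed

section \<open>Trigonometry of the triangle of tensions\<close>

text \<open>The triangle with sides \<open>a + b\<close>, \<open>a + c\<close>, \<open>b + c\<close> has the angle \<open>\<pi> - 2 half_angle a b c\<close> between
  the first two of them.\<close>

definition half_angle :: "real \<Rightarrow> real \<Rightarrow> real \<Rightarrow> real" where
  "half_angle a b c = arccos (sqrt (b * c / ((a + b) * (a + c))))"

lemma half_angle_commute: "half_angle a b c = half_angle a c b"
  by (simp add: half_angle_def mult.commute)

context
  fixes a b c :: real
  assumes pos: "0 < a" "0 < b" "0 < c"
begin

text \<open>The sides \<open>a + b\<close>, \<open>a + c\<close>, \<open>b + c\<close> have
  semiperimeter \<open>a + b + c\<close>; the two ratios are those of the classical half-angle
  formulas, and the third claim is the Pythagorean relation between them.\<close>

lemma half_angle_ratio: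
  "0 < b * c / ((a + b) * (a + c))" "b * c / ((a + b) * (a + c)) < 1"
  "1 - b * c / ((a + b) * (a + c)) = a * (a + b + c) / ((a + b) * (a + c))"
proof -
  have d: "0 < (a + b) * (a + c)" using pos by simp
  show "0 < b * c / ((a + b) * (a + c))" using pos by simp
  have "0 < a * (a + b + c)" using pos by simp
  moreover have "(a + b) * (a + c) = b * c + a * (a + b + c)" by (simp add: algebra_simps)
  ultimately show "b * c / ((a + b) * (a + c)) < 1" using d by (simp add: divide_less_eq)
  show "1 - b * c / ((a + b) * (a + c)) = a * (a + b + c) / ((a + b) * (a + c))"
  proof -
    have "1 - b * c / ((a + b) * (a + c)) = ((a + b) * (a + c) - b * c) / ((a + b) * (a + c))"
      by (simp only: diff_divide_distrib divide_self[OF less_imp_neq[OF d, symmetric]])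
    also have "(a + b) * (a + c) - b * c = a * (a + b + c)" by (simp add: algebra_simps)
    finally show ?thesis .
  qed
qed

lemma cos_half_angle: "cos (half_angle a b c) = sqrt (b * c / ((a + b) * (a + c)))"
proof -
  have "0 \<le> sqrt (b * c / ((a + b) * (a + c)))" "sqrt (b * c / ((a + b) * (a + c))) \<le> 1"
    using half_angle_ratio by auto
  then show ?thesis unfolding half_angle_def by (intro cos_arccos) linarith+
qed

lemma half_angle_bounds: "0 < half_angle a b c" "half_angle a b c < pi / 2"
proof -
  let ?q = "sqrt (b * c / ((a + b) * (a + c)))"
  have q: "0 < ?q" "?q < 1" using half_angle_ratio by auto
  show "0 < half_angle a b c" unfolding half_angle_def using q arccos_lt_bounded[of ?q] by linarith
  have "arccos ?q < arccos 0" using q by (intro arccos_less_arccos) auto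
  then show "half_angle a b c < pi / 2" unfolding half_angle_def by simp
qed

lemma sin_half_angle: "sin (half_angle a b c) = sqrt (a * (a + b + c) / ((a + b) * (a + c)))"
proof -
  have "0 \<le> sin (half_angle a b c)" using half_angle_bounds by (intro sin_ge_zero) auto
  moreover have "(sin (half_angle a b c))\<^sup>2 = 1 - b * c / ((a + b) * (a + c))"
    using sin_cos_squared_add[of "half_angle a b c"] half_angle_ratio(1) unfolding cos_half_angle by simp
  ultimately show ?thesis unfolding half_angle_ratio(3) using real_sqrt_unique by metis
qed

lemma cos_double_half_angle: "cos (2 * half_angle a b c) = 2 * (b * c / ((a + b) * (a + c))) - 1"
  unfolding cos_double_cos cos_half_angle using half_angle_ratio(1) by simp

text \<open>The law of sines: the right side is symmetric in \<open>a\<close>, \<open>b\<close>,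
  \<open>c\<close>, and its square root is Heron's formula for the area of the triangle.\<close>

lemma sin_double_half_angle:
  "sin (2 * half_angle a b c) / (b + c) = 2 * sqrt (a * b * c * (a + b + c)) / ((a + b) * (a + c) * (b + c))"
proof -
  have d: "0 < (a + b) * (a + c)" using pos by simp
  have "sin (2 * half_angle a b c) = 2 * sqrt ((a * (a + b + c) / ((a + b) * (a + c))) * (b * c / ((a + b) * (a + c))))"
    unfolding sin_double sin_half_angle cos_half_angle by (simp only: real_sqrt_mult mult.assoc)
  also have "(a * (a + b + c) / ((a + b) * (a + c))) * (b * c / ((a + b) * (a + c))) = (a * b * c * (a + b + c)) / ((a + b) * (a + c))\<^sup>2"
    by (simp add: power2_eq_square mult_ac)
  also have "sqrt \<dots> = sqrt (a * b * c * (a + b + c)) / ((a + b) * (a + c))"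
    using d by (simp add: real_sqrt_divide)
  finally show ?thesis by simp
qed

end

text \<open>The angle sum of the triangle, whose angles are \<open>pi\<close> minus twice the three
  terms. With \<open>Q\<close> the square of the third cosine, the addition theorem collapses to
  \<open>- sqrt Q\<close>, and cosine is injective on the interval from 0 to
  \<open>pi\<close>.\<close>

lemma half_angle_sum:
  assumes pos: "0 < a" "0 < b" "0 < c"
  shows "half_angle a b c + half_angle b c a + half_angle c a b = pi"
proof -
  let ?x = "half_angle a b c" and ?y = "half_angle b c a" and ?z = "half_angle c a b"
  note X = half_angle_bounds[OF pos] and Y = half_angle_bounds[OF pos(2,3,1)] and Z = half_angle_bounds[OF pos(3,1,2)]
  define Q where "Q = a * b / ((a + c) * (b + c))"
  have "cos ?x * cos ?y = sqrt ((c / (a + b))\<^sup>2 * Q)"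
    unfolding cos_half_angle[OF pos] cos_half_angle[OF pos(2,3,1)] real_sqrt_mult[symmetric] Q_def
    by (simp add: power2_eq_square mult_ac add_ac)
  also have "\<dots> = c / (a + b) * sqrt Q" using pos by (simp add: real_sqrt_mult)
  finally have cc: "cos ?x * cos ?y = c / (a + b) * sqrt Q" .
  have "sin ?x * sin ?y = sqrt (((a + b + c) / (a + b))\<^sup>2 * Q)"
    unfolding sin_half_angle[OF pos] sin_half_angle[OF pos(2,3,1)] real_sqrt_mult[symmetric] Q_def
    by (simp add: power2_eq_square mult_ac add_ac)
  also have "\<dots> = (a + b + c) / (a + b) * sqrt Q" using pos by (simp add: real_sqrt_mult)
  finally have ss: "sin ?x * sin ?y = (a + b + c) / (a + b) * sqrt Q" .
  have "c / (a + b) - (a + b + c) / (a + b) = (c - (a + b + c)) / (a + b)"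
    by (rule diff_divide_distrib[symmetric])
  also have "c - (a + b + c) = - (a + b)" by simp
  also have "- (a + b) / (a + b) = - 1"
    unfolding minus_divide_left[symmetric] using pos by simp
  finally have "c / (a + b) - (a + b + c) / (a + b) = - 1" .
  then have "(c / (a + b) - (a + b + c) / (a + b)) * sqrt Q = - 1 * sqrt Q" by (simp only:)
  then have "cos (?x + ?y) = - sqrt Q"
    unfolding cos_add cc ss by (simp add: left_diff_distrib)
  also have "\<dots> = cos (pi - ?z)"
    unfolding cos_pi_minus cos_half_angle[OF pos(3,1,2)] Q_def add.commute[of a c] add.commute[of b c] by (rule refl)
  finally have e: "cos (?x + ?y) = cos (pi - ?z)" .
  have "?x + ?y = pi - ?z"
    by (rule cos_inj_pi[OF _ _ _ _ e]) (use X Y Z in linarith)+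
  then show ?thesis by simp
qed

text \<open>Arithmetic modulo 3 supplies the two other labels; their order is immaterial by
  \<open>half_angle_commute\<close>.\<close>

definition tip_angle :: "(nat \<Rightarrow> real) \<Rightarrow> nat \<Rightarrow> real" where
  "tip_angle \<alpha> l = 2 * half_angle (\<alpha> l) (\<alpha> ((l + 1) mod 3)) (\<alpha> ((l + 2) mod 3))"

lemma tip_angle_simps:
  "tip_angle \<alpha> 0 = 2 * half_angle (\<alpha> 0) (\<alpha> (Suc 0)) (\<alpha> 2)"
  "tip_angle \<alpha> (Suc 0) = 2 * half_angle (\<alpha> (Suc 0)) (\<alpha> 2) (\<alpha> 0)"
  "tip_angle \<alpha> 2 = 2 * half_angle (\<alpha> 2) (\<alpha> 0) (\<alpha> (Suc 0))"
  by (simp_all add: tip_angle_def numeral_2_eq_2)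

lemma tip_angle_eq:
  assumes "i \<le> 2" "j \<le> 2" "k \<le> 2" "i \<noteq> j" "j \<noteq> k" "i \<noteq> k"
  shows "tip_angle \<alpha> j = 2 * half_angle (\<alpha> j) (\<alpha> i) (\<alpha> k)"
proof -
  have "i = 0 \<or> i = Suc 0 \<or> i = 2" "j = 0 \<or> j = Suc 0 \<or> j = 2" "k = 0 \<or> k = Suc 0 \<or> k = 2" using assms by auto
  then show ?thesis
    using assms(4-6) by (elim disjE) (simp_all add: tip_angle_simps half_angle_commute)
qed

text \<open>By the law of cosines, the bound on \<open>norm ?w\<close> says that the cosine of the
  opening is at most that of the tip angle. Openings of at least \<open>pi\<close> exceed every tip
  angle anyway.\<close>

lemma tip_angle_le:
  assumes fan: "fan m \<theta> \<Lambda> A" and m: "3 \<le> m" and V: "V_minimal \<alpha> A"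
    and cone: "\<And>l. l \<le> 2 \<Longrightarrow> cone_at_origin (A l)" and \<alpha>: "\<And>l. l \<le> 2 \<Longrightarrow> 0 < \<alpha> l"
  shows "tip_angle \<alpha> (\<Lambda> 1) \<le> \<theta> 2 - \<theta> 1"
proof (cases "\<theta> 2 - \<theta> 1 < pi")
  case False
  have "(l + 1) mod 3 \<le> 2" "(l + 2) mod 3 \<le> 2" for l :: nat by (auto simp: less_Suc_eq_le[symmetric])
  then have "half_angle (\<alpha> (\<Lambda> 1)) (\<alpha> ((\<Lambda> 1 + 1) mod 3)) (\<alpha> ((\<Lambda> 1 + 2) mod 3)) < pi / 2"
    using fan_label_le[OF fan] by (intro half_angle_bounds \<alpha>)
  then show ?thesis using False unfolding tip_angle_def by linarith
next
  case True
  define i j k where "i = \<Lambda> 0" and "j = \<Lambda> 1" and "k = \<Lambda> 2"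
  have le2: "i \<le> 2" "j \<le> 2" "k \<le> 2" using fan_label_le[OF fan] by (auto simp: i_def j_def k_def)
  have ij: "i \<noteq> j" "j \<noteq> k" using fan_jump[OF fan, of 0] fan_jump[OF fan, of 1] by (auto simp: i_def j_def k_def numeral_2_eq_2)
  define \<gamma> where "\<gamma> = \<theta> 2 - \<theta> 1"
  have \<gamma>: "0 < \<gamma>" "\<gamma> < pi" using fan_less[OF fan, of 1] True by (auto simp: \<gamma>_def numeral_2_eq_2)
  define P Q where "P = \<alpha> i + \<alpha> j" and "Q = \<alpha> j + \<alpha> k"
  have PQ: "0 < P" "0 < Q" using \<alpha> le2 by (auto simp: P_def Q_def intro!: add_pos_pos)
  let ?w = "P *\<^sub>R dir (\<theta> 1) + Q *\<^sub>R dir (\<theta> 2)"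
  have w: "norm ?w \<le> (if i = k then 0 else \<alpha> i + \<alpha> k)"
    using tip_splitting[OF fan m V cone \<alpha> True] by (simp only: P_def Q_def i_def j_def k_def)
  \<comment> \<open>The component of \<open>?w\<close> transversal to the first ray does not vanish.
    So \<open>?w\<close> is nonzero, which excludes \<open>i = k\<close>, where its norm would be at
    most 0.\<close>
  have "cross2 (dir (\<theta> 1)) ?w = Q * sin \<gamma>" by (simp add: cross2_simps cross2_dir \<gamma>_def)
  moreover have "0 < Q * sin \<gamma>" using PQ sin_gt_zero[OF \<gamma>] by simp
  moreover have "cross2 (dir (\<theta> 1)) 0 = 0" by (simp add: cross2_simps)
  ultimately have "?w \<noteq> 0" by (metis less_irrefl)
  then have ik: "i \<noteq> k" using w by (auto split: if_splits)
  have "(norm ?w)\<^sup>2 \<le> (\<alpha> i + \<alpha> k)\<^sup>2"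
    using w ik by (intro power_mono) auto
  also have "(norm ?w)\<^sup>2 = P\<^sup>2 + Q\<^sup>2 + 2 * P * Q * cos \<gamma>"
  proof -
    have "cos (\<theta> 1 - \<theta> 2) = cos \<gamma>" using cos_minus[of \<gamma>] by (simp add: \<gamma>_def)
    then show ?thesis
      unfolding power2_norm_eq_inner inner_add_left inner_add_right inner_scaleR_left inner_scaleR_right inner_dir
      by (simp add: \<gamma>_def power2_eq_square algebra_simps)
  qed
  finally have le: "2 * P * Q * cos \<gamma> \<le> (\<alpha> i + \<alpha> k)\<^sup>2 - P\<^sup>2 - Q\<^sup>2" by simp
  also have "\<dots> = 2 * P * Q * (2 * (\<alpha> i * \<alpha> k / ((\<alpha> j + \<alpha> i) * (\<alpha> j + \<alpha> k))) - 1)"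
  proof -
    have pq: "(\<alpha> j + \<alpha> i) * (\<alpha> j + \<alpha> k) = P * Q" by (simp add: P_def Q_def)
    have "2 * P * Q * (2 * (\<alpha> i * \<alpha> k / (P * Q)) - 1) = 4 * (\<alpha> i * \<alpha> k) - 2 * P * Q"
      using PQ by (simp add: right_diff_distrib)
    also have "\<dots> = (\<alpha> i + \<alpha> k)\<^sup>2 - P\<^sup>2 - Q\<^sup>2" by (simp add: P_def Q_def power2_eq_square algebra_simps)
    finally show ?thesis unfolding pq by simp
  qed
  also have "\<dots> = 2 * P * Q * cos (tip_angle \<alpha> j)"
    unfolding tip_angle_eq[OF le2 ij ik] using \<alpha> le2 by (subst cos_double_half_angle) auto
  finally have "cos \<gamma> \<le> cos (tip_angle \<alpha> j)" using PQ by (simp add: mult_le_cancel_left_pos)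
  moreover have "tip_angle \<alpha> j \<le> pi"
    unfolding tip_angle_eq[OF le2 ij ik] using half_angle_bounds(2)[of "\<alpha> j" "\<alpha> i" "\<alpha> k"] \<alpha> le2 by simp
  ultimately have "tip_angle \<alpha> j \<le> \<gamma>"
    using cos_monotone_0_pi[of \<gamma> "tip_angle \<alpha> j"] \<gamma> by (cases "tip_angle \<alpha> j \<le> \<gamma>") auto
  then show ?thesis by (simp add: j_def \<gamma>_def)
qed

section \<open>Equality in the angle sum\<close>

lemma connected_sector: "connected (sector \<theta> \<gamma>)"
proof -
  have "sector \<theta> \<gamma> = (\<lambda>(r, t). r *\<^sub>R dir t) ` ({0<..} \<times> {\<theta><..<\<theta> + \<gamma>})"
    by (force simp: mem_sector)
  moreover have "connected ({0<..} \<times> {\<theta><..<\<theta> + \<gamma>} :: (real \<times> real) set)"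
    by (intro connected_Times convex_connected) (auto simp: convex_real_interval)
  moreover have "continuous_on ({0<..} \<times> {\<theta><..<\<theta> + \<gamma>}) (\<lambda>(r, t). r *\<^sub>R dir t)"
    unfolding split_beta by (intro continuous_intros continuous_on_compose2[OF continuous_dir[of UNIV]]) auto
  ultimately show ?thesis by (metis connected_continuous_image)
qed

lemma D_minimal_imp_V_minimal: "D_minimal \<alpha> A \<Longrightarrow> V_minimal \<alpha> A"
  by (auto simp: D_minimal_def V_minimal_def)

text \<open>One sector of each label already uses up the full turn, since the three tip angles add
  up to \<open>2 * pi\<close>. Further sectors or a larger opening would exceed it.\<close>

lemma minimal_cone_sectors:
  assumes V: "V_minimal \<alpha> A" and cone: "\<forall>j\<le>2. cone_at_origin (A j)" and ne: "\<forall>j\<le>2. A j \<noteq> {}"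
    and \<alpha>: "\<forall>j\<le>2. 0 < \<alpha> j" and l: "l \<le> 2"
  shows "\<exists>t. A l = sector t (tip_angle \<alpha> l)"
proof -
  have "permissible A" using V by (simp add: V_minimal_def)
  then obtain m \<theta> \<Lambda> where fan: "fan m \<theta> \<Lambda> A" using fan_exists[OF _ cone ne] by blast
  have "\<exists>n<m. \<Lambda> n = l" if "l \<le> 2" for l
    using ne that fan_eq_finite[OF fan that] by auto
  then obtain N where N: "\<And>l. l \<le> 2 \<Longrightarrow> N l < m" "\<And>l. l \<le> 2 \<Longrightarrow> \<Lambda> (N l) = l" by metis
  have inj: "inj_on N {..2}" using N(2) by (metis atMost_iff inj_onI)
  have sub: "N ` {..2} \<subseteq> {..<m}" using N(1) by auto
  have m: "3 \<le> m" using card_mono[OF _ sub] card_image[OF inj] by simp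
  define \<gamma> where "\<gamma> n = \<theta> (Suc n) - \<theta> n" for n
  have g0: "0 < \<gamma> n" for n using fan_less[OF fan] by (simp add: \<gamma>_def)
  have ge: "tip_angle \<alpha> (\<Lambda> n) \<le> \<gamma> n" for n
  proof -
    \<comment> \<open>Moves sector \<open>n\<close> to index 1. The extra turn \<open>m\<close>
      avoids a negative shift when \<open>n = 0\<close>.\<close>
    let ?r = "n + m - 1"
    have i: "1 + ?r = n + m" "2 + ?r = Suc n + m" using m by auto
    have "tip_angle \<alpha> (\<Lambda> (1 + ?r)) \<le> \<theta> (2 + ?r) - \<theta> (1 + ?r)"
      using tip_angle_le[OF fan_shift[OF fan, of ?r] m V] cone \<alpha> by simp
    then show ?thesis unfolding i fan_period[OF fan] fan_label_period[OF fan] \<gamma>_def by simp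
  qed
  have total: "(\<Sum>n<m. \<gamma> n) = 2 * pi"
    using sum_lessThan_telescope[of \<theta> m] fan_period[OF fan, of 0] by (simp add: \<gamma>_def)
  have tips: "(\<Sum>l\<le>2. tip_angle \<alpha> l) = 2 * pi"
  proof -
    have "{..2::nat} = {0, Suc 0, 2}" by auto
    then have "(\<Sum>l\<le>2. tip_angle \<alpha> l) = tip_angle \<alpha> 0 + tip_angle \<alpha> (Suc 0) + tip_angle \<alpha> 2" by simp
    also have "\<dots> = 2 * pi"
      unfolding tip_angle_simps using half_angle_sum[of "\<alpha> 0" "\<alpha> (Suc 0)" "\<alpha> 2"] \<alpha> by simp
    finally show ?thesis .
  qed
  have "(\<Sum>n<m. \<gamma> n) = (\<Sum>n\<in>{..<m} - N ` {..2}. \<gamma> n) + (\<Sum>n\<in>N ` {..2}. \<gamma> n)"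
    using sub by (intro sum.subset_diff) auto
  also have "(\<Sum>n\<in>N ` {..2}. \<gamma> n) = (\<Sum>l\<le>2. \<gamma> (N l))" by (simp add: sum.reindex[OF inj])
  \<comment> \<open>Both summands are nonnegative, so both vanish: no sector is left over, and each
    chosen opening equals its tip angle.\<close>
  finally have eq: "(\<Sum>n\<in>{..<m} - N ` {..2}. \<gamma> n) + (\<Sum>l\<le>2. \<gamma> (N l) - tip_angle \<alpha> l) = 0"
    using total tips by (simp add: sum_subtractf)
  have nn: "0 \<le> \<gamma> (N l) - tip_angle \<alpha> l" if "l \<in> {..2}" for l using ge[of "N l"] N(2)[of l] that by simp
  have a: "0 \<le> (\<Sum>n\<in>{..<m} - N ` {..2}. \<gamma> n)" using g0 by (intro sum_nonneg) (auto simp: less_imp_le)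
  have b: "0 \<le> (\<Sum>l\<le>2. \<gamma> (N l) - tip_angle \<alpha> l)" using nn by (rule sum_nonneg)
  have "(\<Sum>n\<in>{..<m} - N ` {..2}. \<gamma> n) = 0" "(\<Sum>l\<le>2. \<gamma> (N l) - tip_angle \<alpha> l) = 0" using eq a b by linarith+
  then have rest: "{..<m} \<subseteq> N ` {..2}" and tip: "\<gamma> (N l) = tip_angle \<alpha> l"
    using sum_nonneg_eq_0_iff[of "{..2}" "\<lambda>l. \<gamma> (N l) - tip_angle \<alpha> l"] nn l
      sum_pos[of "{..<m} - N ` {..2}" \<gamma>] g0 by (auto simp: less_le)
  have "{n. n < m \<and> \<Lambda> n = l} = {N l}"
  proof (intro equalityI subsetI)
    fix n assume "n \<in> {n. n < m \<and> \<Lambda> n = l}"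
    then obtain l' where "l' \<le> 2" "n = N l'" "\<Lambda> n = l" using rest by auto
    then show "n \<in> {N l}" using N(2)[of l'] by auto
  qed (use N l in auto)
  then have "A l = fan_sector \<theta> (N l)" using fan_eq_finite[OF fan l] by simp
  then have "A l = sector (\<theta> (N l)) (tip_angle \<alpha> l)" by (simp only: tip[symmetric] \<gamma>_def)
  then show ?thesis ..
qed

theorem theorem9p1:
  fixes \<sigma>01 \<sigma>02 \<sigma>12 :: real and \<alpha> :: "nat \<Rightarrow> real" and A :: "nat \<Rightarrow> (real^2) set"
  defines "\<alpha> \<equiv> tension_coeff \<sigma>01 \<sigma>02 \<sigma>12"
  assumes "\<forall>j\<le>2. 0 < \<alpha> j"
    and "D_minimal \<alpha> A \<or> V_minimal \<alpha> A"
    and "\<forall>j\<le>2. cone_at_origin (A j)"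
    and "\<forall>j\<le>2. A j \<noteq> {}"
  shows "(\<forall>j\<le>2. card (components (A j)) = 1) \<and>
    (\<exists>\<gamma>01 \<gamma>02 \<gamma>12.
       angle_within (A 0) \<gamma>12 \<and> angle_within (A 1) \<gamma>02 \<and> angle_within (A 2) \<gamma>01 \<and>
       sin \<gamma>01 / \<sigma>01 = sin \<gamma>02 / \<sigma>02 \<and> sin \<gamma>02 / \<sigma>02 = sin \<gamma>12 / \<sigma>12)"
proof -
  have V: "V_minimal \<alpha> A" using assms(3) D_minimal_imp_V_minimal by blast
  have sector: "\<exists>t. A l = sector t (tip_angle \<alpha> l)" if "l \<le> 2" for l
    using minimal_cone_sectors[OF V assms(4,5,2) that] .
  have comp: "card (components (A j)) = 1" if j: "j \<le> 2" for j
  proof -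
    have "components (A j) = {A j}"
      using sector[OF j] connected_sector assms(5) j by (auto simp: components_eq_sing_iff)
    then show ?thesis by simp
  qed
  have p: "0 < \<alpha> 0" "0 < \<alpha> 1" "0 < \<alpha> 2" using assms(2) by auto
  have tips: "tip_angle \<alpha> 0 = 2 * half_angle (\<alpha> 0) (\<alpha> 1) (\<alpha> 2)" "tip_angle \<alpha> 1 = 2 * half_angle (\<alpha> 1) (\<alpha> 0) (\<alpha> 2)"
    "tip_angle \<alpha> 2 = 2 * half_angle (\<alpha> 2) (\<alpha> 0) (\<alpha> 1)"
    by (rule tip_angle_eq; simp)+
  have within: "angle_within (A 0) (tip_angle \<alpha> 0)" "angle_within (A 1) (tip_angle \<alpha> 1)" "angle_within (A 2) (tip_angle \<alpha> 2)"
    using sector[of 0] sector[of 1] sector[of 2] half_angle_bounds[OF p] half_angle_bounds[OF p(2,1,3)] half_angle_bounds[OF p(3,1,2)]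
    unfolding angle_within_def tips by auto
  \<comment> \<open>Expressed by the \<open>\<alpha> j\<close>, the tension divided by in each
    quotient is the side opposite to the corresponding angle, which makes
    \<open>sin_double_half_angle\<close> applicable.\<close>
  have s: "\<sigma>12 = \<alpha> 1 + \<alpha> 2" "\<sigma>02 = \<alpha> 0 + \<alpha> 2" "\<sigma>01 = \<alpha> 0 + \<alpha> 1"
    by (simp_all add: \<alpha>_def tension_coeff_def field_simps)
  have "sin (tip_angle \<alpha> 2) / \<sigma>01 = sin (tip_angle \<alpha> 1) / \<sigma>02" "sin (tip_angle \<alpha> 1) / \<sigma>02 = sin (tip_angle \<alpha> 0) / \<sigma>12"
    unfolding tips s sin_double_half_angle[OF p] sin_double_half_angle[OF p(2,1,3)] sin_double_half_angle[OF p(3,1,2)]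
    by (simp_all add: mult_ac add_ac)
  then show ?thesis using comp within by blast
qed

end
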